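(* Let $\{X_n;n\ge1\}$ be a sequence of independent, identically distributed random variables in a sub-linear expectation space $(\Omega,\mathscr H,\widehat{\mathbb E})$ with $\lim_{c\to\infty}\widehat{\mathbb E}[(X_1^2-c)^+]=0$, $\widehat{\mathbb E}[X_1]=\widehat{\mathbb E}[-X_1]=0$ and $$C_{\mathbb V}\left[\frac{X_1^2}{\log\log|X_1|}\right]<\infty,$$ where $\log x=\ln(x\vee e)$. Put $S_n=\sum_{k=1}^nX_k$, $a_n=\sqrt{2n\log\log n}$, $\overline\sigma^2=\widehat{\mathbb E}[X_1^2]$, $\underline\sigma^2=\widehat{\mathcal E}[X_1^2]$ (with $\overline\sigma,\underline\sigma\ge0$), and let $C\{x_n\}$ denote the cluster set (set of limit points) of a sequence $\{x_n\}$ in $\mathbb R$. If $\mathbb V$ is continuous, then: (I) $$\mathbb V\left(C\Big\{\frac{S_n}{a_n}\Big\}=\Big[\liminf_{n\to\infty}\frac{S_n}{a_n},\ \limsup_{n\to\infty}\frac{S_n}{a_n}\Big]=[-\overline\sigma,\overline\sigma]\right)=1;$$ (II) $$\mathcal V\left(\underline\sigma\le\limsup_{n\to\infty}\frac{S_n}{a_n}\le\overline\sigma\right)=1\quad\text{and}\quad\mathcal V\left(-\overline\sigma\le\liminf_{n\to\infty}\frac{S_n}{a_n}\le-\underline\sigma\right)=1;$$ (III) $$\mathcal V\left([-\overline\sigma,\overline\sigma]\supset C\Big\{\frac{S_n}{a_n}\Big\}=\Big[\liminf_{n\to\infty}\frac{S_n}{a_n},\ \limsup_{n\to\infty}\frac{S_n}{a_n}\Big]\supset[-\underline\sigma,\underline\sigma]\right)=1.$$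 If instead $\mathbb V^{\ast}$ is continuous and $\widehat{\mathbb E}$ is countably sub-additive, then the conclusions (I), (II) and (III) also hold with $\mathcal V$ replaced by $\mathcal V^{\ast}$.
   Context: Let $(\Omega,\mathcal F)$ be a measurable space and $\mathscr H$ a linear space of real-valued $\mathcal F$-measurable functions on $\Omega$ such that $\varphi(X_1,\ldots,X_n)\in\mathscr H$ whenever $X_1,\ldots,X_n\in\mathscr H$ and $\varphi\in C_{l,Lip}(\mathbb R^n)$, where $C_{l,Lip}(\mathbb R^n)$ is the space of functions $\varphi:\mathbb R^n\to\mathbb R$ with $|\varphi(x)-\varphi(y)|\le C(1+|x|^m+|y|^m)|x-y|$ for all $x,y\in\mathbb R^n$, for some $C>0$, $m\in\mathbb N$ depending on $\varphi$. Elements of $\mathscr H$ are called random variables. A sub-linear expectation is a map $\widehat{\mathbb E}:\mathscr H\to[-\infty,\infty]$ such that for all $X,Y\in\mathscr H$: $X\ge Y$ implies $\widehat{\mathbb E}[X]\ge\widehat{\mathbb E}[Y]$; $\widehat{\mathbb E}[c]=c$ for constants $c$; $\widehat{\mathbb E}[X+Y]\le\widehat{\mathbb E}[X]+\widehat{\mathbb E}[Y]$ whenever the right side is not of the form $+\infty-\infty$ or $-\infty+\infty$; $\widehat{\mathbb E}[\lambda X]=\lambda\widehat{\mathbb E}[X]$ for $\lambda\ge0$. The triple $(\Omega,\mathscr H,\widehat{\mathbb E})$ is a sub-linear expectation space. The conjugate expectation is $\widehat{\mathcal E}[X]=-\widehat{\mathbb E}[-X]$. $\widehat{\mathbb E}$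 is countably sub-additive if $\widehat{\mathbb E}[X]\le\sum_{n=1}^\infty\widehat{\mathbb E}[X_n]$ whenever $X\le\sum_{n=1}^\infty X_n$, $X,X_n\in\mathscr H$, $X\ge0$, $X_n\ge0$. Capacities: for $A\in\mathcal F$, $\mathbb V(A)=\inf\{\widehat{\mathbb E}[\xi]: I_A\le\xi,\ \xi\in\mathscr H\}$, $\mathcal V(A)=1-\mathbb V(A^c)$, $\mathbb V^{\ast}(A)=\inf\{\sum_{n=1}^\infty\mathbb V(A_n): A\subset\bigcup_{n=1}^\infty A_n,\ A_n\in\mathcal F\}$, $\mathcal V^{\ast}(A)=1-\mathbb V^{\ast}(A^c)$. A capacity $V:\mathcal F\to[0,1]$ is continuous if $V(A_n)\uparrow V(A)$ whenever $A_n\uparrow A$ and $V(A_n)\downarrow V(A)$ whenever $A_n\downarrow A$ ($A_n,A\in\mathcal F$). Choquet expectation: $C_{\mathbb V}[X]=\int_0^\infty\mathbb V(X\ge t)\,dt+\int_{-\infty}^0[\mathbb V(X\ge t)-1]\,dt$. Identical distribution: $\{X_n\}$ is identically distributed if for each $i$, $\widehat{\mathbb E}[\varphi(X_i)]=\widehat{\mathbb E}[\varphi(X_1)]$ for all $\varphi\in C_{l,Lip}(\mathbb R)$ whenever the sub-linear expectations are finite. Independence: a random vector $\boldsymbol Y=(Y_1,\ldots,Y_n)$ (with $Y_i\in\mathscr H$) is independent to $\boldsymbol X=(X_1,\ldots,X_m)$ (with $X_i\in\mathscr H$) if for each $\varphi\in C_{l,Lip}(\mathbb R^m\times\mathbb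 R^n)$, $\widehat{\mathbb E}[\varphi(\boldsymbol X,\boldsymbol Y)]=\widehat{\mathbb E}\big[\widehat{\mathbb E}[\varphi(\boldsymbol x,\boldsymbol Y)]\big|_{\boldsymbol x=\boldsymbol X}\big]$ whenever $\overline\varphi(\boldsymbol x):=\widehat{\mathbb E}[|\varphi(\boldsymbol x,\boldsymbol Y)|]<\infty$ for all $\boldsymbol x$ and $\widehat{\mathbb E}[|\overline\varphi(\boldsymbol X)|]<\infty$. Random variables $X_1,X_2,\ldots$ are independent if $X_{i+1}$ is independent to $(X_1,\ldots,X_i)$ for each $i\ge1$. *)

theory Defs
  imports "HOL-Analysis.Analysis"
begin

text \<open>
  A vector of \<open>R^n\<close> is a function \<open>x :: nat \<Rightarrow> real\<close> of which only the coordinates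
  \<open>x 0, \<dots>, x (n - 1)\<close> matter. The estimate below forces \<open>\<phi> x = \<phi> y\<close> whenever \<open>x\<close> and \<open>y\<close>
  agree on these coordinates, so \<open>C_l_Lip n\<close> is exactly the space of locally Lipschitz functions
  of polynomial growth on \<open>R^n\<close>.
\<close>

definition vnorm :: "nat \<Rightarrow> (nat \<Rightarrow> real) \<Rightarrow> real" where
  "vnorm n x = L2_set x {..<n}"

definition C_l_Lip :: "nat \<Rightarrow> ((nat \<Rightarrow> real) \<Rightarrow> real) set" where
  "C_l_Lip n = {\<phi>. \<exists>C>0. \<exists>m::nat. \<forall>x y.
     \<bar>\<phi> x - \<phi> y\<bar> \<le> C * (1 + vnorm n x ^ m + vnorm n y ^ m) * vnorm n (\<lambda>i. x i - y i)}"

lemma C_l_Lip_cong: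
  assumes "\<phi> \<in> C_l_Lip n" "\<And>i. i < n \<Longrightarrow> x i = y i"
  shows "\<phi> x = \<phi> y"
proof -
  have "vnorm n (\<lambda>i. x i - y i) = 0"
    using assms(2) by (simp add: vnorm_def L2_set_def)
  moreover obtain C m where
    "\<bar>\<phi> x - \<phi> y\<bar> \<le> C * (1 + vnorm n x ^ m + vnorm n y ^ m) * vnorm n (\<lambda>i. x i - y i)"
    using assms(1) unfolding C_l_Lip_def by blast
  ultimately show ?thesis by simp
qed

text \<open>
  \<open>\<Omega> = space M\<close> and the sigma-algebra is \<open>sets M\<close>; no measure is involved, \<open>emeasure M\<close> is
  never used. Comparisons of random variables are made on \<open>space M\<close> only, hence by monotonicity
  \<open>E\<close> ignores the values of a function outside \<open>space M\<close>. The values of \<open>E\<close> outside \<open>H\<close> are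
  irrelevant.
\<close>

definition random_variable_space :: "'a measure \<Rightarrow> ('a \<Rightarrow> real) set \<Rightarrow> bool" where
  "random_variable_space M H \<longleftrightarrow>
     H \<subseteq> borel_measurable M \<and>
     (\<lambda>_. 0) \<in> H \<and>
     (\<forall>X\<in>H. \<forall>Y\<in>H. (\<lambda>\<omega>. X \<omega> + Y \<omega>) \<in> H) \<and>
     (\<forall>c. \<forall>X\<in>H. (\<lambda>\<omega>. c * X \<omega>) \<in> H) \<and>
     (\<forall>n. \<forall>X. \<forall>\<phi>\<in>C_l_Lip n. (\<forall>i<n. X i \<in> H) \<longrightarrow> (\<lambda>\<omega>. \<phi> (\<lambda>i. X i \<omega>)) \<in> H)"

definition sublinear_expectation_space ::
  "'a measure \<Rightarrow> ('a \<Rightarrow> real) set \<Rightarrow> (('a \<Rightarrow> real) \<Rightarrow> ereal) \<Rightarrow> bool" where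
  "sublinear_expectation_space M H E \<longleftrightarrow>
     random_variable_space M H \<and>
     (\<forall>X\<in>H. \<forall>Y\<in>H. (\<forall>\<omega>\<in>space M. X \<omega> \<ge> Y \<omega>) \<longrightarrow> E X \<ge> E Y) \<and>
     (\<forall>c. E (\<lambda>_. c) = ereal c) \<and>
     (\<forall>X\<in>H. \<forall>Y\<in>H. \<not> (E X = \<infinity> \<and> E Y = -\<infinity>) \<and> \<not> (E X = -\<infinity> \<and> E Y = \<infinity>) \<longrightarrow>
        E (\<lambda>\<omega>. X \<omega> + Y \<omega>) \<le> E X + E Y) \<and>
     (\<forall>X\<in>H. \<forall>c\<ge>0. E (\<lambda>\<omega>. c * X \<omega>) = ereal c * E X)"

definition conj_exp :: "(('a \<Rightarrow> real) \<Rightarrow> ereal) \<Rightarrow> ('a \<Rightarrow> real) \<Rightarrow> ereal" where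
  "conj_exp E X = - E (\<lambda>\<omega>. - X \<omega>)"

definition countably_subadditive_exp ::
  "'a measure \<Rightarrow> ('a \<Rightarrow> real) set \<Rightarrow> (('a \<Rightarrow> real) \<Rightarrow> ereal) \<Rightarrow> bool" where
  "countably_subadditive_exp M H E \<longleftrightarrow>
     (\<forall>X\<in>H. \<forall>Y :: nat \<Rightarrow> 'a \<Rightarrow> real. (\<forall>n. Y n \<in> H) \<longrightarrow>
        (\<forall>\<omega>\<in>space M. 0 \<le> X \<omega>) \<longrightarrow> (\<forall>n. \<forall>\<omega>\<in>space M. 0 \<le> Y n \<omega>) \<longrightarrow>
        (\<forall>\<omega>\<in>space M. ereal (X \<omega>) \<le> (\<Sum>n. ereal (Y n \<omega>))) \<longrightarrow>
        E X \<le> (\<Sum>n. E (Y n)))"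

definition upper_cap ::
  "'a measure \<Rightarrow> ('a \<Rightarrow> real) set \<Rightarrow> (('a \<Rightarrow> real) \<Rightarrow> ereal) \<Rightarrow> 'a set \<Rightarrow> ereal" where
  "upper_cap M H E A = Inf {E \<xi> | \<xi>. \<xi> \<in> H \<and> (\<forall>\<omega>\<in>space M. indicator A \<omega> \<le> \<xi> \<omega>)}"

definition outer_cap :: "'a measure \<Rightarrow> ('a set \<Rightarrow> ereal) \<Rightarrow> 'a set \<Rightarrow> ereal" where
  "outer_cap M V A =
     Inf {(\<Sum>n. V (B n)) | B :: nat \<Rightarrow> 'a set. range B \<subseteq> sets M \<and> A \<subseteq> (\<Union>n. B n)}"

definition conj_cap :: "'a measure \<Rightarrow> ('a set \<Rightarrow> ereal) \<Rightarrow> 'a set \<Rightarrow> ereal" where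
  "conj_cap M V A = 1 - V (space M - A)"

definition continuous_cap :: "'a measure \<Rightarrow> ('a set \<Rightarrow> ereal) \<Rightarrow> bool" where
  "continuous_cap M V \<longleftrightarrow>
     (\<forall>A. range A \<subseteq> sets M \<longrightarrow> incseq A \<longrightarrow>
        incseq (\<lambda>n. V (A n)) \<and> (\<lambda>n. V (A n)) \<longlonglongrightarrow> V (\<Union>n. A n)) \<and>
     (\<forall>A. range A \<subseteq> sets M \<longrightarrow> decseq A \<longrightarrow>
        decseq (\<lambda>n. V (A n)) \<and> (\<lambda>n. V (A n)) \<longlonglongrightarrow> V (\<Inter>n. A n))"

text \<open>
  The integrand \<open>V (X \<ge> t) - 1\<close> on the negative half-line is nonpositive, so its integral is minus
  the nonnegative integral of \<open>1 - V (X \<ge> t)\<close>.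
\<close>

definition choquet :: "'a measure \<Rightarrow> ('a set \<Rightarrow> ereal) \<Rightarrow> ('a \<Rightarrow> real) \<Rightarrow> ereal" where
  "choquet M V X =
     enn2ereal (\<integral>\<^sup>+ t\<in>{0..}. e2ennreal (V {\<omega>\<in>space M. X \<omega> \<ge> t}) \<partial>lborel)
   - enn2ereal (\<integral>\<^sup>+ t\<in>{..0}. e2ennreal (1 - V {\<omega>\<in>space M. X \<omega> \<ge> t}) \<partial>lborel)"

text \<open>
  Sequences of random variables are indexed from 1; \<open>X 0\<close> is never used.
  \<open>\<phi>\<close> ranges over functions of one variable, so \<open>\<phi> (\<lambda>_. X i \<omega>)\<close> is \<open>\<phi>(X\<^sub>i)\<close>.
\<close>

definition identically_distributed ::
  "(('a \<Rightarrow> real) \<Rightarrow> ereal) \<Rightarrow> (nat \<Rightarrow> 'a \<Rightarrow> real) \<Rightarrow> bool" where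
  "identically_distributed E X \<longleftrightarrow>
     (\<forall>i\<ge>1. \<forall>\<phi>\<in>C_l_Lip 1.
        \<bar>E (\<lambda>\<omega>. \<phi> (\<lambda>_. X i \<omega>))\<bar> \<noteq> \<infinity> \<longrightarrow> \<bar>E (\<lambda>\<omega>. \<phi> (\<lambda>_. X 1 \<omega>))\<bar> \<noteq> \<infinity> \<longrightarrow>
        E (\<lambda>\<omega>. \<phi> (\<lambda>_. X i \<omega>)) = E (\<lambda>\<omega>. \<phi> (\<lambda>_. X 1 \<omega>)))"

definition vappend :: "nat \<Rightarrow> (nat \<Rightarrow> real) \<Rightarrow> (nat \<Rightarrow> real) \<Rightarrow> nat \<Rightarrow> real" where
  "vappend m x y = (\<lambda>k. if k < m then x k else y (k - m))"

text \<open>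
  \<open>independent_to H E n Y m X\<close>: the vector \<open>(Y 0, \<dots>, Y (n - 1))\<close> is independent to
  \<open>(X 0, \<dots>, X (m - 1))\<close>. Here \<open>\<phi>bar x = E |\<phi>(x, Y)|\<close> and \<open>\<psi> x = E \<phi>(x, Y)\<close>. If \<open>\<phi>bar\<close> is finite
  everywhere, so is \<open>\<psi>\<close>, hence the conversions to \<open>real\<close> lose nothing. As \<open>E\<close> is defined on \<open>H\<close>
  only, the outer expectations require \<open>\<phi>bar(X)\<close> and \<open>\<psi>(X)\<close> to lie in \<open>H\<close>; this is
  automatic, for instance, for bounded Lipschitz \<open>\<phi>\<close>.
\<close>

definition independent_to ::
  "('a \<Rightarrow> real) set \<Rightarrow> (('a \<Rightarrow> real) \<Rightarrow> ereal) \<Rightarrow>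
   nat \<Rightarrow> (nat \<Rightarrow> 'a \<Rightarrow> real) \<Rightarrow> nat \<Rightarrow> (nat \<Rightarrow> 'a \<Rightarrow> real) \<Rightarrow> bool" where
  "independent_to H E n Y m X \<longleftrightarrow>
     (\<forall>\<phi>\<in>C_l_Lip (m + n).
        let \<phi>bar = (\<lambda>x. E (\<lambda>\<omega>. \<bar>\<phi> (vappend m x (\<lambda>j. Y j \<omega>))\<bar>));
            \<psi> = (\<lambda>x. E (\<lambda>\<omega>. \<phi> (vappend m x (\<lambda>j. Y j \<omega>))))
        in (\<forall>x. \<phi>bar x < \<infinity>) \<longrightarrow>
           (\<lambda>\<omega>. real_of_ereal (\<phi>bar (\<lambda>i. X i \<omega>))) \<in> H \<longrightarrow>
           (\<lambda>\<omega>. real_of_ereal (\<psi> (\<lambda>i. X i \<omega>))) \<in> H \<longrightarrow>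
           E (\<lambda>\<omega>. \<bar>real_of_ereal (\<phi>bar (\<lambda>i. X i \<omega>))\<bar>) < \<infinity> \<longrightarrow>
           E (\<lambda>\<omega>. \<phi> (vappend m (\<lambda>i. X i \<omega>) (\<lambda>j. Y j \<omega>)))
             = E (\<lambda>\<omega>. real_of_ereal (\<psi> (\<lambda>i. X i \<omega>))))"

definition independent_seq ::
  "('a \<Rightarrow> real) set \<Rightarrow> (('a \<Rightarrow> real) \<Rightarrow> ereal) \<Rightarrow> (nat \<Rightarrow> 'a \<Rightarrow> real) \<Rightarrow> bool" where
  "independent_seq H E X \<longleftrightarrow>
     (\<forall>i\<ge>1. independent_to H E 1 (\<lambda>_. X (i + 1)) i (\<lambda>k. X (k + 1)))"

definition log_e :: "real \<Rightarrow> real" where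
  "log_e x = ln (max x (exp 1))"

definition cluster_set :: "(nat \<Rightarrow> real) \<Rightarrow> real set" where
  "cluster_set x = {y. \<exists>r :: nat \<Rightarrow> nat. strict_mono r \<and> (x \<circ> r) \<longlonglongrightarrow> y}"

end

(* A continuous capacity leaves no room for ambiguity. If a bounded Lipschitz f had
   -E[-f(X_1)] < E[f(X_1)], then over disjoint long blocks the averages of f(X_i) could be
   steered, by independence, towards either of the two values with upper expectation close to 1.
   The events "the first k block averages are near the lower mean and the next one is near the
   upper mean" would be disjoint, each of capacity at least 1/4, which contradicts continuity
   from above. Hence E is linear on bounded Lipschitz functions of X_1, X_2, ..., and coincides there
   with integration against the product measure whose marginal has distribution function
   V(X_1 <= t). Open sets are limits of bounded Lipschitz functions, so null sets of the product
   measure have capacity 0 and everything reduces to the Hartman-Wintner law of the iterated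
   logarithm.

   For the classical law the summands are truncated at the level tau sqrt(k / log log k), and the
   tails are removed by Kronecker's lemma. The upper bound follows from Ville's maximal inequality for
   the exponential martingale along geometric blocks; the lower bound cuts geometric blocks
   into about (log k) / s pieces and applies the central limit theorem to each of them. *)
theory Submission
  imports Defs "HOL-Probability.Probability" "HOL-Real_Asymp.Real_Asymp"
begin

section \<open>The iterated logarithm\<close>

text \<open>The capacity is not known to be additive. Events are therefore reached only through
  bounded Lipschitz functions squeezed against indicators, and a lower bound for the capacity of a
  complement needs its own limit (continuity from above) instead of a subtraction from 1. Bounded
  Lipschitz functions are the test class because integrating out a coordinate leaves them bounded
  and Lipschitz. The inner expectations then lie in \<open>H\<close>, so the independence hypothesis
  applies to them. Mean and variance belong to unbounded functions. They are recovered from clamped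
  functions, the error being controlled by the expectations of the positive parts of
  \<open>X_1^2 - c\<close>. Both cases of the theorem are one argument about an abstract
  \<open>W\<close> squeezed by \<open>E\<close>. Parts (II) and (III) follow from the exact values
  \<open>\<sigma>up\<close> and \<open>- \<sigma>up\<close> of the upper and lower limits, because
  the lower variance is at most the upper one.\<close>

definition loglog :: "real \<Rightarrow> real" where
  "loglog x = log_e (log_e x)"

definition lil_norm :: "real \<Rightarrow> real" where
  "lil_norm x = sqrt (2 * x * loglog x)"

text \<open>This level balances two demands: multiplied by an exponential tilt of order sqrt (loglog
  x / x) it stays bounded, and the sum of \<open>1 / lil_norm k\<close> over all k whose level is
  below t is only O(t), which a second moment can pay for.\<close>

definition trunc_level :: "real \<Rightarrow> real" where
  "trunc_level x = sqrt (x / loglog x)"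

section \<open>Growth of the iterated logarithm, the norming sequence and the truncation
  level\<close>

lemma log_e_ge_1: "1 \<le> log_e x"
proof -
  have "ln (exp 1) \<le> ln (max x (exp 1))"
    by (subst ln_le_cancel_iff) (auto simp: less_max_iff_disj)
  then show ?thesis by (simp add: log_e_def)
qed

lemma log_e_mono: "x \<le> y \<Longrightarrow> log_e x \<le> log_e y"
  unfolding log_e_def by (subst ln_le_cancel_iff) (auto simp: less_max_iff_disj)

text \<open>Clamping at e respects ratios: \<open>max y (exp 1)\<close> is at most y / x times
  \<open>max x (exp 1)\<close>. The rest is ln z <= z - 1 at z = y / x.\<close>

lemma log_e_le_add:
  assumes "0 < x" "x \<le> y"
  shows "log_e y \<le> log_e x + (y - x) / x"
proof -
  have m: "max y (exp 1) \<le> (y / x) * max x (exp 1)"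
  proof -
    have "1 \<le> y / x" using assms by simp
    then have "1 * exp 1 \<le> (y / x) * max x (exp 1)"
      by (intro mult_mono) auto
    moreover have "(y / x) * x \<le> (y / x) * max x (exp 1)"
      using assms by (intro mult_left_mono) auto
    ultimately show ?thesis using assms by simp
  qed
  have "log_e y \<le> ln ((y / x) * max x (exp 1))"
    unfolding log_e_def using m assms
    by (subst ln_le_cancel_iff) (auto simp: less_max_iff_disj zero_less_mult_iff)
  also have "\<dots> = ln (y / x) + log_e x"
    unfolding log_e_def using assms by (subst ln_mult_pos) (auto simp: less_max_iff_disj)
  also have "ln (y / x) \<le> y / x - 1"
    using assms by (intro ln_le_minus_one) auto
  finally show ?thesis using assms by (simp add: field_simps)
qed

lemma log_e_le_mult:
  assumes "0 < x" "x \<le> y"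
  shows "log_e y \<le> (y / x) * log_e x"
proof -
  have "log_e y \<le> log_e x + (y - x) / x * 1"
    using log_e_le_add[OF assms] by simp
  also have "\<dots> \<le> log_e x + (y - x) / x * log_e x"
    using assms log_e_ge_1[of x] by (intro add_mono mult_left_mono) auto
  also have "\<dots> = (y / x) * log_e x"
    using assms by (simp add: field_simps)
  finally show ?thesis .
qed

lemma loglog_ge_1: "1 \<le> loglog x"
  unfolding loglog_def by (rule log_e_ge_1)

lemma loglog_pos: "0 < loglog x"
  using loglog_ge_1[of x] by linarith

lemma loglog_mono: "x \<le> y \<Longrightarrow> loglog x \<le> loglog y"
  unfolding loglog_def by (intro log_e_mono)

text \<open>In other words loglog x / x is nonincreasing. This makes \<open>trunc_level\<close>
  monotone and lets \<open>lil_norm\<close> grow at most linearly.\<close>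

lemma loglog_le_mult:
  assumes "0 < x" "x \<le> y"
  shows "loglog y \<le> (y / x) * loglog x"
proof -
  have pos: "0 < log_e x" using log_e_ge_1[of x] by linarith
  have "loglog y \<le> (log_e y / log_e x) * loglog x"
    unfolding loglog_def using pos by (rule log_e_le_mult) (use assms log_e_mono in auto)
  also have "\<dots> \<le> (y / x) * loglog x"
  proof (rule mult_right_mono)
    show "log_e y / log_e x \<le> y / x"
      using log_e_le_mult[OF assms] pos by (simp add: field_simps)
  qed (use loglog_pos[of x] in simp)
  finally show ?thesis .
qed

lemma loglog_le_add:
  assumes "0 < x" "x \<le> y"
  shows "loglog y \<le> loglog x + (y - x) / (x * log_e x)"
proof -
  have pos: "0 < log_e x" using log_e_ge_1[of x] by linarith
  have "loglog y \<le> loglog x + (log_e y - log_e x) / log_e x"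
    unfolding loglog_def using pos by (rule log_e_le_add) (use assms log_e_mono in auto)
  also have "(log_e y - log_e x) / log_e x \<le> ((y - x) / x) / log_e x"
    using pos log_e_le_add[OF assms] by (intro divide_right_mono) auto
  finally show ?thesis using assms pos by (simp add: field_simps)
qed

lemma eventually_loglog_eq: "eventually (\<lambda>x. loglog x = ln (ln x)) at_top"
proof -
  have "eventually (\<lambda>x::real. exp 1 \<le> x) at_top" "eventually (\<lambda>x::real. exp (exp 1) \<le> x) at_top"
    by (rule eventually_ge_at_top)+
  then show ?thesis
  proof eventually_elim
    case (elim x)
    have "exp 1 \<le> ln x" using elim by (subst ln_ge_iff) (auto intro: less_le_trans[of 0 "exp (exp 1)"])
    with elim show ?case by (simp add: loglog_def log_e_def max_def)
  qed
qed

lemma lil_norm_pos: "0 < x \<Longrightarrow> 0 < lil_norm x"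
  using loglog_pos[of x] by (simp add: lil_norm_def)

lemma lil_norm_nonneg: "0 \<le> x \<Longrightarrow> 0 \<le> lil_norm x"
  using loglog_pos[of x] by (simp add: lil_norm_def)

lemma lil_norm_mono: "0 \<le> x \<Longrightarrow> x \<le> y \<Longrightarrow> lil_norm x \<le> lil_norm y"
  using loglog_mono[of x y] loglog_pos[of x] loglog_pos[of y]
  by (auto simp: lil_norm_def intro!: mult_mono)

lemma lil_norm_ge: "0 \<le> x \<Longrightarrow> sqrt x \<le> lil_norm x"
  using mult_left_mono[OF loglog_ge_1[of x], of "2 * x"] by (simp add: lil_norm_def)

lemma lil_norm_le_mult:
  assumes "0 < x" "x \<le> y"
  shows "lil_norm y \<le> (y / x) * lil_norm x"
proof -
  have "2 * y * loglog y \<le> 2 * y * ((y / x) * loglog x)"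
    using loglog_le_mult[OF assms] assms by (intro mult_left_mono) auto
  also have "\<dots> = (y / x)\<^sup>2 * (2 * x * loglog x)"
    using assms by (simp add: field_simps power2_eq_square)
  finally have "lil_norm y \<le> sqrt ((y / x)\<^sup>2 * (2 * x * loglog x))"
    unfolding lil_norm_def by simp
  also have "\<dots> = (y / x) * lil_norm x"
    using assms by (simp add: lil_norm_def real_sqrt_mult)
  finally show ?thesis .
qed

lemma filterlim_lil_norm: "filterlim (\<lambda>n. lil_norm (real n)) at_top sequentially"
proof (rule filterlim_at_top_mono)
  show "filterlim (\<lambda>n. sqrt (real n)) at_top sequentially"
    by real_asymp
qed (use lil_norm_ge in auto)

lemma trunc_level_nonneg: "0 \<le> x \<Longrightarrow> 0 \<le> trunc_level x"
  using loglog_pos[of x] by (simp add: trunc_level_def)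

lemma trunc_level_mono:
  assumes "0 < x" "x \<le> y"
  shows "trunc_level x \<le> trunc_level y"
  using loglog_le_mult[OF assms] loglog_pos[of x] loglog_pos[of y] assms
  by (simp add: trunc_level_def field_simps)

lemma trunc_level_mult: "0 < x \<Longrightarrow> trunc_level x * loglog x = lil_norm x / sqrt 2"
  using loglog_pos[of x] by (simp add: trunc_level_def lil_norm_def real_sqrt_mult real_sqrt_divide field_simps)

text \<open>Heuristically, sqrt (x / loglog x) has derivative 1 / (2 sqrt (x loglog x)) times 1 - 1
  / (log x loglog x). From 9 on, log (x - 1) is at least 2 because exp 2 < 8, so the last factor
  costs at most one half; the constant 4 leaves room for the discrete step.\<close>

lemma trunc_level_incr:
  assumes "9 \<le> x"
  shows "1 / lil_norm x \<le> 4 * (trunc_level x - trunc_level (x - 1))"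
proof -
  define l where "l = loglog x"
  define l' where "l' = loglog (x - 1)"
  define L where "L = log_e (x - 1)"
  have l: "1 \<le> l" "1 \<le> l'" "l' \<le> l"
    unfolding l_def l'_def by (auto intro: loglog_ge_1 loglog_mono)
  have "2 \<le> L"
  proof -
    have "exp (2::real) = exp 1 * exp 1" by (simp flip: exp_add)
    also have "\<dots> \<le> (272/100::real) * (272/100)" by (intro mult_mono less_imp_le[OF e_less_272]) auto
    finally have "exp (2::real) \<le> 8" by simp
    then have "exp 2 \<le> max (x - 1) (exp 1)" using assms by (simp add: le_max_iff_disj)
    then show ?thesis unfolding L_def log_e_def
      by (subst ln_ge_iff) (auto simp: less_max_iff_disj)
  qed
  \<comment> \<open>Over a unit step loglog grows by at most 1 / ((x - 1) L). Multiplied by x - 1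
    this is at most l' / 2, which is why x / loglog x still increases by at least 1 / (2 l).\<close>
  have "l \<le> l' + 1 / ((x - 1) * L)"
    using loglog_le_add[of "x - 1" x] assms by (simp add: l_def l'_def L_def)
  then have "(x - 1) * l \<le> (x - 1) * (l' + 1 / ((x - 1) * L))"
    using assms by (intro mult_left_mono) auto
  also have "\<dots> = (x - 1) * l' + 1 / L"
    using assms \<open>2 \<le> L\<close> by (simp add: field_simps)
  also have "1 / L \<le> l' / 2"
    using mult_mono[OF \<open>2 \<le> L\<close> l(2)] \<open>2 \<le> L\<close> by (simp add: field_simps)
  finally have "l' / 2 \<le> x * l' - (x - 1) * l"
    by (simp add: algebra_simps)
  then have sq: "1 / (2 * l) \<le> x / l - (x - 1) / l'"
    using l by (simp add: field_simps)
  define s where "s = trunc_level x"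
  define t where "t = trunc_level (x - 1)"
  have s2: "s\<^sup>2 = x / l" "t\<^sup>2 = (x - 1) / l'" and t0: "0 \<le> t" "0 < s"
    using assms l by (auto simp: s_def t_def l_def l'_def trunc_level_def)
  have "t \<le> s" unfolding s_def t_def using assms by (intro trunc_level_mono) auto
  have "1 / (2 * l) \<le> (s - t) * (s + t)"
    using sq s2 by (simp add: algebra_simps power2_eq_square)
  also have "\<dots> \<le> (s - t) * (2 * s)"
    using \<open>t \<le> s\<close> by (intro mult_left_mono) auto
  finally have "1 \<le> 4 * (s - t) * (s * l)"
    using l by (simp add: field_simps)
  also have "s * l = lil_norm x / sqrt 2"
    using trunc_level_mult[of x] assms by (simp add: s_def l_def)
  also have "4 * (s - t) * (lil_norm x / sqrt 2) \<le> 4 * (s - t) * lil_norm x"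
    using \<open>t \<le> s\<close> lil_norm_pos[of x] assms
    by (intro mult_left_mono) (auto simp: field_simps)
  finally show ?thesis
    using lil_norm_pos[of x] assms by (simp add: field_simps s_def t_def)
qed

lemma sum_inverse_lil_norm_le:
  assumes "0 \<le> t"
  shows "(\<Sum>k=1..n. if trunc_level (real k) < t then 1 / lil_norm (real k) else 0) \<le> 8 + 4 * t"
proof -
  let ?f = "\<lambda>k. if trunc_level (real k) < t then 1 / lil_norm (real k) else 0"
  \<comment> \<open>The minimum with t closes the induction: a nonzero term still has its level
    below t, and afterwards neither side grows by more than the minimum allows.\<close>
  have tele: "(\<Sum>k=9..n. ?f k) \<le> 4 * min (trunc_level (real n)) t" for n
  proof (induction n)
    case 0
    then show ?case using assms by (simp add: trunc_level_def)
  next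
    case (Suc n)
    show ?case
    proof (cases "9 \<le> Suc n")
      case True
      have inc: "1 / lil_norm (real (Suc n)) \<le> 4 * (trunc_level (real (Suc n)) - trunc_level (real n))"
        using trunc_level_incr[of "real (Suc n)"] True by simp
      have mono: "trunc_level (real n) \<le> trunc_level (real (Suc n))"
        using True by (intro trunc_level_mono) auto
      have "(\<Sum>k=9..Suc n. ?f k) = (\<Sum>k=9..n. ?f k) + ?f (Suc n)"
        using True by simp
      then show ?thesis using Suc inc mono by (auto split: if_splits)
    next
      case False
      then have "(\<Sum>k=9..Suc n. ?f k) = 0" by simp
      then show ?thesis using assms trunc_level_nonneg[of "real (Suc n)"] by simp
    qed
  qed
  have pos: "0 \<le> ?f k" for k using lil_norm_nonneg[of "real k"] by simp
  have "(\<Sum>k=1..n. ?f k) \<le> (\<Sum>k\<in>{1..8} \<union> {9..n}. ?f k)"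
    by (rule sum_mono2) (use pos in auto)
  also have "\<dots> = (\<Sum>k\<in>{1..8}. ?f k) + (\<Sum>k\<in>{9..n}. ?f k)"
    by (rule sum.union_disjoint) auto
  also have "(\<Sum>k\<in>{1..8}. ?f k) \<le> (\<Sum>k\<in>{1..8::nat}. 1)"
  proof (rule sum_mono)
    fix k :: nat assume k: "k \<in> {1..8}"
    have "1 \<le> lil_norm (real k)"
      using lil_norm_ge[of "real k"] k real_sqrt_ge_one[of "real k"]
      by (auto intro: order_trans[of 1 "sqrt (real k)"])
    then show "?f k \<le> 1" by simp
  qed
  also have "(\<Sum>k=9..n. ?f k) \<le> 4 * t"
    using tele[of n] by simp
  finally show ?thesis by simp
qed

section \<open>Maximal inequality\<close>

text \<open>For nonnegative terms no summation by parts is needed: beyond N each u k is at most its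
  weighted version times a n, and the finite beginning is swamped by a n. The weights start at
  \<open>a (Suc 0)\<close> because \<open>a 0\<close> may vanish, as \<open>lil_norm 0\<close>
  does.\<close>

lemma kronecker_nonneg:
  fixes u a :: "nat \<Rightarrow> real"
  assumes u: "\<And>k. 0 \<le> u k"
    and a: "\<And>n. 0 < n \<Longrightarrow> 0 < a n" "\<And>m n. m \<le> n \<Longrightarrow> a m \<le> a n" "filterlim a at_top sequentially"
    and sm: "summable (\<lambda>k. u k / a (Suc k))"
  shows "(\<lambda>n. (\<Sum>k<n. u k) / a n) \<longlonglongrightarrow> 0"
proof (rule LIMSEQ_I)
  fix e :: real assume e: "0 < e"
  define w where "w k = u k / a (Suc k)" for k
  have w: "0 \<le> w k" "u k = w k * a (Suc k)" for k
    using u[of k] a(1)[of "Suc k"] by (auto simp: w_def)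
  obtain N where N: "\<And>m n. m \<ge> N \<Longrightarrow> norm (sum w {m..<n}) < e / 2"
    using sm e unfolding summable_Cauchy w_def[symmetric] by (meson half_gt_zero)
  define K where "K = (\<Sum>k<N. u k)"
  have "filterlim (\<lambda>n. e / 2 * a n) at_top sequentially"
    using a(3) e by (intro filterlim_tendsto_pos_mult_at_top[OF tendsto_const]) auto
  then have "eventually (\<lambda>n. K < e / 2 * a n) sequentially"
    by (simp add: filterlim_at_top_dense)
  then obtain N' where N': "\<And>n. n \<ge> N' \<Longrightarrow> K < e / 2 * a n"
    by (auto simp: eventually_sequentially)
  show "\<exists>no. \<forall>n\<ge>no. norm ((\<Sum>k<n. u k) / a n - 0) < e"
  proof (intro exI allI impI)
    fix n assume n: "n \<ge> max (Suc 0) (max N N')"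
    then have an: "0 < a n" using a(1) by simp
    have "(\<Sum>k<n. u k) = K + (\<Sum>k=N..<n. u k)"
      unfolding K_def using n by (subst sum.atLeastLessThan_concat[of 0 N n, symmetric, simplified atLeast0LessThan]) auto
    also have "(\<Sum>k=N..<n. u k) \<le> (\<Sum>k=N..<n. w k * a n)"
      unfolding w(2) using w(1) a(2) by (intro sum_mono mult_left_mono) auto
    also have "\<dots> = (\<Sum>k=N..<n. w k) * a n" by (simp add: sum_distrib_right)
    also have "\<dots> \<le> e / 2 * a n"
      using N[of N n] an by (intro mult_right_mono) auto
    finally have "(\<Sum>k<n. u k) < e * a n" using N'[of n] n by simp
    moreover have "0 \<le> (\<Sum>k<n. u k)" using u by (intro sum_nonneg) auto
    ultimately show "norm ((\<Sum>k<n. u k) / a n - 0) < e"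
      using an by (simp add: field_simps)
  qed
qed

lemma exp_le_quadratic:
  fixes x c :: real
  assumes "\<bar>x\<bar> \<le> c"
  shows "exp x \<le> 1 + x + x\<^sup>2 / 2 * exp c"
proof -
  obtain t where t: "\<bar>t\<bar> \<le> \<bar>x\<bar>" "exp x = (\<Sum>m<2. x ^ m / fact m) + exp t / fact 2 * x ^ 2"
    using Maclaurin_exp_le[of x 2] by blast
  have "exp t * x\<^sup>2 \<le> exp c * x\<^sup>2"
    using t(1) assms by (intro mult_right_mono) auto
  then show ?thesis using t(2) by (simp add: numeral_2_eq_2 field_simps)
qed

lemma (in prob_space) indep_var_prefix:
  fixes X :: "nat \<Rightarrow> 'a \<Rightarrow> real" and f :: "(nat \<Rightarrow> real) \<Rightarrow> real"
  assumes ind: "indep_vars (\<lambda>_. borel) X UNIV"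
    and f: "f \<in> borel_measurable (PiM {..<n} (\<lambda>_. borel))"
    and dep: "\<And>z. f (restrict z {..<n}) = f z"
  shows "indep_var borel (\<lambda>\<omega>. f (\<lambda>i. X i \<omega>)) borel (X n)"
proof -
  have "indep_var borel (f \<circ> (\<lambda>\<omega>. restrict (\<lambda>i. X i \<omega>) {..<n}))
      borel ((\<lambda>z. z n) \<circ> (\<lambda>\<omega>. restrict (\<lambda>i. X i \<omega>) {n}))"
    by (rule indep_var_compose[OF indep_var_restrict[OF ind] f]) auto
  then show ?thesis by (simp add: comp_def dep)
qed

text \<open>The product process stopped on reaching c. It is a function of the sequence of factors,
  so that its value at time n visibly depends on the first n factors only.\<close>

primrec stopped_prod :: "real \<Rightarrow> nat \<Rightarrow> (nat \<Rightarrow> real) \<Rightarrow> real" where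
  "stopped_prod c 0 z = 1"
| "stopped_prod c (Suc n) z =
    (if c \<le> stopped_prod c n z then stopped_prod c n z else stopped_prod c n z * z n)"

lemma stopped_prod_cong: "(\<And>k. k < n \<Longrightarrow> z k = z' k) \<Longrightarrow> stopped_prod c n z = stopped_prod c n z'"
  by (induction n) auto

lemma stopped_prod_nonneg: "(\<And>k. 0 \<le> z k) \<Longrightarrow> 0 \<le> stopped_prod c n z"
  by (induction n) auto

lemma stopped_prod_measurable:
  "{..<n} \<subseteq> J \<Longrightarrow> stopped_prod c n \<in> borel_measurable (PiM J (\<lambda>_. borel))"
proof (induction n)
  case 0
  have "stopped_prod c 0 = (\<lambda>z. 1)" by (rule ext) simp
  then show ?case by simp
next
  case (Suc n)
  have [measurable]: "stopped_prod c n \<in> borel_measurable (PiM J (\<lambda>_. borel))"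
    using Suc by (simp add: lessThan_Suc)
  have [measurable]: "(\<lambda>z. z n) \<in> borel_measurable (PiM J (\<lambda>_. borel))"
    using Suc.prems by (intro measurable_component_singleton) auto
  have "stopped_prod c (Suc n) = (\<lambda>z. if c \<le> stopped_prod c n z then stopped_prod c n z
      else stopped_prod c n z * z n)"
    by (rule ext) simp
  then show ?case by simp
qed

lemma stopped_prod_reaches:
  "(\<forall>m\<le>n. (\<Prod>k<m. z k) < c) \<and> stopped_prod c n z = (\<Prod>k<n. z k) \<or> c \<le> stopped_prod c n z"
proof (induction n)
  case (Suc n)
  then show ?case by (auto simp: le_Suc_eq not_le)
qed auto

text \<open>The stopped product is a nonnegative supermartingale started at 1, so its expectation at
  time N is at most 1. If some partial product reaches c, the stopped product is at least c at time
  N, and Markov's inequality applies.\<close>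

lemma (in prob_space) ville_inequality:
  fixes Z :: "nat \<Rightarrow> 'a \<Rightarrow> real"
  assumes ind: "indep_vars (\<lambda>_. borel) Z UNIV"
    and Z: "\<And>k \<omega>. 0 \<le> Z k \<omega>" "\<And>k. k < N \<Longrightarrow> integrable M (Z k)"
      "\<And>k. k < N \<Longrightarrow> expectation (Z k) \<le> 1"
    and c: "0 < c"
  shows "prob {\<omega>\<in>space M. \<exists>n\<le>N. c \<le> (\<Prod>k<n. Z k \<omega>)} \<le> 1 / c"
proof -
  have rv[measurable]: "Z k \<in> borel_measurable M" for k
    using ind by (auto simp: indep_vars_def2)
  define W where "W n \<omega> = stopped_prod c n (\<lambda>i. Z i \<omega>)" for n \<omega>
  have W0: "0 \<le> W n \<omega>" for n \<omega>
    unfolding W_def by (rule stopped_prod_nonneg) (use Z in auto)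
  have Wm[measurable]: "W n \<in> borel_measurable M" for n
    unfolding W_def by (induction n) auto
  have W: "integrable M (W n) \<and> expectation (W n) \<le> 1" if "n \<le> N" for n
    using that
  proof (induction n)
    case 0
    then show ?case by (simp add: W_def prob_space)
  next
    case (Suc n)
    \<comment> \<open>The part of the product that is still moving. It depends on the first n
      factors, hence is independent of \<open>Z n\<close>; the remaining part is carried over
      unchanged.\<close>
    define f where "f z = (if c \<le> stopped_prod c n z then 0 else stopped_prod c n z)" for z
    have [measurable]: "stopped_prod c n \<in> borel_measurable (PiM {..<n} (\<lambda>_. borel))"
      by (rule stopped_prod_measurable) auto
    have iv: "indep_var borel (\<lambda>\<omega>. f (\<lambda>i. Z i \<omega>)) borel (Z n)"
    proof (rule indep_var_prefix[OF ind])
      show "f \<in> borel_measurable (PiM {..<n} (\<lambda>_. borel))" unfolding f_def by simp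
      show "f (restrict z {..<n}) = f z" for z
        unfolding f_def by (subst (1 2) stopped_prod_cong[of n _ z]) auto
    qed
    have f_eq: "f (\<lambda>i. Z i \<omega>) = (if c \<le> W n \<omega> then 0 else W n \<omega>)" for \<omega>
      by (simp add: f_def W_def)
    have fm[measurable]: "(\<lambda>\<omega>. f (\<lambda>i. Z i \<omega>)) \<in> borel_measurable M"
      unfolding f_eq by simp
    have int: "integrable M (W n)" and le: "expectation (W n) \<le> 1" using Suc by auto
    have fint: "integrable M (\<lambda>\<omega>. f (\<lambda>i. Z i \<omega>))"
      by (rule Bochner_Integration.integrable_bound[OF int fm]) (auto simp: f_eq W0)
    have gint: "integrable M (\<lambda>\<omega>. W n \<omega> - f (\<lambda>i. Z i \<omega>))"
      using int fint by auto
    have eq: "W (Suc n) = (\<lambda>\<omega>. (W n \<omega> - f (\<lambda>i. Z i \<omega>)) + f (\<lambda>i. Z i \<omega>) * Z n \<omega>)"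
      by (rule ext) (simp add: f_eq, simp add: W_def)
    have Zn: "integrable M (Z n)" "expectation (Z n) \<le> 1" using Z Suc.prems by auto
    have int2: "integrable M (\<lambda>\<omega>. f (\<lambda>i. Z i \<omega>) * Z n \<omega>)"
      by (rule indep_var_integrable[OF iv fint Zn(1)])
    have "expectation (W (Suc n)) = expectation (\<lambda>\<omega>. W n \<omega> - f (\<lambda>i. Z i \<omega>))
        + expectation (\<lambda>\<omega>. f (\<lambda>i. Z i \<omega>)) * expectation (Z n)"
      unfolding eq by (subst Bochner_Integration.integral_add[OF gint int2])
        (simp add: indep_var_lebesgue_integral[OF iv fint Zn(1)])
    also have "\<dots> \<le> expectation (\<lambda>\<omega>. W n \<omega> - f (\<lambda>i. Z i \<omega>)) + expectation (\<lambda>\<omega>. f (\<lambda>i. Z i \<omega>)) * 1"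
      using Zn(2) W0 by (intro add_left_mono mult_left_mono Bochner_Integration.integral_nonneg) (auto simp: f_eq)
    also have "\<dots> = expectation (W n)"
      using int fint by (simp add: Bochner_Integration.integral_diff)
    finally show ?case using le gint int2 by (simp add: eq)
  qed
  have "{\<omega>\<in>space M. \<exists>n\<le>N. c \<le> (\<Prod>k<n. Z k \<omega>)} \<subseteq> {\<omega>\<in>space M. c \<le> W N \<omega>}"
    using stopped_prod_reaches[of N _ c] unfolding W_def by (auto simp: not_le[symmetric])
  then have "prob {\<omega>\<in>space M. \<exists>n\<le>N. c \<le> (\<Prod>k<n. Z k \<omega>)} \<le> prob {\<omega>\<in>space M. c \<le> W N \<omega>}"
    by (intro finite_measure_mono) auto
  also have "\<dots> \<le> expectation (W N) / c"
    using W[of N] W0 c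
    by (intro integral_Markov_inequality_measure[where A="{}"]) auto
  also have "\<dots> \<le> 1 / c" using W[of N] c by (intro divide_right_mono) auto
  finally show ?thesis .
qed

section \<open>The law of the iterated logarithm for i.i.d. sequences\<close>

locale centered_iid_sequence = prob_space M for M :: "'a measure" +
  fixes X :: "nat \<Rightarrow> 'a \<Rightarrow> real" and \<sigma> :: real
  assumes indep: "indep_vars (\<lambda>_. borel) X UNIV"
    and distr_eq: "\<And>n. distr M borel (X n) = distr M borel (X 0)"
    and square_integrable: "integrable M (\<lambda>\<omega>. (X 0 \<omega>)\<^sup>2)"
    and mean_zero: "expectation (X 0) = 0"
    and second_moment: "expectation (\<lambda>\<omega>. (X 0 \<omega>)\<^sup>2) = \<sigma>\<^sup>2"
    and sigma_nonneg: "0 \<le> \<sigma>"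
begin

lemma rv[measurable]: "X n \<in> borel_measurable M"
  using indep by (auto simp: indep_vars_def2)

lemma expectation_eq:
  fixes f :: "real \<Rightarrow> real"
  assumes [measurable]: "f \<in> borel_measurable borel"
  shows "expectation (\<lambda>\<omega>. f (X n \<omega>)) = expectation (\<lambda>\<omega>. f (X 0 \<omega>))"
  using distr_eq[of n] integral_distr[of "X n" M borel f] integral_distr[of "X 0" M borel f] by simp

lemma integrable_eq:
  fixes f :: "real \<Rightarrow> real"
  assumes [measurable]: "f \<in> borel_measurable borel"
  shows "integrable M (\<lambda>\<omega>. f (X n \<omega>)) \<longleftrightarrow> integrable M (\<lambda>\<omega>. f (X 0 \<omega>))"
  using distr_eq[of n] integrable_distr_eq[of "X n" M borel f] integrable_distr_eq[of "X 0" M borel f] by simp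

lemma integrable_X0: "integrable M (X 0)"
  by (rule square_integrable_imp_integrable[OF _ square_integrable]) simp

lemma integrable_X: "integrable M (X n)"
  using integrable_eq[of "\<lambda>x. x" n] integrable_X0 by simp

lemma mean_zero': "expectation (X n) = 0"
  using expectation_eq[of "\<lambda>x. x" n] mean_zero by simp

lemma square_integrable': "integrable M (\<lambda>\<omega>. (X n \<omega>)\<^sup>2)"
  using integrable_eq[of "\<lambda>x. x\<^sup>2" n] square_integrable by simp

lemma second_moment': "expectation (\<lambda>\<omega>. (X n \<omega>)\<^sup>2) = \<sigma>\<^sup>2"
  using expectation_eq[of "\<lambda>x. x\<^sup>2" n] second_moment by simp

text \<open>Sequences start at 0 here, so \<open>X k\<close> is the summand number k + 1 and is cut
  at the level of \<open>Suc k\<close>. The factor \<open>\<tau>\<close> is free because each use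
  needs a different one.\<close>

definition tail_part :: "real \<Rightarrow> nat \<Rightarrow> 'a \<Rightarrow> real" where
  "tail_part \<tau> k \<omega> = (if \<tau> * trunc_level (real (Suc k)) < \<bar>X k \<omega>\<bar> then X k \<omega> else 0)"

lemma tail_part_measurable[measurable]: "tail_part \<tau> k \<in> borel_measurable M"
  unfolding tail_part_def by simp

lemma tail_part_integrable: "integrable M (tail_part \<tau> k)"
  by (rule Bochner_Integration.integrable_bound[OF integrable_X[of k]]) (auto simp: tail_part_def)

text \<open>All terms can be written with \<open>X 0\<close>. For a fixed value of
  \<open>X 0\<close> the sum over k is bounded by \<open>sum_inverse_lil_norm_le\<close> with t = |X
  0| / \<tau>, which gives 8 |X 0| + 4 (X 0)^2 / \<tau>; this is integrable exactly by the second
  moment.\<close>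

lemma summable_tail_expectation:
  assumes "0 < \<tau>"
  shows "summable (\<lambda>k. expectation (\<lambda>\<omega>. \<bar>tail_part \<tau> k \<omega>\<bar>) / lil_norm (real (Suc k)))"
proof -
  let ?a = "\<lambda>k. lil_norm (real (Suc k))"
  let ?g = "\<lambda>k x. if trunc_level (real k) < \<bar>x\<bar> / \<tau> then 1 / lil_norm (real k) else 0 :: real"
  have term_eq: "expectation (\<lambda>\<omega>. \<bar>tail_part \<tau> k \<omega>\<bar>) / ?a k
      = expectation (\<lambda>\<omega>. \<bar>X 0 \<omega>\<bar> * ?g (Suc k) (X 0 \<omega>))" for k
  proof -
    have "expectation (\<lambda>\<omega>. \<bar>tail_part \<tau> k \<omega>\<bar>) / ?a k
        = expectation (\<lambda>\<omega>. \<bar>X k \<omega>\<bar> * ?g (Suc k) (X k \<omega>))"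
      using assms by (subst Bochner_Integration.integral_divide_zero[symmetric], intro Bochner_Integration.integral_cong)
        (auto simp: tail_part_def field_simps)
    also have "\<dots> = expectation (\<lambda>\<omega>. \<bar>X 0 \<omega>\<bar> * ?g (Suc k) (X 0 \<omega>))"
      by (rule expectation_eq) simp
    finally show ?thesis .
  qed
  have int: "integrable M (\<lambda>\<omega>. \<bar>X 0 \<omega>\<bar> * ?g (Suc k) (X 0 \<omega>))" for k
    by (rule Bochner_Integration.integrable_bound[where f="\<lambda>\<omega>. X 0 \<omega> * (1 / ?a k)"])
      (auto intro!: integrable_X0 simp: abs_mult lil_norm_nonneg)
  show ?thesis
  proof (rule summableI_nonneg_bounded)
    fix n
    have "(\<Sum>k<n. expectation (\<lambda>\<omega>. \<bar>tail_part \<tau> k \<omega>\<bar>) / ?a k)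
        = expectation (\<lambda>\<omega>. \<Sum>k<n. \<bar>X 0 \<omega>\<bar> * ?g (Suc k) (X 0 \<omega>))"
      unfolding term_eq using int by (subst Bochner_Integration.integral_sum) auto
    also have "\<dots> \<le> expectation (\<lambda>\<omega>. \<bar>X 0 \<omega>\<bar> * 8 + 4 / \<tau> * (X 0 \<omega>)\<^sup>2)"
    proof (rule Bochner_Integration.integral_mono)
      fix \<omega>
      have "(\<Sum>k<n. \<bar>X 0 \<omega>\<bar> * ?g (Suc k) (X 0 \<omega>)) = \<bar>X 0 \<omega>\<bar> * (\<Sum>k=1..n. ?g k (X 0 \<omega>))"
        by (simp only: sum_distrib_left sum.atLeast1_atMost_eq One_nat_def)
      also have "\<dots> \<le> \<bar>X 0 \<omega>\<bar> * (8 + 4 * (\<bar>X 0 \<omega>\<bar> / \<tau>))"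
        using assms by (intro mult_left_mono sum_inverse_lil_norm_le) auto
      finally show "(\<Sum>k<n. \<bar>X 0 \<omega>\<bar> * ?g (Suc k) (X 0 \<omega>)) \<le> \<bar>X 0 \<omega>\<bar> * 8 + 4 / \<tau> * (X 0 \<omega>)\<^sup>2"
        by (simp add: algebra_simps power2_eq_square)
    qed (use int integrable_X0 square_integrable in auto)
    finally show "(\<Sum>k<n. expectation (\<lambda>\<omega>. \<bar>tail_part \<tau> k \<omega>\<bar>) / ?a k)
      \<le> expectation (\<lambda>\<omega>. \<bar>X 0 \<omega>\<bar> * 8 + 4 / \<tau> * (X 0 \<omega>)\<^sup>2)" .
  qed (simp add: lil_norm_nonneg)
qed

lemma tail_expectation_negligible:
  assumes "0 < \<tau>"
  shows "(\<lambda>n. (\<Sum>k<n. expectation (\<lambda>\<omega>. \<bar>tail_part \<tau> k \<omega>\<bar>)) / lil_norm (real n)) \<longlonglongrightarrow> 0"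
  by (rule kronecker_nonneg)
    (use summable_tail_expectation[OF assms] filterlim_lil_norm in \<open>auto simp: lil_norm_pos lil_norm_mono\<close>)

lemma AE_tail_negligible:
  assumes "0 < \<tau>"
  shows "AE \<omega> in M. (\<lambda>n. (\<Sum>k<n. \<bar>tail_part \<tau> k \<omega>\<bar>) / lil_norm (real n)) \<longlonglongrightarrow> 0"
proof -
  let ?u = "\<lambda>k \<omega>. \<bar>tail_part \<tau> k \<omega>\<bar> / lil_norm (real (Suc k))"
  have pos: "0 \<le> ?u k \<omega>" for k \<omega> by (simp add: lil_norm_nonneg)
  have "(\<integral>\<^sup>+\<omega>. (\<Sum>k. ennreal (?u k \<omega>)) \<partial>M) = (\<Sum>k. \<integral>\<^sup>+\<omega>. ennreal (?u k \<omega>) \<partial>M)"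
    by (rule nn_integral_suminf) simp
  also have "\<dots> = (\<Sum>k. ennreal (expectation (\<lambda>\<omega>. \<bar>tail_part \<tau> k \<omega>\<bar>) / lil_norm (real (Suc k))))"
  proof (rule suminf_cong)
    fix k
    have "integrable M (?u k)" by (intro Bochner_Integration.integrable_divide integrable_abs tail_part_integrable)
    then have "(\<integral>\<^sup>+\<omega>. ennreal (?u k \<omega>) \<partial>M) = ennreal (expectation (?u k))"
      using pos by (intro nn_integral_eq_integral) auto
    then show "(\<integral>\<^sup>+\<omega>. ennreal (?u k \<omega>) \<partial>M)
        = ennreal (expectation (\<lambda>\<omega>. \<bar>tail_part \<tau> k \<omega>\<bar>) / lil_norm (real (Suc k)))"
      by (simp only: Bochner_Integration.integral_divide_zero)
  qed
  also have "\<dots> \<noteq> top"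
    by (rule ennreal_suminf_neq_top[OF summable_tail_expectation[OF assms]])
      (intro divide_nonneg_nonneg Bochner_Integration.integral_nonneg lil_norm_nonneg, auto)
  finally have "AE \<omega> in M. (\<Sum>k. ennreal (?u k \<omega>)) \<noteq> \<infinity>"
    by (intro nn_integral_PInf_AE) auto
  then show ?thesis
  proof eventually_elim
    case (elim \<omega>)
    then have "summable (\<lambda>k. ?u k \<omega>)"
      using pos by (intro summable_suminf_not_top) auto
    then show ?case
      by (intro kronecker_nonneg) (use filterlim_lil_norm in \<open>auto simp: lil_norm_pos lil_norm_mono\<close>)
  qed
qed

end

section \<open>Truncated sums and the upper half of the law\<close>

context centered_iid_sequence
begin

definition trunc_part :: "real \<Rightarrow> nat \<Rightarrow> 'a \<Rightarrow> real" where
  "trunc_part \<tau> k \<omega> = X k \<omega> - tail_part \<tau> k \<omega>"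

definition trunc_sum :: "real \<Rightarrow> nat \<Rightarrow> 'a \<Rightarrow> real" where
  "trunc_sum \<tau> n \<omega> = (\<Sum>k<n. trunc_part \<tau> k \<omega> - expectation (trunc_part \<tau> k))"

lemma trunc_part_measurable[measurable]: "trunc_part \<tau> k \<in> borel_measurable M"
  unfolding trunc_part_def by simp

lemma trunc_sum_measurable[measurable]: "trunc_sum \<tau> k \<in> borel_measurable M"
  unfolding trunc_sum_def by simp

lemma abs_trunc_part_le: "0 \<le> \<tau> \<Longrightarrow> \<bar>trunc_part \<tau> k \<omega>\<bar> \<le> \<tau> * trunc_level (real (Suc k))"
  using trunc_level_nonneg[of "real (Suc k)"] by (auto simp: trunc_part_def tail_part_def)

lemma trunc_part_integrable: "integrable M (trunc_part \<tau> k)"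
  unfolding trunc_part_def using integrable_X tail_part_integrable by (intro Bochner_Integration.integrable_diff) auto

lemma sum_minus_trunc_sum_le:
  "\<bar>(\<Sum>k<n. X k \<omega>) - trunc_sum \<tau> n \<omega>\<bar>
    \<le> (\<Sum>k<n. \<bar>tail_part \<tau> k \<omega>\<bar>) + (\<Sum>k<n. expectation (\<lambda>\<omega>. \<bar>tail_part \<tau> k \<omega>\<bar>))"
proof -
  \<comment> \<open>Since \<open>X k\<close> has mean zero, centring the truncated part at its own
    mean leaves precisely the centred tail as error.\<close>
  have m: "expectation (trunc_part \<tau> k) = - expectation (tail_part \<tau> k)" for k
    unfolding trunc_part_def
    by (subst Bochner_Integration.integral_diff) (auto simp: integrable_X tail_part_integrable mean_zero')
  have "(\<Sum>k<n. X k \<omega>) - trunc_sum \<tau> n \<omega> = (\<Sum>k<n. tail_part \<tau> k \<omega> - expectation (tail_part \<tau> k))"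
    unfolding trunc_sum_def m sum_subtractf[symmetric]
    by (intro sum.cong) (auto simp: trunc_part_def)
  also have "\<bar>\<dots>\<bar> \<le> (\<Sum>k<n. \<bar>tail_part \<tau> k \<omega> - expectation (tail_part \<tau> k)\<bar>)"
    by (rule sum_abs)
  also have "\<dots> \<le> (\<Sum>k<n. \<bar>tail_part \<tau> k \<omega>\<bar> + expectation (\<lambda>\<omega>. \<bar>tail_part \<tau> k \<omega>\<bar>))"
  proof (rule sum_mono)
    fix k
    show "\<bar>tail_part \<tau> k \<omega> - expectation (tail_part \<tau> k)\<bar>
        \<le> \<bar>tail_part \<tau> k \<omega>\<bar> + expectation (\<lambda>\<omega>. \<bar>tail_part \<tau> k \<omega>\<bar>)"
      using integral_abs_bound[of M "tail_part \<tau> k"] by linarith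
  qed
  finally show ?thesis by (simp add: sum.distrib)
qed

lemma AE_sum_minus_trunc_sum:
  assumes "0 < \<tau>"
  shows "AE \<omega> in M. (\<lambda>n. ((\<Sum>k<n. X k \<omega>) - trunc_sum \<tau> n \<omega>) / lil_norm (real n)) \<longlonglongrightarrow> 0"
  using AE_tail_negligible[OF assms]
proof eventually_elim
  case (elim \<omega>)
  have lim: "(\<lambda>n. (\<Sum>k<n. \<bar>tail_part \<tau> k \<omega>\<bar>) / lil_norm (real n)
      + (\<Sum>k<n. expectation (\<lambda>\<omega>. \<bar>tail_part \<tau> k \<omega>\<bar>)) / lil_norm (real n)) \<longlonglongrightarrow> 0"
    using tendsto_add[OF elim tail_expectation_negligible[OF assms]] by simp
  show ?case
  proof (rule Lim_null_comparison[OF always_eventually lim], rule allI)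
    fix n
    show "norm (((\<Sum>k<n. X k \<omega>) - trunc_sum \<tau> n \<omega>) / lil_norm (real n))
      \<le> (\<Sum>k<n. \<bar>tail_part \<tau> k \<omega>\<bar>) / lil_norm (real n)
      + (\<Sum>k<n. expectation (\<lambda>\<omega>. \<bar>tail_part \<tau> k \<omega>\<bar>)) / lil_norm (real n)"
      using divide_right_mono[OF sum_minus_trunc_sum_le[where n=n and \<omega>=\<omega> and \<tau>=\<tau>] lil_norm_nonneg[of "real n"]]
      by (simp add: add_divide_distrib lil_norm_nonneg abs_divide)
  qed
qed

text \<open>In the expansion of exp to second order the linear term cancels by centring, and the
  remainder carries the factor exp c, where c bounds tilt times truncation level. The gap between
  \<open>\<sigma>\<^sup>2\<close> and v is there to absorb this factor.\<close>

lemma trunc_mgf_le: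
  assumes "0 \<le> \<tau>" "0 \<le> r" "r * (\<tau> * trunc_level (real (Suc k))) \<le> c" "\<sigma>\<^sup>2 * exp c \<le> v"
  defines "Z \<equiv> \<lambda>\<omega>. exp (r * (trunc_part \<tau> k \<omega> - expectation (trunc_part \<tau> k)) - r\<^sup>2 * v / 2)"
  shows "integrable M Z" "expectation Z \<le> 1"
proof -
  let ?Y = "trunc_part \<tau> k" and ?m = "expectation (trunc_part \<tau> k)"
  have bd: "\<bar>r * ?Y \<omega>\<bar> \<le> c" for \<omega>
  proof -
    have "\<bar>r * ?Y \<omega>\<bar> = r * \<bar>?Y \<omega>\<bar>" using assms by (simp add: abs_mult)
    also have "\<dots> \<le> r * (\<tau> * trunc_level (real (Suc k)))"
      using assms abs_trunc_part_le by (intro mult_left_mono) auto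
    finally show ?thesis using assms by simp
  qed
  have sq: "integrable M (\<lambda>\<omega>. (?Y \<omega>)\<^sup>2)" "expectation (\<lambda>\<omega>. (?Y \<omega>)\<^sup>2) \<le> \<sigma>\<^sup>2"
  proof -
    have le: "(?Y \<omega>)\<^sup>2 \<le> (X k \<omega>)\<^sup>2" for \<omega> by (simp add: trunc_part_def tail_part_def)
    show 1: "integrable M (\<lambda>\<omega>. (?Y \<omega>)\<^sup>2)"
      by (rule Bochner_Integration.integrable_bound[OF square_integrable'[of k]]) (auto simp: le)
    show "expectation (\<lambda>\<omega>. (?Y \<omega>)\<^sup>2) \<le> \<sigma>\<^sup>2"
      unfolding second_moment'[of k, symmetric]
      by (rule Bochner_Integration.integral_mono[OF 1 square_integrable']) (rule le)
  qed
  have eint: "integrable M (\<lambda>\<omega>. exp (r * ?Y \<omega>))"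
  proof (rule integrable_const_bound[where B="exp c"])
    show "AE \<omega> in M. norm (exp (r * ?Y \<omega>)) \<le> exp c"
      using bd by (intro AE_I2) (auto simp: abs_le_iff)
  qed simp
  have Zeq: "Z = (\<lambda>\<omega>. exp (r * ?Y \<omega>) * exp (- r * ?m - r\<^sup>2 * v / 2))"
    unfolding Z_def by (simp flip: exp_add add: algebra_simps)
  show "integrable M Z" unfolding Zeq using eint by (intro integrable_mult_left) auto
  have "expectation (\<lambda>\<omega>. exp (r * ?Y \<omega>)) \<le> expectation (\<lambda>\<omega>. 1 + r * ?Y \<omega> + r\<^sup>2 / 2 * exp c * (?Y \<omega>)\<^sup>2)"
  proof (rule Bochner_Integration.integral_mono[OF eint])
    show "integrable M (\<lambda>\<omega>. 1 + r * ?Y \<omega> + r\<^sup>2 / 2 * exp c * (?Y \<omega>)\<^sup>2)"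
      using trunc_part_integrable sq(1) by auto
    show "exp (r * ?Y \<omega>) \<le> 1 + r * ?Y \<omega> + r\<^sup>2 / 2 * exp c * (?Y \<omega>)\<^sup>2" for \<omega>
      using exp_le_quadratic[OF bd[of \<omega>]] by (simp add: power_mult_distrib algebra_simps)
  qed
  also have "\<dots> = 1 + r * ?m + r\<^sup>2 / 2 * exp c * expectation (\<lambda>\<omega>. (?Y \<omega>)\<^sup>2)"
    using trunc_part_integrable sq(1) by (simp add: prob_space)
  also have "r\<^sup>2 / 2 * exp c * expectation (\<lambda>\<omega>. (?Y \<omega>)\<^sup>2) \<le> r\<^sup>2 / 2 * exp c * \<sigma>\<^sup>2"
    using sq(2) by (intro mult_left_mono) auto
  also have "\<dots> \<le> r\<^sup>2 / 2 * v"
    using mult_left_mono[OF assms(4), of "r\<^sup>2 / 2"] by (simp add: algebra_simps)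
  also have "1 + r * ?m + r\<^sup>2 / 2 * v \<le> exp (r * ?m + r\<^sup>2 * v / 2)"
    using exp_ge_add_one_self[of "r * ?m + r\<^sup>2 * v / 2"] by (simp add: algebra_simps)
  finally have "expectation (\<lambda>\<omega>. exp (r * ?Y \<omega>)) * exp (- r * ?m - r\<^sup>2 * v / 2)
      \<le> exp (r * ?m + r\<^sup>2 * v / 2) * exp (- r * ?m - r\<^sup>2 * v / 2)"
    by (intro mult_right_mono) auto
  also have "\<dots> = 1" by (simp flip: exp_add)
  finally show "expectation Z \<le> 1" unfolding Zeq by simp
qed

text \<open>Ville's inequality for the product of the normalized exponentials. It bounds the maximum
  over all n up to N at once, since the compensator is linear in n; x only has to dominate every
  truncation level that occurs.\<close>

lemma trunc_sum_exceeds_le: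
  assumes "0 \<le> \<tau>" "0 \<le> r" "0 < x" "r * (\<tau> * trunc_level x) \<le> c" "\<sigma>\<^sup>2 * exp c \<le> v" "real N \<le> x"
  shows "prob {\<omega>\<in>space M. \<exists>n\<le>N. u \<le> r * trunc_sum \<tau> n \<omega> - real n * (r\<^sup>2 * v / 2)} \<le> exp (- u)"
proof -
  define Z where "Z k \<omega> = exp (r * (trunc_part \<tau> k \<omega> - expectation (trunc_part \<tau> k)) - r\<^sup>2 * v / 2)" for k \<omega>
  have small: "r * (\<tau> * trunc_level (real (Suc k))) \<le> c" if "k < N" for k
  proof -
    have "trunc_level (real (Suc k)) \<le> trunc_level x"
      using that assms by (intro trunc_level_mono) auto
    then have "r * (\<tau> * trunc_level (real (Suc k))) \<le> r * (\<tau> * trunc_level x)"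
      using assms by (intro mult_left_mono) auto
    then show ?thesis using assms by simp
  qed
  have prod: "(\<Prod>k<n. Z k \<omega>) = exp (r * trunc_sum \<tau> n \<omega> - real n * (r\<^sup>2 * v / 2))" for n \<omega>
    unfolding Z_def trunc_sum_def exp_sum[symmetric, OF finite_lessThan]
    by (simp flip: sum_distrib_left add: sum_subtractf)
  have "indep_vars (\<lambda>_. borel) Z UNIV"
  proof -
    have Z_eq: "Z = (\<lambda>k \<omega>. (\<lambda>y. exp (r * ((y - (if \<tau> * trunc_level (real (Suc k)) < \<bar>y\<bar> then y else 0))
        - expectation (trunc_part \<tau> k)) - r\<^sup>2 * v / 2)) (X k \<omega>))"
      by (intro ext) (simp add: Z_def trunc_part_def tail_part_def)
    show ?thesis unfolding Z_eq by (rule indep_vars_compose2[OF indep]) simp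
  qed
  then have "prob {\<omega>\<in>space M. \<exists>n\<le>N. exp u \<le> (\<Prod>k<n. Z k \<omega>)} \<le> 1 / exp u"
    using trunc_mgf_le[OF assms(1,2) small assms(5)]
    by (intro ville_inequality) (auto simp: Z_def[abs_def])
  then show ?thesis unfolding prod by (simp add: exp_minus field_simps)
qed

text \<open>On the block ending at x = \<theta>^(k+1) the exceptional probability is at most exp (-
  \<alpha> loglog x), and log x = (k+1) ln \<theta> turns this into a summable power of k. The
  factor (\<alpha> + 1) / 2 collects \<alpha> loglog x from the threshold and loglog x from the
  compensator.\<close>

lemma AE_trunc_sum_le:
  assumes v: "0 < v" "\<sigma>\<^sup>2 * exp c \<le> v" and c: "0 < c" and \<alpha>: "1 < \<alpha>" and \<theta>: "1 < \<theta>"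
  defines "\<tau> \<equiv> c * sqrt (v / 2)"
  shows "AE \<omega> in M. eventually (\<lambda>k. \<forall>n. real n \<le> \<theta> ^ Suc k \<longrightarrow>
      trunc_sum \<tau> n \<omega> < (\<alpha> + 1) / 2 * sqrt v * lil_norm (\<theta> ^ Suc k)) sequentially"
proof -
  define x where "x k = \<theta> ^ Suc k" for k
  define l where "l k = loglog (x k)" for k
  \<comment> \<open>The optimal Gaussian tilt for variance v x at the height sqrt v * lil_norm x: it
    makes the compensator at time x equal to l k.\<close>
  define r where "r k = sqrt (2 * l k / (x k * v))" for k
  define N where "N k = nat \<lfloor>x k\<rfloor>" for k
  have x: "1 < x k" for k unfolding x_def using \<theta> by (intro one_less_power) auto
  have l: "1 \<le> l k" for k unfolding l_def by (rule loglog_ge_1)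
  have r: "0 < r k" for k using x[of k] l[of k] v by (simp add: r_def zero_less_mult_iff)
  define B where "B k = {\<omega>\<in>space M. \<exists>n\<le>N k. \<alpha> * l k \<le> r k * trunc_sum \<tau> n \<omega> - real n * ((r k)\<^sup>2 * v / 2)}" for k
  have [measurable]: "B k \<in> sets M" for k unfolding B_def by simp
  \<comment> \<open>Here \<open>\<tau>\<close> gets its value: c * sqrt (v / 2) makes tilt times
    truncation level exactly c at the end of the block.\<close>
  have rt: "r k * (\<tau> * trunc_level (x k)) \<le> c" for k
  proof -
    have "r k * (\<tau> * trunc_level (x k)) = c * sqrt ((2 * l k / (x k * v)) * (v / 2) * (x k / l k))"
      unfolding r_def \<tau>_def trunc_level_def l_def by (simp add: real_sqrt_mult[symmetric] mult_ac)
    also have "(2 * l k / (x k * v)) * (v / 2) * (x k / l k) = 1"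
      using x[of k] l[of k] v by (simp add: field_simps)
    finally show ?thesis by simp
  qed
  have PB: "prob (B k) \<le> (real (Suc k) * ln \<theta>) powr (- \<alpha>)" for k
  proof -
    have "prob (B k) \<le> exp (- (\<alpha> * l k))"
      unfolding B_def using x[of k] r[of k] c v rt[of k]
      by (intro trunc_sum_exceeds_le[where x="x k" and c=c]) (auto simp: N_def \<tau>_def)
    also have "ln (real (Suc k) * ln \<theta>) \<le> l k"
    proof -
      have pos: "0 < real (Suc k) * ln \<theta>" using \<theta> by simp
      have "real (Suc k) * ln \<theta> = ln (x k)" unfolding x_def using \<theta> by (subst ln_realpow) auto
      also have "\<dots> \<le> log_e (x k)"
        unfolding log_e_def using x[of k] by (subst ln_le_cancel_iff) auto
      finally have "ln (real (Suc k) * ln \<theta>) \<le> ln (log_e (x k))"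
        using pos by (subst ln_le_cancel_iff) (auto intro: less_le_trans[OF pos])
      also have "\<dots> \<le> l k"
        unfolding l_def loglog_def log_e_def[of "log_e (x k)"]
        using log_e_ge_1[of "x k"] by (subst ln_le_cancel_iff) auto
      finally show ?thesis .
    qed
    then have "exp (- (\<alpha> * l k)) \<le> (real (Suc k) * ln \<theta>) powr (- \<alpha>)"
      using \<alpha> \<theta> by (simp add: powr_def mult_left_mono)
    finally show ?thesis .
  qed
  have "summable (\<lambda>k. prob (B k))"
  proof (rule summable_comparison_test')
    have "summable (\<lambda>k. real k powr (- \<alpha>))"
      using \<alpha> by (simp add: summable_real_powr_iff)
    then have "summable (\<lambda>k. real (Suc k) powr (- \<alpha>) * (ln \<theta>) powr (- \<alpha>))"
      by (intro summable_mult2) (subst summable_Suc_iff)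
    then show "summable (\<lambda>k. (real (Suc k) * ln \<theta>) powr (- \<alpha>))"
      using \<theta> by (simp add: powr_mult)
    show "norm (prob (B k)) \<le> (real (Suc k) * ln \<theta>) powr (- \<alpha>)" if "0 \<le> k" for k
      using PB[of k] by simp
  qed
  then have "AE \<omega> in M. eventually (\<lambda>k. \<omega> \<in> space M - B k) sequentially"
    by (intro borel_cantelli_AE1) (auto simp: emeasure_eq_measure)
  then show ?thesis
  proof eventually_elim
    case (elim \<omega>)
    then show ?case
    proof eventually_elim
      case (elim k)
      show ?case
      proof (intro allI impI)
        fix n assume n: "real n \<le> \<theta> ^ Suc k"
        then have "n \<le> N k" unfolding N_def x_def by linarith
        with elim have "\<not> \<alpha> * l k \<le> r k * trunc_sum \<tau> n \<omega> - real n * ((r k)\<^sup>2 * v / 2)"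
          by (auto simp: B_def)
        then have "r k * trunc_sum \<tau> n \<omega> - real n * ((r k)\<^sup>2 * v / 2) < \<alpha> * l k"
          by simp
        moreover have "real n * ((r k)\<^sup>2 * v / 2) \<le> x k * ((r k)\<^sup>2 * v / 2)"
          using n v by (intro mult_right_mono) (auto simp: x_def)
        moreover have "x k * ((r k)\<^sup>2 * v / 2) = l k"
          using x[of k] l[of k] v by (simp add: r_def)
        ultimately have "r k * trunc_sum \<tau> n \<omega> < (\<alpha> + 1) * l k"
          by (simp add: algebra_simps)
        also have "l k = r k * (sqrt v * lil_norm (x k) / 2)"
        proof -
          have "r k * (sqrt v * lil_norm (x k)) = sqrt ((2 * l k / (x k * v)) * v * (2 * x k * l k))"
            by (simp add: r_def lil_norm_def l_def real_sqrt_mult[symmetric] mult_ac)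
          also have "(2 * l k / (x k * v)) * v * (2 * x k * l k) = (2 * l k)\<^sup>2"
            using x[of k] v by (simp add: field_simps power2_eq_square)
          finally have "r k * (sqrt v * lil_norm (x k)) = 2 * l k"
            unfolding real_sqrt_abs using l[of k] by simp
          then show ?thesis by simp
        qed
        finally have "r k * trunc_sum \<tau> n \<omega> < r k * ((\<alpha> + 1) / 2 * sqrt v * lil_norm (x k))"
          by (simp add: algebra_simps)
        then show "trunc_sum \<tau> n \<omega> < (\<alpha> + 1) / 2 * sqrt v * lil_norm (\<theta> ^ Suc k)"
          using r[of k] by (simp add: x_def)
      qed
    qed
  qed
qed

lemma AE_sum_le:
  assumes "\<sigma> < s"
  shows "AE \<omega> in M. eventually (\<lambda>n. (\<Sum>k<n. X k \<omega>) \<le> s * lil_norm (real n)) sequentially"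
proof -
  define v where "v = ((s + \<sigma>) / 2)\<^sup>2"
  have v: "\<sigma>\<^sup>2 < v" "v < s\<^sup>2" "0 < v" "sqrt v = (s + \<sigma>) / 2"
    using assms sigma_nonneg unfolding v_def
    by (auto intro!: power_strict_mono simp: zero_less_power)
  have s: "0 < s" "sqrt v < s" using assms sigma_nonneg v by auto
  \<comment> \<open>The largest c that the slack between \<open>\<sigma>\<^sup>2\<close> and v
    permits; for \<open>\<sigma> = 0\<close> any positive c will do.\<close>
  define c where "c = (if \<sigma> = 0 then 1 else ln (v / \<sigma>\<^sup>2))"
  have c: "0 < c" "\<sigma>\<^sup>2 * exp c \<le> v"
    using v sigma_nonneg by (auto simp: c_def)
  \<comment> \<open>One number serves as both \<open>\<alpha>\<close> and the ratio of the blocks.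
    Passing from the end of a block to n costs another factor \<open>\<rho>\<close>, and (\<rho> +
    1) / 2 < \<rho> leaves the room \<open>s - s'\<close> for the tails.\<close>
  define \<rho> where "\<rho> = sqrt (s / sqrt v)"
  have \<rho>: "1 < \<rho>" "\<rho>\<^sup>2 * sqrt v = s"
    using s v(3) by (auto simp: \<rho>_def)
  define \<tau> where "\<tau> = c * sqrt (v / 2)"
  have \<tau>: "0 < \<tau>" using c v by (simp add: \<tau>_def)
  define s' where "s' = (\<rho> + 1) / 2 * sqrt v * \<rho>"
  have "s' < \<rho> * sqrt v * \<rho>"
    unfolding s'_def using \<rho>(1) v(3) by (intro mult_strict_right_mono) auto
  then have s': "s' < s" using \<rho>(2) by (simp add: power2_eq_square mult_ac)
  show ?thesis
    using AE_sum_minus_trunc_sum[OF \<tau>] AE_trunc_sum_le[OF v(3) c(2,1) \<rho>(1) \<rho>(1), folded \<tau>_def]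
  proof eventually_elim
    case (elim \<omega>)
    obtain K where K: "\<And>k n. K \<le> k \<Longrightarrow> real n \<le> \<rho> ^ Suc k \<Longrightarrow>
        trunc_sum \<tau> n \<omega> < (\<rho> + 1) / 2 * sqrt v * lil_norm (\<rho> ^ Suc k)"
      using elim(2) by (auto simp: eventually_sequentially)
    have "eventually (\<lambda>n. ((\<Sum>k<n. X k \<omega>) - trunc_sum \<tau> n \<omega>) / lil_norm (real n) < s - s') sequentially"
      using elim(1) s' by (intro order_tendstoD(2)) auto
    moreover have "eventually (\<lambda>n. real n \<ge> \<rho> ^ K) sequentially"
      using filterlim_real_sequentially by (simp add: filterlim_at_top)
    ultimately show ?case using eventually_gt_at_top[of 0]
    proof eventually_elim
      case (elim n)
      define i where "i = (LEAST i. real n < \<rho> ^ i)"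
      have i: "real n < \<rho> ^ i"
        unfolding i_def using real_arch_pow[OF \<rho>(1)] by (rule LeastI_ex)
      have "i \<noteq> 0" using i elim by (intro notI) simp
      then obtain j where ij: "i = Suc j" by (cases i) auto
      have "\<not> real n < \<rho> ^ j"
        using ij by (intro not_less_Least) (simp add: i_def)
      then have j: "\<rho> ^ j \<le> real n" "real n < \<rho> ^ Suc j"
        using i ij by auto
      have "K \<le> j"
      proof (rule ccontr)
        assume "\<not> K \<le> j"
        then have "\<rho> ^ Suc j \<le> \<rho> ^ K" using \<rho>(1) by (intro power_increasing) auto
        then show False using j elim by simp
      qed
      then have "trunc_sum \<tau> n \<omega> \<le> (\<rho> + 1) / 2 * sqrt v * lil_norm (\<rho> ^ Suc j)"
        using K[of j n] j by simp
      also have "lil_norm (\<rho> ^ Suc j) \<le> (\<rho> ^ Suc j / real n) * lil_norm (real n)"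
        using elim j by (intro lil_norm_le_mult) auto
      also have "\<rho> ^ Suc j / real n \<le> \<rho>"
        using elim j(1) \<rho>(1) by (simp add: field_simps)
      finally have "trunc_sum \<tau> n \<omega> \<le> s' * lil_norm (real n)"
        using v(3) \<rho>(1) lil_norm_nonneg[of "real n"] by (simp add: s'_def mult_left_mono mult_right_mono mult_ac)
      then show ?case using elim lil_norm_pos[of "real n"] by (simp add: field_simps)
    qed
  qed
qed

end

section \<open>Independent blocks and the lower half of the law\<close>

lemma (in prob_space) borel_cantelli_2:
  fixes Y :: "nat \<Rightarrow> 'a \<Rightarrow> 'b"
  assumes ind: "indep_vars N Y UNIV"
    and A: "\<And>k. A k \<in> sets (N k)"
    and div: "\<not> summable (\<lambda>k. prob (Y k -` A k \<inter> space M))"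
  shows "AE \<omega> in M. \<exists>\<^sub>F k in sequentially. Y k \<omega> \<in> A k"
proof -
  have Y[measurable]: "Y k \<in> measurable M (N k)" for k
    using ind by (auto simp: indep_vars_def2)
  define p where "p k = prob (Y k -` A k \<inter> space M)" for k
  define D where "D k = space (N k) - A k" for k
  have D: "D k \<in> sets (N k)" for k using A by (auto simp: D_def)
  have pD: "prob (Y k -` D k \<inter> space M) = 1 - p k" for k
  proof -
    have "Y k -` D k \<inter> space M = space M - (Y k -` A k \<inter> space M)"
      using measurable_space[OF Y] by (auto simp: D_def)
    then show ?thesis unfolding p_def using A by (simp add: prob_compl)
  qed
  have null: "(\<Inter>k\<in>{n..}. Y k -` D k \<inter> space M) \<in> null_sets M" for n
  proof -
    let ?I = "\<Inter>k\<in>{n..}. Y k -` D k \<inter> space M"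
    have meas: "?I \<in> sets M" using D by (intro sets.countable_INT') auto
    \<comment> \<open>Independence and 1 - p <= exp (- p). If the intersection had positive
      probability, its logarithm would bound the partial sums of p.\<close>
    have le: "prob ?I \<le> exp (- (\<Sum>k\<in>{n..n+m}. p k))" for m
    proof -
      have "prob ?I \<le> prob (\<Inter>k\<in>{n..n+m}. Y k -` D k \<inter> space M)"
        using D by (intro finite_measure_mono sets.finite_INT) auto
      also have "\<dots> = (\<Prod>k\<in>{n..n+m}. prob (Y k -` D k \<inter> space M))"
        using D by (intro indep_varsD[OF ind]) auto
      also have "\<dots> \<le> (\<Prod>k\<in>{n..n+m}. exp (- p k))"
      proof (rule prod_mono)
        fix k
        show "0 \<le> prob (Y k -` D k \<inter> space M) \<and> prob (Y k -` D k \<inter> space M) \<le> exp (- p k)"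
          using exp_ge_add_one_self[of "- p k"] pD[of k] by (intro conjI measure_nonneg) simp
      qed
      also have "\<dots> = exp (- (\<Sum>k\<in>{n..n+m}. p k))"
        by (simp add: exp_sum sum_negf[symmetric])
      finally show ?thesis .
    qed
    have "prob ?I = 0"
    proof (rule ccontr)
      assume "prob ?I \<noteq> 0"
      then have pos: "0 < prob ?I" by (simp add: zero_less_measure_iff)
      have "summable (\<lambda>k. p (k + n))"
      proof (rule summableI_nonneg_bounded)
        fix m
        have "(\<Sum>k<m. p (k + n)) \<le> (\<Sum>k\<in>{..m}. p (k + n))"
          by (rule sum_mono2) (auto simp: p_def)
        also have "\<dots> = (\<Sum>k\<in>{n..n+m}. p k)"
          using sum.shift_bounds_cl_nat_ivl[of p 0 n m] by (simp add: atLeast0AtMost add.commute)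
        also have "\<dots> \<le> - ln (prob ?I)"
        proof -
          have "ln (prob ?I) \<le> ln (exp (- (\<Sum>k\<in>{n..n+m}. p k)))"
            using le[of m] pos by (subst ln_le_cancel_iff) auto
          then show ?thesis by simp
        qed
        finally show "(\<Sum>k<m. p (k + n)) \<le> - ln (prob ?I)" .
      qed (simp add: p_def)
      then show False using div by (simp add: p_def summable_iff_shift[of "\<lambda>k. prob (Y k -` A k \<inter> space M)" n])
    qed
    then show ?thesis using meas by (auto simp: null_sets_def emeasure_eq_measure)
  qed
  have "AE \<omega> in M. \<forall>n. \<omega> \<notin> (\<Inter>k\<in>{n..}. Y k -` D k \<inter> space M)"
    unfolding AE_all_countable using null by (intro allI AE_not_in)
  then show ?thesis using AE_space
  proof eventually_elim
    case (elim \<omega>)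
    show ?case unfolding frequently_sequentially
    proof
      fix n
      obtain k where "k \<ge> n" "Y k \<omega> \<notin> D k" using elim by auto
      moreover have "Y k \<omega> \<in> space (N k)" using measurable_space[OF Y] elim by auto
      ultimately show "\<exists>k\<ge>n. Y k \<omega> \<in> A k" by (auto simp: D_def)
    qed
  qed
qed

text \<open>The density on (x, x + 1] is at least its value at x + 1. The bound is crude but has the
  right exponent to leading order, which is all that the block estimate uses.\<close>

lemma std_normal_tail_ge:
  assumes "0 \<le> x"
  shows "exp (- (x + 1)\<^sup>2 / 2) / sqrt (2 * pi) \<le> 1 - cdf std_normal_distribution x"
proof -
  interpret N: real_distribution std_normal_distribution by (rule real_dist_normal_dist)
  define c where "c = exp (- (x + 1)\<^sup>2 / 2) / sqrt (2 * pi)"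
  have "1 - cdf std_normal_distribution x = measure std_normal_distribution {x<..}"
    using N.prob_compl[of "{..x}"] by (simp add: cdf_def Compl_eq_Diff_UNIV[symmetric] Compl_atMost)
  have "ennreal c = (\<integral>\<^sup>+ y. ennreal c * indicator {x<..x+1} y \<partial>lborel)"
    by (simp add: nn_integral_cmult_indicator)
  also have "\<dots> \<le> (\<integral>\<^sup>+ y. ennreal (std_normal_density y) * indicator {x<..} y \<partial>lborel)"
  proof (rule nn_integral_mono)
    fix y
    have "c \<le> std_normal_density y" if "x < y" "y \<le> x + 1"
      unfolding c_def std_normal_density_def using that assms
      by (simp add: divide_right_mono power_mono)
    then show "ennreal c * indicator {x<..x+1} y \<le> ennreal (std_normal_density y) * indicator {x<..} y"
      by (auto simp: indicator_def ennreal_leI)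
  qed
  also have "\<dots> = emeasure std_normal_distribution {x<..}"
    by (simp add: emeasure_density)
  also have "\<dots> = ennreal (measure std_normal_distribution {x<..})"
    by (rule N.emeasure_eq_measure)
  finally have "c \<le> measure std_normal_distribution {x<..}" by simp
  also have "{x<..} = space std_normal_distribution - {..x}" by auto
  also have "measure std_normal_distribution \<dots> = 1 - cdf std_normal_distribution x"
    by (subst N.prob_compl) (auto simp: cdf_def)
  finally show ?thesis by (simp add: c_def)
qed

lemma isCont_cdf_std_normal: "isCont (cdf std_normal_distribution) x"
proof -
  interpret N: real_distribution std_normal_distribution by (rule real_dist_normal_dist)
  have "emeasure std_normal_distribution {x} = 0"
    by (subst emeasure_density) (auto intro!: nn_integral_0_iff_AE[THEN iffD2] AE_lborel_singleton[THEN AE_mp])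
  then show ?thesis by (simp add: N.isCont_cdf N.emeasure_eq_measure)
qed

context centered_iid_sequence
begin

lemma uminus_iid: "centered_iid_sequence M (\<lambda>n \<omega>. - X n \<omega>) \<sigma>"
proof
  show "indep_vars (\<lambda>_. borel) (\<lambda>n \<omega>. - X n \<omega>) UNIV"
    by (rule indep_vars_compose2[OF indep]) simp
  show "distr M borel (\<lambda>\<omega>. - X n \<omega>) = distr M borel (\<lambda>\<omega>. - X 0 \<omega>)" for n
  proof -
    have "distr M borel (\<lambda>\<omega>. - X k \<omega>) = distr (distr M borel (X k)) borel uminus" for k
      by (subst distr_distr) (auto simp: comp_def)
    then show ?thesis using distr_eq[of n] by simp
  qed
qed (use square_integrable mean_zero second_moment sigma_nonneg in auto)

lemma shifted_indep: "indep_vars (\<lambda>_. borel) (\<lambda>i. X (u + i)) UNIV"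
proof -
  have "indep_vars (\<lambda>j. PiM {u + j} (\<lambda>_. borel)) (\<lambda>j \<omega>. restrict (\<lambda>i. X i \<omega>) {u + j}) UNIV"
    by (rule indep_vars_restrict[OF indep]) (auto simp: disjoint_family_on_def)
  then have "indep_vars (\<lambda>_. borel) (\<lambda>j \<omega>. (\<lambda>z. z (u + j)) (restrict (\<lambda>i. X i \<omega>) {u + j})) UNIV"
    by (rule indep_vars_compose2) auto
  then show ?thesis by simp
qed

text \<open>Wherever it starts, a block of m variables is distributed as the m-fold product of the
  common law.\<close>

lemma prob_shifted_sum_ge:
  "prob {\<omega>\<in>space M. y \<le> (\<Sum>i=u..<u+m. X i \<omega>)} = prob {\<omega>\<in>space M. y \<le> (\<Sum>i<m. X i \<omega>)}"
proof (cases "m = 0")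
  case False
  let ?P = "PiM {..<m} (\<lambda>_. distr M borel (X 0))"
  let ?A = "{z \<in> space (PiM {..<m} (\<lambda>_. borel)). y \<le> (\<Sum>i<m. z i :: real)}"
  have "prob {\<omega>\<in>space M. y \<le> (\<Sum>i<m. X (u + i) \<omega>)} = measure ?P ?A" for u
  proof -
    have "indep_vars (\<lambda>_. borel) (\<lambda>i. X (u + i)) {..<m}"
      by (rule indep_vars_subset[OF shifted_indep]) auto
    then have "distr M (PiM {..<m} (\<lambda>_. borel)) (\<lambda>\<omega>. \<lambda>i\<in>{..<m}. X (u + i) \<omega>)
        = PiM {..<m} (\<lambda>i. distr M borel (X (u + i)))"
      using False by (subst indep_vars_iff_distr_eq_PiM'[symmetric]) auto
    also have "\<dots> = ?P" by (rule PiM_cong) (auto intro: distr_eq)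
    finally have "measure ?P ?A = measure (distr M (PiM {..<m} (\<lambda>_. borel)) (\<lambda>\<omega>. \<lambda>i\<in>{..<m}. X (u + i) \<omega>)) ?A"
      by simp
    also have "\<dots> = prob ((\<lambda>\<omega>. \<lambda>i\<in>{..<m}. X (u + i) \<omega>) -` ?A \<inter> space M)"
      by (rule measure_distr) auto
    also have "(\<lambda>\<omega>. \<lambda>i\<in>{..<m}. X (u + i) \<omega>) -` ?A \<inter> space M = {\<omega>\<in>space M. y \<le> (\<Sum>i<m. X (u + i) \<omega>)}"
      by (auto simp: space_PiM)
    finally show ?thesis by simp
  qed
  from this[of u] this[of 0] show ?thesis
    by (simp add: sum.atLeastLessThan_shift_0 atLeast0LessThan add.commute)
qed simp

text \<open>The threshold (1 - \<epsilon>) sqrt (2 s) costs an exponent of about (1 - \<epsilon>)^2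
  s, which is strictly smaller than (1 - \<epsilon>) s. For large s the difference pays for the loss
  in the Gaussian tail bound. Since s is then fixed, the central limit theorem suffices and no
  moderate deviations enter.\<close>

lemma eventually_prob_block_ge:
  assumes \<sigma>: "0 < \<sigma>" and \<epsilon>: "0 < \<epsilon>" "\<epsilon> < 1"
  shows "\<exists>s>0. eventually (\<lambda>m. exp (- (1 - \<epsilon>) * s) \<le>
    prob {\<omega>\<in>space M. (1 - \<epsilon>) * sqrt (2 * s) * \<sigma> * sqrt (real m) \<le> (\<Sum>i<m. X i \<omega>)}) sequentially"
proof -
  define C where "C = ln (sqrt (2 * pi))"
  have "((\<lambda>s. (((1 - \<epsilon>) * sqrt (2 * s) + 1)\<^sup>2 / 2 + C) / s) \<longlongrightarrow> (1 - \<epsilon>)\<^sup>2) at_top"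
    using \<epsilon> by real_asymp (simp add: powr_half_sqrt power_mult_distrib)
  moreover have "(1 - \<epsilon>)\<^sup>2 < 1 - \<epsilon>" using \<epsilon> by (simp add: power2_eq_square)
  ultimately have "eventually (\<lambda>s. (((1 - \<epsilon>) * sqrt (2 * s) + 1)\<^sup>2 / 2 + C) / s < 1 - \<epsilon>) at_top"
    by (rule order_tendstoD)
  then have "eventually (\<lambda>s. 0 < s \<and> (((1 - \<epsilon>) * sqrt (2 * s) + 1)\<^sup>2 / 2 + C) / s < 1 - \<epsilon>) at_top"
    using eventually_gt_at_top[of 0] by eventually_elim auto
  then obtain s where s: "0 < s" "(((1 - \<epsilon>) * sqrt (2 * s) + 1)\<^sup>2 / 2 + C) / s < 1 - \<epsilon>"
    by (auto dest: eventually_happens)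
  define x where "x = (1 - \<epsilon>) * sqrt (2 * s)"
  have x: "0 \<le> x" using s \<epsilon> by (simp add: x_def)
  have "(x + 1)\<^sup>2 / 2 + C < (1 - \<epsilon>) * s"
    using s by (simp add: x_def field_simps)
  then have "exp (- (1 - \<epsilon>) * s) < exp (- (x + 1)\<^sup>2 / 2 - C)" by (simp add: algebra_simps)
  also have "\<dots> = exp (- (x + 1)\<^sup>2 / 2) / sqrt (2 * pi)" by (simp add: exp_diff C_def)
  also have "\<dots> \<le> 1 - cdf std_normal_distribution x" by (rule std_normal_tail_ge[OF x])
  finally have lt: "exp (- (1 - \<epsilon>) * s) < 1 - cdf std_normal_distribution x" .
  let ?D = "\<lambda>m. distr M borel (\<lambda>\<omega>. (\<Sum>i<m. X i \<omega>) / sqrt (real m * \<sigma>\<^sup>2))"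
  have "weak_conv_m ?D std_normal_distribution"
    by (rule central_limit_theorem_zero_mean[OF indep mean_zero' \<sigma> square_integrable' _ distr_eq])
      (simp add: mean_zero' second_moment')
  then have "(\<lambda>m. 1 - cdf (?D m) x) \<longlonglongrightarrow> 1 - cdf std_normal_distribution x"
    using isCont_cdf_std_normal by (intro tendsto_diff tendsto_const) (auto simp: weak_conv_m_def weak_conv_def)
  then have "eventually (\<lambda>m. exp (- (1 - \<epsilon>) * s) < 1 - cdf (?D m) x) sequentially"
    using lt by (rule order_tendstoD)
  then have "eventually (\<lambda>m. exp (- (1 - \<epsilon>) * s) \<le>
    prob {\<omega>\<in>space M. (1 - \<epsilon>) * sqrt (2 * s) * \<sigma> * sqrt (real m) \<le> (\<Sum>i<m. X i \<omega>)}) sequentially"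
    using eventually_gt_at_top[of 0]
  proof eventually_elim
    case (elim m)
    have m: "0 < sqrt (real m * \<sigma>\<^sup>2)" using elim \<sigma> by simp
    have "1 - cdf (?D m) x = 1 - prob {\<omega>\<in>space M. (\<Sum>i<m. X i \<omega>) / sqrt (real m * \<sigma>\<^sup>2) \<le> x}"
      by (simp add: cdf_def measure_distr vimage_def Int_def conj_commute)
    also have "\<dots> = prob (space M - {\<omega>\<in>space M. (\<Sum>i<m. X i \<omega>) / sqrt (real m * \<sigma>\<^sup>2) \<le> x})"
      by (subst prob_compl) auto
    also have "\<dots> \<le> prob {\<omega>\<in>space M. (1 - \<epsilon>) * sqrt (2 * s) * \<sigma> * sqrt (real m) \<le> (\<Sum>i<m. X i \<omega>)}"
    proof (intro finite_measure_mono subsetI CollectI conjI)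
      fix \<omega>
      assume \<omega>: "\<omega> \<in> space M - {\<omega>\<in>space M. (\<Sum>i<m. X i \<omega>) / sqrt (real m * \<sigma>\<^sup>2) \<le> x}"
      then have "x * sqrt (real m * \<sigma>\<^sup>2) < (\<Sum>i<m. X i \<omega>)"
        using m by (simp add: not_le pos_less_divide_eq)
      then show "(1 - \<epsilon>) * sqrt (2 * s) * \<sigma> * sqrt (real m) \<le> (\<Sum>i<m. X i \<omega>)"
        using \<sigma> by (simp add: x_def real_sqrt_mult mult_ac)
    qed auto
    finally show ?case using elim by simp
  qed
  then show ?thesis using s(1) by blast
qed

end

lemma frequently_sequentially_subseq:
  assumes "\<exists>\<^sub>F k in sequentially. P (t k)" "filterlim t sequentially sequentially"
  shows "\<exists>\<^sub>F n in sequentially. P n"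
  using assms unfolding frequently_def filterlim_iff by blast

text \<open>If each of p pieces of length m exceeds (1 - \<epsilon>) \<sigma> sqrt (2 s m), their
  total exceeds (1 - \<epsilon>) \<sigma> sqrt (2 s p) sqrt (p m). With s p close to log k this is
  the size wanted for a block of p m terms, and the probabilities multiply to a power of k whose
  series diverges.\<close>

lemma (in centered_iid_sequence) AE_sum_ge:
  assumes \<sigma>: "0 < \<sigma>" and half: "0 < \<epsilon>" "\<epsilon> < 1 / 2"
  shows "AE \<omega> in M. \<exists>\<^sub>F n in sequentially. (1 - 2 * \<epsilon>) * \<sigma> * lil_norm (real n) \<le> (\<Sum>k<n. X k \<omega>)"
proof -
  have \<epsilon>: "0 < \<epsilon>" "\<epsilon> < 1" using half by auto
  obtain s where s: "0 < s" and block: "eventually (\<lambda>m. exp (- (1 - \<epsilon>) * s) \<le>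
    prob {\<omega>\<in>space M. (1 - \<epsilon>) * sqrt (2 * s) * \<sigma> * sqrt (real m) \<le> (\<Sum>i<m. X i \<omega>)}) sequentially"
    using eventually_prob_block_ge[OF \<sigma> \<epsilon>] by blast
  define x where "x = (1 - \<epsilon>) * sqrt (2 * s) * \<sigma>"
  have x: "0 < x" using \<epsilon> s \<sigma> by (simp add: x_def)
  \<comment> \<open>A large ratio N makes the terms before a block harmless: they shorten the useful
    part by the factor (N - 1) / N, and their sum, at worst -2 \<sigma> lil_norm (N^k), costs at
    most 2 / sqrt N of the norm at the end of the block.\<close>
  have "((\<lambda>N. (1 - \<epsilon>) * sqrt ((N - 1) / N) - 2 / sqrt N) \<longlongrightarrow> 1 - \<epsilon>) at_top"
    by real_asymp
  then have "eventually (\<lambda>N. 1 - 2 * \<epsilon> < (1 - \<epsilon>) * sqrt ((N - 1) / N) - 2 / sqrt N) at_top"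
    using \<epsilon> by (intro order_tendstoD(1)) auto
  then have "eventually (\<lambda>N. 1 - 2 * \<epsilon> < (1 - \<epsilon>) * sqrt ((real N - 1) / real N) - 2 / sqrt (real N)) sequentially"
    using filterlim_real_sequentially by (rule eventually_compose_filterlim)
  then have "eventually (\<lambda>N. 2 \<le> N \<and> 1 - 2 * \<epsilon> < (1 - \<epsilon>) * sqrt ((real N - 1) / real N) - 2 / sqrt (real N)) sequentially"
    using eventually_ge_at_top[of 2] by eventually_elim auto
  then obtain N where N2: "2 \<le> N" and N: "1 - 2 * \<epsilon> < (1 - \<epsilon>) * sqrt ((real N - 1) / real N) - 2 / sqrt (real N)"
    by (auto dest: eventually_happens)

  (* Block k is {N^k..<N^(k+1)}, cut into p k pieces of length m k. By the central limit theorem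
     all pieces exceed x sqrt(m k) with probability about k powr -(1 - epsilon). *)
  define p where "p k = Suc (nat \<lfloor>ln (real k) / s\<rfloor>)" for k :: nat
  define m where "m k = ((N - 1) * N ^ k) div p k" for k
  define t where "t k = N ^ k + p k * m k" for k
  have p_ge: "ln (real k) / s \<le> real (p k)" for k unfolding p_def by linarith
  have p_le: "real (p k) \<le> ln (real k) / s + 1" if "1 \<le> k" for k
    using that s by (simp add: p_def)
  have p_pos: "0 < real (p k)" for k by (simp add: p_def)
  have pm_le: "p k * m k \<le> (N - 1) * N ^ k" for k by (simp add: m_def)
  have pm_ge: "real ((N - 1) * N ^ k) - real (p k) \<le> real (p k) * real (m k)" for k
  proof -
    have "(N - 1) * N ^ k < p k * m k + p k"
      unfolding m_def by (metis dividend_less_times_div p_def zero_less_Suc add.commute)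
    then show ?thesis by (metis add.commute less_diff_eq less_eq_real_def diff_less_eq of_nat_add of_nat_less_iff of_nat_mult)
  qed
  have t_le: "t k \<le> N ^ Suc k" for k
  proof -
    have "t k \<le> N ^ k + (N - 1) * N ^ k" unfolding t_def using pm_le[of k] by simp
    also have "\<dots> = N ^ Suc k" using N2 by (cases N) auto
    finally show ?thesis .
  qed
  have m_lim: "filterlim m sequentially sequentially"
  proof -
    have "filterlim (\<lambda>k. (real N - 1) * real N ^ k / (ln (real k) / s + 1) - 1) at_top sequentially"
      using N2 s by real_asymp
    moreover have "eventually (\<lambda>k. (real N - 1) * real N ^ k / (ln (real k) / s + 1) - 1 \<le> real (m k)) sequentially"
      using eventually_ge_at_top[of 1]
    proof eventually_elim
      case (elim k)
      have "(real N - 1) * real N ^ k / (ln (real k) / s + 1) \<le> (real N - 1) * real N ^ k / real (p k)"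
        using p_le[OF elim] p_pos[of k] N2 by (intro divide_left_mono mult_pos_pos) auto
      also have "\<dots> \<le> real (m k) + 1"
        using pm_ge[of k] p_pos[of k] N2 by (simp add: field_simps of_nat_diff)
      finally show ?case by simp
    qed
    ultimately have "filterlim (\<lambda>k. real (m k)) at_top sequentially"
      by (rule filterlim_at_top_mono)
    then have "eventually (\<lambda>k. real Z \<le> real (m k)) sequentially" for Z
      unfolding filterlim_at_top by blast
    then show ?thesis unfolding filterlim_at_top by simp
  qed
  have k_less: "k < N ^ k" for k
    using N2 power_gt_expt[of N k] by simp
  have t_lim: "filterlim t sequentially sequentially"
  proof (rule filterlim_at_top_mono)
    show "filterlim (\<lambda>k::nat. k) sequentially sequentially" by (rule filterlim_ident)
    show "eventually (\<lambda>k. k \<le> t k) sequentially"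
      unfolding t_def by (intro always_eventually allI trans_le_add1 less_imp_le[OF k_less])
  qed

  \<comment> \<open>The full blocks \<open>I k\<close> carry the independence between different k,
    the pieces \<open>J k j\<close> the independence inside a block. The pieces end at
    \<open>t k\<close>, which may fall short of the end of the block because the division drops a
    remainder.\<close>
  define I where "I k = {N ^ k..<N ^ Suc k}" for k
  define J where "J k j = {N ^ k + j * m k..<N ^ k + j * m k + m k}" for k j
  have J_sub: "J k j \<subseteq> {N ^ k..<t k}" "J k j \<subseteq> I k" if "j < p k" for k j
  proof -
    have "j * m k + m k \<le> p k * m k" using that by (metis add.commute mult_Suc mult_le_mono1 Suc_leI)
    then show "J k j \<subseteq> {N ^ k..<t k}" by (auto simp: J_def t_def)
    then show "J k j \<subseteq> I k" using t_le[of k] by (auto simp: I_def)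
  qed
  have J_sum: "(\<Sum>j<n. \<Sum>i\<in>J k j. z i) = (\<Sum>i=N ^ k..<N ^ k + n * m k. z i)" for k n and z :: "nat \<Rightarrow> real"
  proof (induction n)
    case (Suc n)
    have "(\<Sum>i=N ^ k..<N ^ k + Suc n * m k. z i)
        = (\<Sum>i=N ^ k..<N ^ k + n * m k. z i) + (\<Sum>i=N ^ k + n * m k..<N ^ k + Suc n * m k. z i)"
      by (rule sum.atLeastLessThan_concat[symmetric]) auto
    then show ?case using Suc by (simp add: J_def algebra_simps)
  qed simp
  have I_disj: "disjoint_family_on I UNIV"
    unfolding disjoint_family_on_def
  proof (intro ballI impI)
    have *: "I a \<inter> I b = {}" if "a < b" for a b
    proof -
      have "N ^ Suc a \<le> N ^ b" using that N2 by (intro power_increasing) auto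
      then show ?thesis by (auto simp: I_def)
    qed
    fix a b :: nat assume "a \<noteq> b"
    then show "I a \<inter> I b = {}" using *[of a b] *[of b a] by (cases a b rule: linorder_cases) auto
  qed
  have J_disj: "disjoint_family_on (J k) {..<n}" for k n
    unfolding disjoint_family_on_def
  proof (intro ballI impI)
    have *: "J k a \<inter> J k b = {}" if "a < b" for a b
    proof -
      have "a * m k + m k \<le> b * m k" using that by (metis add.commute mult_Suc mult_le_mono1 Suc_leI)
      then show ?thesis by (auto simp: J_def)
    qed
    fix a b :: nat assume "a \<noteq> b"
    then show "J k a \<inter> J k b = {}" using *[of a b] *[of b a] by (cases a b rule: linorder_cases) auto
  qed

  define y where "y k = x * sqrt (real (m k))" for k
  define A where "A k = {z \<in> space (PiM (I k) (\<lambda>_. borel)). \<forall>j<p k. y k \<le> (\<Sum>i\<in>J k j. z i :: real)}" for k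
  define Y where "Y k \<omega> = restrict (\<lambda>i. X i \<omega>) (I k)" for k \<omega>
  have Am: "A k \<in> sets (PiM (I k) (\<lambda>_. borel))" for k
  proof -
    have [measurable]: "(\<lambda>z. \<Sum>i\<in>J k j. z i :: real) \<in> borel_measurable (PiM (I k) (\<lambda>_. borel))" if "j < p k" for j
      using J_sub(2)[OF that] by (intro borel_measurable_sum measurable_component_singleton) auto
    have "A k = (\<Inter>j<p k. {z \<in> space (PiM (I k) (\<lambda>_. borel)). y k \<le> (\<Sum>i\<in>J k j. z i :: real)})"
      by (auto simp: A_def p_def)
    also have "\<dots> \<in> sets (PiM (I k) (\<lambda>_. borel))"
      by (intro sets.finite_INT) (auto simp: p_def)
    finally show ?thesis .
  qed
  have ind: "indep_vars (\<lambda>k. PiM (I k) (\<lambda>_. borel)) Y UNIV"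
    unfolding Y_def[abs_def] by (rule indep_vars_restrict[OF indep]) (use I_disj in auto)
  have YA: "Y k \<omega> \<in> A k \<longleftrightarrow> (\<forall>j<p k. y k \<le> (\<Sum>i\<in>J k j. X i \<omega>))" for k \<omega>
  proof -
    have "(\<Sum>i\<in>J k j. Y k \<omega> i) = (\<Sum>i\<in>J k j. X i \<omega>)" if "j < p k" for j
      using J_sub(2)[OF that] by (intro sum.cong) (auto simp: Y_def)
    then show ?thesis by (auto simp: A_def Y_def space_PiM)
  qed
  define q where "q k = prob {\<omega>\<in>space M. y k \<le> (\<Sum>i<m k. X i \<omega>)}" for k
  have prob_A: "prob (Y k -` A k \<inter> space M) = q k ^ p k" for k
  proof -
    have "indep_vars (\<lambda>j. PiM (J k j) (\<lambda>_. borel)) (\<lambda>j \<omega>. restrict (\<lambda>i. X i \<omega>) (J k j)) {..<p k}"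
      by (rule indep_vars_restrict[OF indep]) (use J_disj in auto)
    then have "indep_vars (\<lambda>_. borel) (\<lambda>j \<omega>. (\<lambda>z. \<Sum>i\<in>J k j. z i) (restrict (\<lambda>i. X i \<omega>) (J k j))) {..<p k}"
      by (rule indep_vars_compose2) simp
    then have "prob (\<Inter>j\<in>{..<p k}. (\<lambda>\<omega>. \<Sum>i\<in>J k j. X i \<omega>) -` {y k..} \<inter> space M)
        = (\<Prod>j\<in>{..<p k}. prob ((\<lambda>\<omega>. \<Sum>i\<in>J k j. X i \<omega>) -` {y k..} \<inter> space M))"
      by (intro indep_varsD[where I="{..<p k}"]) (auto simp: p_def)
    also have "\<dots> = (\<Prod>j\<in>{..<p k}. q k)"
    proof (rule prod.cong)
      fix j
      have "(\<lambda>\<omega>. \<Sum>i\<in>J k j. X i \<omega>) -` {y k..} \<inter> space M = {\<omega>\<in>space M. y k \<le> (\<Sum>i\<in>J k j. X i \<omega>)}"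
        by auto
      then show "prob ((\<lambda>\<omega>. \<Sum>i\<in>J k j. X i \<omega>) -` {y k..} \<inter> space M) = q k"
        unfolding q_def J_def by (simp only: prob_shifted_sum_ge)
    qed simp
    also have "(\<Inter>j\<in>{..<p k}. (\<lambda>\<omega>. \<Sum>i\<in>J k j. X i \<omega>) -` {y k..} \<inter> space M) = Y k -` A k \<inter> space M"
      by (auto simp: YA p_def)
    finally show ?thesis by simp
  qed
  have ev_q: "eventually (\<lambda>k. exp (- (1 - \<epsilon>) * s) \<le> q k) sequentially"
    unfolding q_def y_def x_def using eventually_compose_filterlim[OF block m_lim] by simp
  have div: "\<not> summable (\<lambda>k. prob (Y k -` A k \<inter> space M))"
  proof
    assume sm: "summable (\<lambda>k. prob (Y k -` A k \<inter> space M))"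
    have "summable (\<lambda>k. exp (- (1 - \<epsilon>) * s) * real k powr (- (1 - \<epsilon>)))"
    proof (rule summable_comparison_test_ev[OF _ sm])
      show "eventually (\<lambda>k. norm (exp (- (1 - \<epsilon>) * s) * real k powr (- (1 - \<epsilon>)))
          \<le> prob (Y k -` A k \<inter> space M)) sequentially"
        using ev_q eventually_ge_at_top[of 1]
      proof eventually_elim
        case (elim k)
        have "exp (- (1 - \<epsilon>) * s) * real k powr (- (1 - \<epsilon>)) = exp (- ((1 - \<epsilon>) * s * (ln (real k) / s + 1)))"
          using elim s by (simp add: powr_def field_simps flip: exp_add)
        also have "\<dots> \<le> exp (- ((1 - \<epsilon>) * s * real (p k)))"
          using p_le[of k] elim s \<epsilon> by (simp add: mult_left_mono)
        also have "\<dots> = exp (- (1 - \<epsilon>) * s) ^ p k"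
          by (subst exp_of_nat_mult[symmetric]) (simp add: algebra_simps)
        also have "\<dots> \<le> q k ^ p k" using elim by (intro power_mono) auto
        finally show ?case by (simp add: prob_A)
      qed
    qed
    then have "summable (\<lambda>k. real k powr (- (1 - \<epsilon>)))" by (subst (asm) summable_cmult_iff) auto
    then show False using \<epsilon> by (simp add: summable_real_powr_iff)
  qed
  \<comment> \<open>The upper half of the law for - X keeps the sum of the first N^k terms above -2
    \<sigma> lil_norm (N^k) for all large k, almost surely.\<close>
  interpret neg: centered_iid_sequence M "\<lambda>n \<omega>. - X n \<omega>" \<sigma> by (rule uminus_iid)

  \<comment> \<open>Chosen so that sqrt (\<rho> k) times the norm at N^(k+1) equals sqrt (2 ln k *
    length), where length is a lower bound for p k * m k. The limit is (N - 1) / N because loglog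
    (N^(k+1)) is asymptotic to ln k.\<close>
  define \<rho> where "\<rho> k = ((real N - 1) * real N ^ k - (ln (real k) / s + 1)) / real N ^ Suc k * (ln (real k) / loglog (real N ^ Suc k))" for k
  have rho_lim: "\<rho> \<longlonglongrightarrow> (real N - 1) / real N"
  proof -
    have "filterlim (\<lambda>k. real N ^ Suc k) at_top sequentially" using N2 by real_asymp
    from eventually_compose_filterlim[OF eventually_loglog_eq this]
    have ev: "eventually (\<lambda>k. ((real N - 1) * real N ^ k - (ln (real k) / s + 1)) / real N ^ Suc k * (ln (real k) / ln (ln (real N ^ Suc k))) = \<rho> k) sequentially"
      by eventually_elim (simp add: \<rho>_def)
    have "(\<lambda>k. ((real N - 1) * real N ^ k - (ln (real k) / s + 1)) / real N ^ Suc k * (ln (real k) / ln (ln (real N ^ Suc k))))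
      \<longlonglongrightarrow> (real N - 1) / real N"
      using N2 s by real_asymp (simp add: divide_inverse)
    then show ?thesis using ev by (rule Lim_transform_eventually)
  qed
  have "(\<lambda>k. (1 - \<epsilon>) * sqrt (\<rho> k) - 2 / sqrt (real N)) \<longlonglongrightarrow> (1 - \<epsilon>) * sqrt ((real N - 1) / real N) - 2 / sqrt (real N)"
    by (intro tendsto_intros rho_lim)
  from order_tendstoD(1)[OF this N]
  have ev_rho: "eventually (\<lambda>k. 1 - 2 * \<epsilon> < (1 - \<epsilon>) * sqrt (\<rho> k) - 2 / sqrt (real N)) sequentially" .

  have two_sigma: "\<sigma> < 2 * \<sigma>" using \<sigma> by simp
  have power_lim: "filterlim (\<lambda>k. N ^ k) sequentially sequentially"
  proof (rule filterlim_at_top_mono)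
    show "filterlim (\<lambda>k::nat. k) sequentially sequentially" by (rule filterlim_ident)
  qed (use less_imp_le[OF k_less] in auto)

  show ?thesis
    using borel_cantelli_2[OF ind Am div] neg.AE_sum_le[of "2 * \<sigma>", simplified sum_negf, OF two_sigma]
  proof eventually_elim
    case (elim \<omega>)
    have ev_low: "eventually (\<lambda>k. - (2 * \<sigma>) * lil_norm (real (N ^ k)) \<le> (\<Sum>i<N ^ k. X i \<omega>)) sequentially"
      using eventually_compose_filterlim[OF elim(2) power_lim] by eventually_elim simp
    have "\<exists>\<^sub>F k in sequentially. (1 - 2 * \<epsilon>) * \<sigma> * lil_norm (real (t k)) \<le> (\<Sum>i<t k. X i \<omega>)"
      using elim(1)
    proof (rule frequently_rev_mp)
      show "eventually (\<lambda>k. Y k \<omega> \<in> A k \<longrightarrow> (1 - 2 * \<epsilon>) * \<sigma> * lil_norm (real (t k)) \<le> (\<Sum>i<t k. X i \<omega>)) sequentially"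
        using ev_low ev_rho eventually_ge_at_top[of 1]
      proof eventually_elim
        case (elim k)
        let ?L = "lil_norm (real N ^ Suc k)"
        show ?case
        proof
          assume "Y k \<omega> \<in> A k"
          then have "(\<Sum>j<p k. y k) \<le> (\<Sum>j<p k. \<Sum>i\<in>J k j. X i \<omega>)"
            unfolding YA by (intro sum_mono) auto
          then have "real (p k) * y k \<le> (\<Sum>i=N ^ k..<t k. X i \<omega>)"
            unfolding J_sum t_def by simp
          moreover have "(\<Sum>i<t k. X i \<omega>) = (\<Sum>i<N ^ k. X i \<omega>) + (\<Sum>i=N ^ k..<t k. X i \<omega>)"
            using sum.atLeastLessThan_concat[of 0 "N ^ k" "t k" "\<lambda>i. X i \<omega>"] by (simp add: t_def atLeast0LessThan)
          moreover have "(1 - \<epsilon>) * \<sigma> * sqrt (\<rho> k) * ?L \<le> real (p k) * y k"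
          proof -
            have "sqrt (\<rho> k) * ?L = sqrt (2 * ln (real k) * ((real N - 1) * real N ^ k - (ln (real k) / s + 1)))"
              unfolding \<rho>_def lil_norm_def real_sqrt_mult[symmetric]
              using N2 loglog_pos[of "real N ^ Suc k"] by (intro arg_cong[of _ _ sqrt]) (simp add: field_simps)
            also have "\<dots> \<le> sqrt (2 * (s * real (p k)) * (real (p k) * real (m k)))"
            proof (intro real_sqrt_le_mono)
              have "(real N - 1) * real N ^ k - (ln (real k) / s + 1) \<le> real (p k) * real (m k)"
                using pm_ge[of k] p_le[of k] elim N2 by (simp add: of_nat_diff)
              then have "2 * ln (real k) * ((real N - 1) * real N ^ k - (ln (real k) / s + 1))
                  \<le> 2 * ln (real k) * (real (p k) * real (m k))"
                using elim by (intro mult_left_mono) auto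
              also have "\<dots> \<le> 2 * (s * real (p k)) * (real (p k) * real (m k))"
                using p_ge[of k] s by (intro mult_right_mono) (auto simp: field_simps)
              finally show "2 * ln (real k) * ((real N - 1) * real N ^ k - (ln (real k) / s + 1))
                \<le> 2 * (s * real (p k)) * (real (p k) * real (m k))" .
            qed
            also have "\<dots> = real (p k) * sqrt (2 * s) * sqrt (real (m k))"
              by (simp add: real_sqrt_mult)
            finally have "(1 - \<epsilon>) * \<sigma> * (sqrt (\<rho> k) * ?L) \<le> (1 - \<epsilon>) * \<sigma> * (real (p k) * sqrt (2 * s) * sqrt (real (m k)))"
              using \<epsilon> \<sigma> by (intro mult_left_mono) auto
            then show ?thesis by (simp add: y_def x_def mult_ac)
          qed
          moreover have "lil_norm (real (N ^ k)) \<le> ?L / sqrt (real N)"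
          proof -
            have "loglog (real N ^ k) \<le> loglog (real N ^ Suc k)"
              using N2 by (intro loglog_mono power_increasing) auto
            then have "2 * real N ^ k * loglog (real N ^ k) \<le> 2 * real N ^ Suc k * loglog (real N ^ Suc k) / real N"
              using N2 by simp
            then show ?thesis
              unfolding lil_norm_def by (subst real_sqrt_divide[symmetric]) simp
          qed
          ultimately have "(\<Sum>i<t k. X i \<omega>) \<ge> (1 - \<epsilon>) * \<sigma> * sqrt (\<rho> k) * ?L - 2 * \<sigma> * (?L / sqrt (real N))"
            using elim(1) \<sigma> by (smt (verit) mult_left_mono mult_minus_left)
          then have "\<sigma> * ?L * ((1 - \<epsilon>) * sqrt (\<rho> k) - 2 / sqrt (real N)) \<le> (\<Sum>i<t k. X i \<omega>)"
            by (simp add: algebra_simps)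
          moreover have "\<sigma> * ?L * (1 - 2 * \<epsilon>) \<le> \<sigma> * ?L * ((1 - \<epsilon>) * sqrt (\<rho> k) - 2 / sqrt (real N))"
            using elim(2) \<sigma> lil_norm_nonneg[of "real N ^ Suc k"] by (intro mult_left_mono) auto
          moreover have "(1 - 2 * \<epsilon>) * \<sigma> * lil_norm (real (t k)) \<le> (1 - 2 * \<epsilon>) * \<sigma> * ?L"
          proof -
            have "real (t k) \<le> real N ^ Suc k" using t_le[of k] by (metis of_nat_le_iff of_nat_power)
            then show ?thesis using half \<sigma> by (intro mult_left_mono lil_norm_mono) auto
          qed
          ultimately show "(1 - 2 * \<epsilon>) * \<sigma> * lil_norm (real (t k)) \<le> (\<Sum>i<t k. X i \<omega>)"
            by (simp add: mult_ac)
        qed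
      qed
    qed
    then show ?case by (rule frequently_sequentially_subseq[OF _ t_lim])
  qed
qed

text \<open>Vanishing increments are a discrete intermediate value property: on the infinitely many
  passages from near the lower to near the upper limit the sequence cannot jump over a neighbourhood
  of y.\<close>

lemma cluster_set_eq_interval:
  fixes x :: "nat \<Rightarrow> real"
  assumes inc: "(\<lambda>n. x (Suc n) - x n) \<longlonglongrightarrow> 0"
    and low: "\<And>a. a < l \<Longrightarrow> eventually (\<lambda>n. a < x n) sequentially" "\<And>a. l < a \<Longrightarrow> \<exists>\<^sub>F n in sequentially. x n < a"
    and up: "\<And>a. u < a \<Longrightarrow> eventually (\<lambda>n. x n < a) sequentially" "\<And>a. a < u \<Longrightarrow> \<exists>\<^sub>F n in sequentially. a < x n"
    and "l \<le> u"
  shows "cluster_set x = {l..u}"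
proof (intro equalityI subsetI)
  fix y assume "y \<in> cluster_set x"
  then obtain r where r: "strict_mono r" "(x \<circ> r) \<longlonglongrightarrow> y" by (auto simp: cluster_set_def)
  have fl: "filterlim r sequentially sequentially" using r(1) by (rule filterlim_subseq)
  have "l \<le> y"
  proof (rule dense_le)
    fix a assume "a < l"
    then have "eventually (\<lambda>n. a < x (r n)) sequentially"
      using eventually_compose_filterlim[OF low(1) fl] by auto
    then show "a \<le> y"
      by (intro tendsto_lowerbound[OF r(2)]) (auto elim: eventually_mono)
  qed
  moreover have "y \<le> u"
  proof (rule dense_ge)
    fix a assume "u < a"
    then have "eventually (\<lambda>n. x (r n) < a) sequentially"
      using eventually_compose_filterlim[OF up(1) fl] by auto
    then show "y \<le> a"
      by (intro tendsto_upperbound[OF r(2)]) (auto elim: eventually_mono)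
  qed
  ultimately show "y \<in> {l..u}" by simp
next
  fix y assume y: "y \<in> {l..u}"
  have near: "\<exists>n\<ge>N. \<bar>x n - y\<bar> < e" if e: "0 < e" for e N
  proof -
    obtain K where K: "\<And>n. K \<le> n \<Longrightarrow> \<bar>x (Suc n) - x n\<bar> < e"
      using LIMSEQ_D[OF inc e] by auto
    have "\<exists>\<^sub>F n in sequentially. x n < y + e" "\<exists>\<^sub>F n in sequentially. y - e < x n"
      using low(2)[of "y + e"] up(2)[of "y - e"] y e by auto
    note often = this[unfolded frequently_sequentially]
    obtain a where a: "max N K \<le> a" "x a < y + e"
      using often(1) by blast
    obtain b where b: "a \<le> b" "y - e < x b"
      using often(2) by blast
    \<comment> \<open>The first entry above y - e after a time a with value below y + e. Unless this
      is a itself, the preceding value is at most y - e and the increment is less than e, so the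
      entry lands inside the window.\<close>
    define c where "c = (LEAST c. a \<le> c \<and> y - e < x c)"
    have c: "a \<le> c" "y - e < x c"
      using LeastI[of "\<lambda>c. a \<le> c \<and> y - e < x c" b] b by (auto simp: c_def)
    have "x c < y + e"
    proof (cases "c = a")
      case False
      then obtain d where d: "c = Suc d" "a \<le> d" using c(1) by (cases c) auto
      have "\<not> (a \<le> d \<and> y - e < x d)"
        using d(1) by (intro not_less_Least) (simp add: c_def)
      then have "x d \<le> y - e" using d by auto
      moreover have "\<bar>x c - x d\<bar> < e" unfolding d(1) using d a by (intro K) auto
      ultimately show ?thesis using e by linarith
    qed (use a in simp)
    then show ?thesis using a c by (intro exI[of _ c]) auto
  qed
  define P where "P k n \<longleftrightarrow> \<bar>x n - y\<bar> < 1 / real (Suc k)" for k n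
  have "\<exists>r. strict_mono r \<and> (\<forall>k. P k (r k))"
  proof -
    have "\<forall>k m. \<exists>n. m < n \<and> P k n"
    proof (intro allI)
      show "\<exists>n. m < n \<and> P k n" for k m
        using near[of "1 / real (Suc k)" "Suc m"] by (auto simp: P_def Suc_le_eq)
    qed
    then obtain g where g: "\<And>k m. m < g k m \<and> P k (g k m)" by metis
    define r where "r = rec_nat (g 0 0) (\<lambda>k v. g (Suc k) v)"
    have "r (Suc k) = g (Suc k) (r k)" "r 0 = g 0 0" for k by (simp_all add: r_def)
    then have "strict_mono r" "P k (r k)" for k
      using g by (auto intro!: strict_mono_Suc_iff[THEN iffD2], cases k, auto)
    then show ?thesis by blast
  qed
  then obtain r where r: "strict_mono r" "\<And>k. \<bar>x (r k) - y\<bar> < 1 / real (Suc k)"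
    by (auto simp: P_def)
  have "(\<lambda>k. x (r k) - y) \<longlonglongrightarrow> 0"
  proof (rule Lim_null_comparison)
    show "eventually (\<lambda>k. norm (x (r k) - y) \<le> 1 / real (Suc k)) sequentially"
      using r(2) by (intro always_eventually allI) (auto intro: less_imp_le)
    show "(\<lambda>k. 1 / real (Suc k)) \<longlonglongrightarrow> 0" by real_asymp
  qed
  then show "y \<in> cluster_set x"
    using r(1) by (auto simp: cluster_set_def comp_def LIM_zero_iff)
qed

lemma limsup_eqI:
  fixes x :: "nat \<Rightarrow> real"
  assumes "\<And>a. u < a \<Longrightarrow> eventually (\<lambda>n. x n < a) sequentially"
    and "\<And>a. a < u \<Longrightarrow> \<exists>\<^sub>F n in sequentially. a < x n"
  shows "limsup (\<lambda>n. ereal (x n)) = ereal u"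
proof (rule antisym)
  show "limsup (\<lambda>n. ereal (x n)) \<le> ereal u"
  proof (rule dense_ge)
    fix b assume "ereal u < b"
    then obtain a where a: "u < a" "ereal a < b"
      using ereal_dense2[of "ereal u" b] by auto
    have "limsup (\<lambda>n. ereal (x n)) \<le> ereal a"
      using assms(1)[OF a(1)] by (intro Limsup_bounded) (auto elim!: eventually_mono)
    then show "limsup (\<lambda>n. ereal (x n)) \<le> b" using a by simp
  qed
  show "ereal u \<le> limsup (\<lambda>n. ereal (x n))"
  proof (rule dense_le)
    fix b assume "b < ereal u"
    then obtain a where a: "b < ereal a" "a < u"
      using ereal_dense2[of b "ereal u"] by auto
    show "b \<le> limsup (\<lambda>n. ereal (x n))"
    proof (rule ccontr)
      assume "\<not> b \<le> limsup (\<lambda>n. ereal (x n))"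
      then have "limsup (\<lambda>n. ereal (x n)) < ereal a" using a by auto
      then have "eventually (\<lambda>n. ereal (x n) < ereal a) sequentially" by (rule Limsup_lessD)
      then have "eventually (\<lambda>n. \<not> a < x n) sequentially" by (auto elim!: eventually_mono)
      then show False using assms(2)[OF a(2)] by (simp add: frequently_def)
    qed
  qed
qed

lemma liminf_eqI:
  fixes x :: "nat \<Rightarrow> real"
  assumes "\<And>a. a < l \<Longrightarrow> eventually (\<lambda>n. a < x n) sequentially"
    and "\<And>a. l < a \<Longrightarrow> \<exists>\<^sub>F n in sequentially. x n < a"
  shows "liminf (\<lambda>n. ereal (x n)) = ereal l"
proof -
  have "limsup (\<lambda>n. ereal (- x n)) = ereal (- l)"
  proof (rule limsup_eqI)
    show "eventually (\<lambda>n. - x n < a) sequentially" if "- l < a" for a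
      using assms(1)[of "- a"] that by (auto elim!: eventually_mono)
    show "\<exists>\<^sub>F n in sequentially. a < - x n" if "a < - l" for a
      using assms(2)[of "- a"] that by (auto elim!: frequently_elim1)
  qed
  then show ?thesis
    using ereal_Liminf_uminus[of sequentially "\<lambda>n. ereal (- x n)"] by simp
qed

section \<open>Upper limit, lower limit and cluster set of the normalized sums\<close>

context centered_iid_sequence
begin

definition lil_ratio :: "'a \<Rightarrow> nat \<Rightarrow> real" where
  "lil_ratio \<omega> n = (\<Sum>k<n. X k \<omega>) / lil_norm (real n)"

lemma AE_lil_ratio_less: "AE \<omega> in M. \<forall>a>\<sigma>. eventually (\<lambda>n. lil_ratio \<omega> n < a) sequentially"
proof -
  have "AE \<omega> in M. \<forall>j. eventually (\<lambda>n. (\<Sum>k<n. X k \<omega>) \<le> (\<sigma> + 1 / real (Suc j)) * lil_norm (real n)) sequentially"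
    unfolding AE_all_countable by (intro allI AE_sum_le) simp
  then show ?thesis
  proof eventually_elim
    case (elim \<omega>)
    show ?case
    proof (intro allI impI)
      fix a assume "\<sigma> < a"
      then obtain j where j: "1 / real (Suc j) < a - \<sigma>"
        using nat_approx_posE[of "a - \<sigma>"] by auto
      show "eventually (\<lambda>n. lil_ratio \<omega> n < a) sequentially"
        using elim[rule_format, of j] eventually_gt_at_top[of 0]
      proof eventually_elim
        case (elim n)
        then have "lil_ratio \<omega> n \<le> \<sigma> + 1 / real (Suc j)"
          using lil_norm_pos[of "real n"] by (simp add: lil_ratio_def pos_divide_le_eq)
        then show ?case using j by simp
      qed
    qed
  qed
qed

end

lemma (in centered_iid_sequence) lil_ratio_uminus:
  "centered_iid_sequence.lil_ratio (\<lambda>n \<omega>. - X n \<omega>) \<omega> n = - lil_ratio \<omega> n"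
  unfolding lil_ratio_def centered_iid_sequence.lil_ratio_def[OF uminus_iid] by (simp add: sum_negf)

lemma (in centered_iid_sequence) AE_lil_ratio_greater:
  "AE \<omega> in M. \<forall>a<\<sigma>. \<exists>\<^sub>F n in sequentially. a < lil_ratio \<omega> n"
\<comment> \<open>The block argument needs a positive variance. In the degenerate case the upper
  bound for - X already keeps the ratio eventually above every negative a.\<close>
proof (cases "\<sigma> = 0")
  case True
  interpret neg: centered_iid_sequence M "\<lambda>n \<omega>. - X n \<omega>" \<sigma> by (rule uminus_iid)
  show ?thesis
    using neg.AE_lil_ratio_less
  proof eventually_elim
    case (elim \<omega>)
    show ?case
    proof (intro allI impI)
      fix a assume "a < \<sigma>"
      then have "eventually (\<lambda>n. a < lil_ratio \<omega> n) sequentially"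
        using elim[rule_format, of "- a"] True by (simp add: lil_ratio_uminus)
      then show "\<exists>\<^sub>F n in sequentially. a < lil_ratio \<omega> n"
        by (rule eventually_frequently[rotated]) simp
    qed
  qed
next
  case False
  then have \<sigma>: "0 < \<sigma>" using sigma_nonneg by simp
  \<comment> \<open>Countably many values of \<open>\<epsilon>\<close> suffice; the offset 3 keeps
    all of them below 1 / 2.\<close>
  have "AE \<omega> in M. \<forall>j. \<exists>\<^sub>F n in sequentially. (1 - 2 * (1 / real (j + 3))) * \<sigma> * lil_norm (real n) \<le> (\<Sum>k<n. X k \<omega>)"
    unfolding AE_all_countable using \<sigma> by (intro allI AE_sum_ge) auto
  then show ?thesis
  proof eventually_elim
    case (elim \<omega>)
    show ?case
    proof (intro allI impI)
      fix a assume "a < \<sigma>"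
      have "(\<lambda>j. (1 - 2 * (1 / real (j + 3))) * \<sigma>) \<longlonglongrightarrow> \<sigma>" by real_asymp
      then have "eventually (\<lambda>j. a < (1 - 2 * (1 / real (j + 3))) * \<sigma>) sequentially"
        using \<open>a < \<sigma>\<close> by (rule order_tendstoD)
      then obtain j where j: "a < (1 - 2 * (1 / real (j + 3))) * \<sigma>"
        by (auto dest: eventually_happens)
      show "\<exists>\<^sub>F n in sequentially. a < lil_ratio \<omega> n"
        using elim[rule_format, of j]
      proof (rule frequently_rev_mp)
        show "eventually (\<lambda>n. (1 - 2 * (1 / real (j + 3))) * \<sigma> * lil_norm (real n) \<le> (\<Sum>k<n. X k \<omega>)
            \<longrightarrow> a < lil_ratio \<omega> n) sequentially"
          using eventually_gt_at_top[of 0]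
        proof eventually_elim
          case (elim n)
          then show ?case
            using j lil_norm_pos[of "real n"] by (auto simp: lil_ratio_def pos_le_divide_eq[symmetric] simp del: of_nat_add)
        qed
      qed
    qed
  qed
qed

lemma trunc_level_le_lil_norm: "0 \<le> x \<Longrightarrow> trunc_level x \<le> lil_norm x"
proof -
  assume x: "0 \<le> x"
  have "x / loglog x \<le> x"
    using mult_left_mono[OF loglog_ge_1[of x] x] loglog_pos[of x] by (simp add: field_simps)
  then have "trunc_level x \<le> sqrt x" by (simp add: trunc_level_def)
  also have "\<dots> \<le> lil_norm x" by (rule lil_norm_ge[OF x])
  finally show ?thesis .
qed

text \<open>A single term is at most its tail part plus \<tau> times the norm, and the tail part is
  dominated by the sum of all tail parts, which is already negligible. Letting \<tau> run through 1
  / (j + 1) finishes.\<close>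

lemma (in centered_iid_sequence) AE_term_negligible:
  "AE \<omega> in M. (\<lambda>n. X n \<omega> / lil_norm (real (Suc n))) \<longlonglongrightarrow> 0"
proof -
  have "AE \<omega> in M. \<forall>j. (\<lambda>n. (\<Sum>k<n. \<bar>tail_part (1 / real (Suc j)) k \<omega>\<bar>) / lil_norm (real n)) \<longlonglongrightarrow> 0"
    unfolding AE_all_countable by (intro allI AE_tail_negligible) simp
  then show ?thesis
  proof eventually_elim
    case (elim \<omega>)
    show ?case
    proof (rule LIMSEQ_I)
      fix e :: real assume e: "0 < e"
      then obtain j where j: "1 / real (Suc j) < e / 2"
        using nat_approx_posE[of "e / 2"] by auto
      let ?t = "1 / real (Suc j)"
      have "(\<lambda>n. (\<Sum>k<Suc n. \<bar>tail_part ?t k \<omega>\<bar>) / lil_norm (real (Suc n))) \<longlonglongrightarrow> 0"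
        using elim[rule_format, of j] by (rule LIMSEQ_Suc)
      then have "eventually (\<lambda>n. (\<Sum>k<Suc n. \<bar>tail_part ?t k \<omega>\<bar>) / lil_norm (real (Suc n)) < e / 2) sequentially"
        using e by (intro order_tendstoD(2)) auto
      then obtain N where N: "\<And>n. n \<ge> N \<Longrightarrow> (\<Sum>k<Suc n. \<bar>tail_part ?t k \<omega>\<bar>) / lil_norm (real (Suc n)) < e / 2"
        unfolding eventually_sequentially by blast
      have "norm (X n \<omega> / lil_norm (real (Suc n)) - 0) < e" if "n \<ge> N" for n
      proof -
        let ?a = "lil_norm (real (Suc n))"
        have a: "0 < ?a" by (rule lil_norm_pos) simp
        have "\<bar>X n \<omega>\<bar> \<le> \<bar>tail_part ?t n \<omega>\<bar> + ?t * trunc_level (real (Suc n))"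
          using trunc_level_nonneg[of "real (Suc n)"] by (auto simp: tail_part_def)
        also have "\<bar>tail_part ?t n \<omega>\<bar> \<le> (\<Sum>k<Suc n. \<bar>tail_part ?t k \<omega>\<bar>)"
          by (simp add: sum_nonneg)
        also have "?t * trunc_level (real (Suc n)) \<le> ?t * ?a"
          by (intro mult_left_mono trunc_level_le_lil_norm) auto
        also have "\<dots> < e / 2 * ?a" using j a by (intro mult_strict_right_mono)
        also have "(\<Sum>k<Suc n. \<bar>tail_part ?t k \<omega>\<bar>) < e / 2 * ?a"
          using N[OF that] a by (simp only: pos_divide_less_eq)
        finally show ?thesis using a by (simp add: pos_divide_less_eq)
      qed
      then show "\<exists>N. \<forall>n\<ge>N. norm (X n \<omega> / lil_norm (real (Suc n)) - 0) < e" by blast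
    qed
  qed
qed

theorem (in centered_iid_sequence) law_of_the_iterated_logarithm:
  "AE \<omega> in M. limsup (\<lambda>n. ereal (lil_ratio \<omega> n)) = ereal \<sigma> \<and>
     liminf (\<lambda>n. ereal (lil_ratio \<omega> n)) = ereal (- \<sigma>) \<and> cluster_set (lil_ratio \<omega>) = {- \<sigma>..\<sigma>}"
proof -
  interpret neg: centered_iid_sequence M "\<lambda>n \<omega>. - X n \<omega>" \<sigma> by (rule uminus_iid)
  show ?thesis
    using AE_lil_ratio_less AE_lil_ratio_greater neg.AE_lil_ratio_less neg.AE_lil_ratio_greater AE_term_negligible
  proof eventually_elim
    case (elim \<omega>)
    have up: "eventually (\<lambda>n. lil_ratio \<omega> n < a) sequentially" if "\<sigma> < a" for a
      using elim(1) that by blast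
    have up': "\<exists>\<^sub>F n in sequentially. a < lil_ratio \<omega> n" if "a < \<sigma>" for a
      using elim(2) that by blast
    have low: "eventually (\<lambda>n. a < lil_ratio \<omega> n) sequentially" if "a < - \<sigma>" for a
      using elim(3)[rule_format, of "- a"] that by (simp add: lil_ratio_uminus)
    have low': "\<exists>\<^sub>F n in sequentially. lil_ratio \<omega> n < a" if "- \<sigma> < a" for a
      using elim(4)[rule_format, of "- a"] that by (simp add: lil_ratio_uminus)
    have bd: "eventually (\<lambda>n. \<bar>lil_ratio \<omega> n\<bar> \<le> \<sigma> + 1) sequentially"
      using up[of "\<sigma> + 1", simplified] low[of "- \<sigma> - 1", simplified] by eventually_elim linarith
    \<comment> \<open>One step changes the ratio by the normalized new term and by the relative
      growth of the norm, which is at most 1 / (n + 1) while the ratio itself stays bounded.\<close>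
    have inc: "(\<lambda>n. lil_ratio \<omega> (Suc n) - lil_ratio \<omega> n) \<longlonglongrightarrow> 0"
    proof (rule Lim_null_comparison)
      show "(\<lambda>n. \<bar>X n \<omega> / lil_norm (real (Suc n))\<bar> + (\<sigma> + 1) * (1 / real (Suc n))) \<longlonglongrightarrow> 0"
      proof -
        have "(\<lambda>n. (\<sigma> + 1) * (1 / real (Suc n))) \<longlonglongrightarrow> 0" by real_asymp
        then show ?thesis using tendsto_add[OF tendsto_rabs_zero[OF elim(5)]] by simp
      qed
      show "eventually (\<lambda>n. norm (lil_ratio \<omega> (Suc n) - lil_ratio \<omega> n)
          \<le> \<bar>X n \<omega> / lil_norm (real (Suc n))\<bar> + (\<sigma> + 1) * (1 / real (Suc n))) sequentially"
        using bd eventually_gt_at_top[of 0]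
      proof eventually_elim
        case (elim n)
        let ?a = "lil_norm (real n)" and ?b = "lil_norm (real (Suc n))"
        have ab: "0 < ?a" "?a \<le> ?b" "0 < ?b"
          using elim by (auto intro!: lil_norm_pos lil_norm_mono)
        have "real n * ?b \<le> real (Suc n) * ?a"
          using lil_norm_le_mult[of "real n" "real (Suc n)"] elim by (simp add: field_simps)
        then have q: "1 - ?a / ?b \<le> 1 / real (Suc n)"
          using ab by (simp add: field_simps del: of_nat_Suc) (simp add: algebra_simps)
        have "(\<Sum>k<n. X k \<omega>) = lil_ratio \<omega> n * ?a" using ab by (simp add: lil_ratio_def)
        then have "lil_ratio \<omega> (Suc n) - lil_ratio \<omega> n = X n \<omega> / ?b - lil_ratio \<omega> n * (1 - ?a / ?b)"
          unfolding lil_ratio_def[of \<omega> "Suc n"] by (simp add: add_divide_distrib right_diff_distrib)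
        also have "\<bar>\<dots>\<bar> \<le> \<bar>X n \<omega> / ?b\<bar> + \<bar>lil_ratio \<omega> n\<bar> * \<bar>1 - ?a / ?b\<bar>"
          by (simp only: abs_mult[symmetric] abs_triangle_ineq4)
        also have "\<bar>lil_ratio \<omega> n\<bar> * \<bar>1 - ?a / ?b\<bar> \<le> (\<sigma> + 1) * (1 / real (Suc n))"
          using elim q ab sigma_nonneg by (intro mult_mono) (auto simp: abs_of_nonneg)
        finally show ?case by simp
      qed
    qed
    have "cluster_set (lil_ratio \<omega>) = {- \<sigma>..\<sigma>}"
      by (rule cluster_set_eq_interval[OF inc low low' up up']) (use sigma_nonneg in auto)
    moreover have "limsup (\<lambda>n. ereal (lil_ratio \<omega> n)) = ereal \<sigma>" by (rule limsup_eqI[OF up up'])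
    moreover have "liminf (\<lambda>n. ereal (lil_ratio \<omega> n)) = ereal (- \<sigma>)" by (rule liminf_eqI[OF low low'])
    ultimately show ?case by blast
  qed
qed

section \<open>Bounded Lipschitz functions\<close>

text \<open>Like \<open>C_l_Lip n\<close>, the class lives on whole sequences, the seminorm
  \<open>vnorm n\<close> restricting the dependence to the first n coordinates. A function of few
  coordinates thus needs no reindexing to become one of more coordinates.\<close>

definition bounded_Lipschitz :: "nat \<Rightarrow> ((nat \<Rightarrow> real) \<Rightarrow> real) set" where
  "bounded_Lipschitz n = {\<phi>. (\<exists>K\<ge>0. \<forall>x y. \<bar>\<phi> x - \<phi> y\<bar> \<le> K * vnorm n (\<lambda>i. x i - y i)) \<and>
     (\<exists>B. \<forall>x. \<bar>\<phi> x\<bar> \<le> B)}"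

lemma vnorm_nonneg: "0 \<le> vnorm n x"
  by (simp add: vnorm_def)

lemma vnorm_mono: "m \<le> n \<Longrightarrow> vnorm m x \<le> vnorm n x"
  unfolding vnorm_def L2_set_def by (intro real_sqrt_le_mono sum_mono2) auto

lemma abs_le_vnorm: "i < n \<Longrightarrow> \<bar>x i\<bar> \<le> vnorm n x"
  unfolding vnorm_def using member_le_L2_set[of "{..<n}" i "\<lambda>i. \<bar>x i\<bar>"] by (simp add: L2_set_def)

lemma vnorm_1: "vnorm (Suc 0) x = \<bar>x 0\<bar>"
  by (simp add: vnorm_def L2_set_def)

lemma vnorm_Suc_eq: "x n = 0 \<Longrightarrow> vnorm (Suc n) x = vnorm n x"
  by (simp add: vnorm_def L2_set_def)

lemma vnorm_cong: "(\<And>i. i < n \<Longrightarrow> x i = y i) \<Longrightarrow> vnorm n x = vnorm n y"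
  unfolding vnorm_def by (rule L2_set_cong) auto

lemma vnorm_triangle: "vnorm n (\<lambda>i. x i - z i) \<le> vnorm n (\<lambda>i. x i - y i) + vnorm n (\<lambda>i. y i - z i)"
  unfolding vnorm_def using L2_set_triangle_ineq[of "\<lambda>i. x i - y i" "\<lambda>i. y i - z i" "{..<n}"] by simp

lemma vnorm_minus_commute: "vnorm n (\<lambda>i. x i - y i) = vnorm n (\<lambda>i. y i - x i)"
  unfolding vnorm_def L2_set_def by (simp add: power2_commute)

lemma bounded_LipschitzI:
  assumes "0 \<le> K" "\<And>x y. \<bar>\<phi> x - \<phi> y\<bar> \<le> K * vnorm n (\<lambda>i. x i - y i)" "\<And>x. \<bar>\<phi> x\<bar> \<le> B"
  shows "\<phi> \<in> bounded_Lipschitz n"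
  using assms by (auto simp: bounded_Lipschitz_def)

lemma bounded_LipschitzE:
  assumes "\<phi> \<in> bounded_Lipschitz n"
  obtains K B where "0 \<le> K" "0 \<le> B" "\<And>x y. \<bar>\<phi> x - \<phi> y\<bar> \<le> K * vnorm n (\<lambda>i. x i - y i)" "\<And>x. \<bar>\<phi> x\<bar> \<le> B"
proof -
  from assms obtain K B where *: "0 \<le> K" "\<And>x y. \<bar>\<phi> x - \<phi> y\<bar> \<le> K * vnorm n (\<lambda>i. x i - y i)" "\<And>x. \<bar>\<phi> x\<bar> \<le> B"
    by (auto simp: bounded_Lipschitz_def)
  moreover have "0 \<le> B" using *(3)[of "\<lambda>_. 0"] by linarith
  ultimately show ?thesis using that by blast
qed

lemma bounded_Lipschitz_C_l_Lip:
  assumes "\<phi> \<in> bounded_Lipschitz n"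
  shows "\<phi> \<in> C_l_Lip n"
proof -
  from assms obtain K B where K: "0 \<le> K" "\<And>x y. \<bar>\<phi> x - \<phi> y\<bar> \<le> K * vnorm n (\<lambda>i. x i - y i)"
    by (rule bounded_LipschitzE) blast
  have "\<bar>\<phi> x - \<phi> y\<bar> \<le> (K + 1) * (1 + vnorm n x ^ 0 + vnorm n y ^ 0) * vnorm n (\<lambda>i. x i - y i)" for x y
  proof -
    have "K * vnorm n (\<lambda>i. x i - y i) \<le> ((K + 1) * 3) * vnorm n (\<lambda>i. x i - y i)"
      using K(1) by (intro mult_right_mono vnorm_nonneg) auto
    then show ?thesis using K(2)[of x y] by simp
  qed
  then show ?thesis using K(1) unfolding C_l_Lip_def
    by (intro CollectI exI[of _ "K + 1"] conjI exI[of _ 0]) auto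
qed

lemma bounded_Lipschitz_mono: "\<phi> \<in> bounded_Lipschitz m \<Longrightarrow> m \<le> n \<Longrightarrow> \<phi> \<in> bounded_Lipschitz n"
proof (elim bounded_LipschitzE)
  fix K B assume m: "m \<le> n" and *: "0 \<le> K" "\<And>x y. \<bar>\<phi> x - \<phi> y\<bar> \<le> K * vnorm m (\<lambda>i. x i - y i)" "\<And>x. \<bar>\<phi> x\<bar> \<le> B"
  show "\<phi> \<in> bounded_Lipschitz n"
  proof (rule bounded_LipschitzI[OF *(1) _ *(3)])
    show "\<bar>\<phi> x - \<phi> y\<bar> \<le> K * vnorm n (\<lambda>i. x i - y i)" for x y
      using *(2)[of x y] mult_left_mono[OF vnorm_mono[OF m] *(1)] by (rule order_trans)
  qed
qed

lemma bounded_Lipschitz_cong: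
  "\<phi> \<in> bounded_Lipschitz n \<Longrightarrow> (\<And>i. i < n \<Longrightarrow> x i = y i) \<Longrightarrow> \<phi> x = \<phi> y"
  by (rule C_l_Lip_cong[OF bounded_Lipschitz_C_l_Lip])

lemma bounded_Lipschitz_const: "(\<lambda>_. c) \<in> bounded_Lipschitz n"
  by (rule bounded_LipschitzI[of 0 _ _ "\<bar>c\<bar>"]) auto

lemma bounded_Lipschitz_add:
  assumes "\<phi> \<in> bounded_Lipschitz n" "\<psi> \<in> bounded_Lipschitz n"
  shows "(\<lambda>x. \<phi> x + \<psi> x) \<in> bounded_Lipschitz n"
proof -
  from assms(1) obtain K B where 1: "0 \<le> K" "\<And>x y. \<bar>\<phi> x - \<phi> y\<bar> \<le> K * vnorm n (\<lambda>i. x i - y i)" "\<And>x. \<bar>\<phi> x\<bar> \<le> B"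
    by (rule bounded_LipschitzE) blast
  from assms(2) obtain K' B' where 2: "0 \<le> K'" "\<And>x y. \<bar>\<psi> x - \<psi> y\<bar> \<le> K' * vnorm n (\<lambda>i. x i - y i)" "\<And>x. \<bar>\<psi> x\<bar> \<le> B'"
    by (rule bounded_LipschitzE) blast
  show ?thesis
  proof (rule bounded_LipschitzI[of "K + K'" _ _ "B + B'"])
    show "\<bar>(\<phi> x + \<psi> x) - (\<phi> y + \<psi> y)\<bar> \<le> (K + K') * vnorm n (\<lambda>i. x i - y i)" for x y
      unfolding distrib_right using 1(2)[of x y] 2(2)[of x y] by linarith
    show "\<bar>\<phi> x + \<psi> x\<bar> \<le> B + B'" for x using 1(3)[of x] 2(3)[of x] by linarith
  qed (use 1 2 in auto)
qed

lemma bounded_Lipschitz_mult: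
  assumes "\<phi> \<in> bounded_Lipschitz n" "\<psi> \<in> bounded_Lipschitz n"
  shows "(\<lambda>x. \<phi> x * \<psi> x) \<in> bounded_Lipschitz n"
proof -
  from assms(1) obtain K B where 1: "0 \<le> K" "0 \<le> B" "\<And>x y. \<bar>\<phi> x - \<phi> y\<bar> \<le> K * vnorm n (\<lambda>i. x i - y i)" "\<And>x. \<bar>\<phi> x\<bar> \<le> B"
    by (rule bounded_LipschitzE) blast
  from assms(2) obtain K' B' where 2: "0 \<le> K'" "0 \<le> B'" "\<And>x y. \<bar>\<psi> x - \<psi> y\<bar> \<le> K' * vnorm n (\<lambda>i. x i - y i)" "\<And>x. \<bar>\<psi> x\<bar> \<le> B'"
    by (rule bounded_LipschitzE) blast
  show ?thesis
  proof (rule bounded_LipschitzI[of "B * K' + B' * K" _ _ "B * B'"])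
    fix x y
    let ?v = "vnorm n (\<lambda>i. x i - y i)"
    have "\<phi> x * \<psi> x - \<phi> y * \<psi> y = \<phi> x * (\<psi> x - \<psi> y) + \<psi> y * (\<phi> x - \<phi> y)"
      by (simp add: algebra_simps)
    also have "\<bar>\<dots>\<bar> \<le> \<bar>\<phi> x\<bar> * \<bar>\<psi> x - \<psi> y\<bar> + \<bar>\<psi> y\<bar> * \<bar>\<phi> x - \<phi> y\<bar>"
      by (simp only: abs_mult[symmetric] abs_triangle_ineq)
    also have "\<dots> \<le> B * (K' * ?v) + B' * (K * ?v)"
      using 1 2 by (intro add_mono mult_mono) auto
    finally show "\<bar>\<phi> x * \<psi> x - \<phi> y * \<psi> y\<bar> \<le> (B * K' + B' * K) * ?v"
      by (simp add: algebra_simps)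
    show "\<bar>\<phi> x * \<psi> x\<bar> \<le> B * B'" unfolding abs_mult using 1 2 by (intro mult_mono) auto
  qed (use 1 2 in auto)
qed

lemma bounded_Lipschitz_cmult: "\<phi> \<in> bounded_Lipschitz n \<Longrightarrow> (\<lambda>x. c * \<phi> x) \<in> bounded_Lipschitz n"
  by (rule bounded_Lipschitz_mult[OF bounded_Lipschitz_const])

lemma bounded_Lipschitz_uminus: "\<phi> \<in> bounded_Lipschitz n \<Longrightarrow> (\<lambda>x. - \<phi> x) \<in> bounded_Lipschitz n"
  using bounded_Lipschitz_cmult[of \<phi> n "-1"] by simp

lemma bounded_Lipschitz_diff:
  "\<phi> \<in> bounded_Lipschitz n \<Longrightarrow> \<psi> \<in> bounded_Lipschitz n \<Longrightarrow> (\<lambda>x. \<phi> x - \<psi> x) \<in> bounded_Lipschitz n"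
  using bounded_Lipschitz_add[OF _ bounded_Lipschitz_uminus] by fastforce

lemma bounded_Lipschitz_abs:
  assumes "\<phi> \<in> bounded_Lipschitz n"
  shows "(\<lambda>x. \<bar>\<phi> x\<bar>) \<in> bounded_Lipschitz n"
proof -
  from assms obtain K B where 1: "0 \<le> K" "\<And>x y. \<bar>\<phi> x - \<phi> y\<bar> \<le> K * vnorm n (\<lambda>i. x i - y i)" "\<And>x. \<bar>\<phi> x\<bar> \<le> B"
    by (rule bounded_LipschitzE) blast
  have "\<bar>\<bar>\<phi> x\<bar> - \<bar>\<phi> y\<bar>\<bar> \<le> K * vnorm n (\<lambda>i. x i - y i)" for x y
    using abs_triangle_ineq3 1(2) by (rule order_trans)
  then show ?thesis
    using 1 by (intro bounded_LipschitzI[of K _ _ B]) auto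
qed

lemma bounded_Lipschitz_max:
  assumes "\<phi> \<in> bounded_Lipschitz n" "\<psi> \<in> bounded_Lipschitz n"
  shows "(\<lambda>x. max (\<phi> x) (\<psi> x)) \<in> bounded_Lipschitz n"
proof -
  have "(\<lambda>x. max (\<phi> x) (\<psi> x)) = (\<lambda>x. (1 / 2) * (\<phi> x + \<psi> x + \<bar>\<phi> x - \<psi> x\<bar>))"
    by (rule ext) (simp add: max_def)
  then show ?thesis
    using assms by (auto intro!: bounded_Lipschitz_cmult bounded_Lipschitz_add bounded_Lipschitz_abs bounded_Lipschitz_diff simp del: mult_1 times_divide_eq_left)
qed

lemma bounded_Lipschitz_sum:
  "(\<And>i. i \<in> I \<Longrightarrow> \<phi> i \<in> bounded_Lipschitz n) \<Longrightarrow> (\<lambda>x. \<Sum>i\<in>I. \<phi> i x) \<in> bounded_Lipschitz n"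
  by (induction I rule: infinite_finite_induct)
    (auto intro!: bounded_Lipschitz_add bounded_Lipschitz_const)

section \<open>Bounded Lipschitz functions of one variable\<close>

definition real_BL :: "(real \<Rightarrow> real) set" where
  "real_BL = {f. (\<exists>K\<ge>0. \<forall>x y. \<bar>f x - f y\<bar> \<le> K * \<bar>x - y\<bar>) \<and> (\<exists>B. \<forall>x. \<bar>f x\<bar> \<le> B)}"

lemma real_BL_E:
  assumes "f \<in> real_BL"
  obtains K B where "0 \<le> K" "0 \<le> B" "\<And>x y. \<bar>f x - f y\<bar> \<le> K * \<bar>x - y\<bar>" "\<And>x. \<bar>f x\<bar> \<le> B"
proof -
  from assms obtain K B where *: "0 \<le> K" "\<And>x y. \<bar>f x - f y\<bar> \<le> K * \<bar>x - y\<bar>" "\<And>x. \<bar>f x\<bar> \<le> B"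
    by (auto simp: real_BL_def)
  moreover have "0 \<le> B" using *(3)[of 0] by linarith
  ultimately show ?thesis using that by blast
qed

lemma real_BL_I:
  assumes "0 \<le> K" "\<And>x y. \<bar>f x - f y\<bar> \<le> K * \<bar>x - y\<bar>" "\<And>x. \<bar>f x\<bar> \<le> B"
  shows "f \<in> real_BL"
  using assms by (auto simp: real_BL_def)

lemma bounded_Lipschitz_coord:
  assumes "f \<in> real_BL" "i < n"
  shows "(\<lambda>x. f (x i)) \<in> bounded_Lipschitz n"
proof -
  from assms(1) obtain K B where 1: "0 \<le> K" "\<And>x y. \<bar>f x - f y\<bar> \<le> K * \<bar>x - y\<bar>" "\<And>x. \<bar>f x\<bar> \<le> B"
    by (rule real_BL_E) blast
  show ?thesis
  proof (rule bounded_LipschitzI[OF 1(1) _ 1(3)])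
    show "\<bar>f (x i) - f (y i)\<bar> \<le> K * vnorm n (\<lambda>i. x i - y i)" for x y
      using 1(2)[of "x i" "y i"] mult_left_mono[OF abs_le_vnorm[OF assms(2), of "\<lambda>i. x i - y i"] 1(1)] by linarith
  qed
qed

lemma real_BL_update:
  assumes "\<phi> \<in> bounded_Lipschitz (Suc n)"
  shows "(\<lambda>y. \<phi> (x(n := y))) \<in> real_BL"
proof -
  from assms obtain K B where 1: "0 \<le> K" "\<And>x y. \<bar>\<phi> x - \<phi> y\<bar> \<le> K * vnorm (Suc n) (\<lambda>i. x i - y i)" "\<And>x. \<bar>\<phi> x\<bar> \<le> B"
    by (rule bounded_LipschitzE) blast
  show ?thesis
  proof (rule real_BL_I[OF 1(1) _ 1(3)])
    fix y z
    have "vnorm (Suc n) (\<lambda>i. (x(n := y)) i - (x(n := z)) i) = \<bar>y - z\<bar>"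
      by (simp add: vnorm_def L2_set_def)
    then show "\<bar>\<phi> (x(n := y)) - \<phi> (x(n := z))\<bar> \<le> K * \<bar>y - z\<bar>"
      using 1(2)[of "x(n := y)" "x(n := z)"] by simp
  qed
qed

lemma real_BL_const: "(\<lambda>_. c) \<in> real_BL"
  by (rule real_BL_I[of 0 _ "\<bar>c\<bar>"]) auto

lemma real_BL_coordI:
  assumes "(\<lambda>x. f (x 0)) \<in> bounded_Lipschitz (Suc 0)"
  shows "f \<in> real_BL"
  using real_BL_update[OF assms, of undefined] by simp

lemma real_BL_coord: "f \<in> real_BL \<Longrightarrow> (\<lambda>x. f (x 0)) \<in> bounded_Lipschitz (Suc 0)"
  by (rule bounded_Lipschitz_coord) auto

lemma real_BL_add: "f \<in> real_BL \<Longrightarrow> g \<in> real_BL \<Longrightarrow> (\<lambda>x. f x + g x) \<in> real_BL"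
  by (rule real_BL_coordI) (rule bounded_Lipschitz_add; rule real_BL_coord)

lemma real_BL_cmult: "f \<in> real_BL \<Longrightarrow> (\<lambda>x. c * f x) \<in> real_BL"
  by (rule real_BL_coordI) (rule bounded_Lipschitz_cmult, rule real_BL_coord)

lemma real_BL_uminus: "f \<in> real_BL \<Longrightarrow> (\<lambda>x. - f x) \<in> real_BL"
  by (rule real_BL_coordI) (rule bounded_Lipschitz_uminus, rule real_BL_coord)

lemma real_BL_diff: "f \<in> real_BL \<Longrightarrow> g \<in> real_BL \<Longrightarrow> (\<lambda>x. f x - g x) \<in> real_BL"
  by (rule real_BL_coordI) (rule bounded_Lipschitz_diff; rule real_BL_coord)

lemma real_BL_sum: "(\<And>i. i \<in> I \<Longrightarrow> f i \<in> real_BL) \<Longrightarrow> (\<lambda>x. \<Sum>i\<in>I. f i x) \<in> real_BL"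
  by (rule real_BL_coordI) (rule bounded_Lipschitz_sum, rule real_BL_coord, blast)

section \<open>Sublinear expectations of independent sequences\<close>

locale sublinear_iid_sequence =
  fixes M :: "'a measure" and H :: "('a \<Rightarrow> real) set" and E :: "('a \<Rightarrow> real) \<Rightarrow> ereal"
    and X :: "nat \<Rightarrow> 'a \<Rightarrow> real"
  assumes space: "sublinear_expectation_space M H E"
    and rv: "\<And>n. 1 \<le> n \<Longrightarrow> X n \<in> H"
    and indep: "independent_seq H E X"
    and ident: "identically_distributed E X"
begin

lemma in_H: "\<phi> \<in> C_l_Lip n \<Longrightarrow> (\<And>i. i < n \<Longrightarrow> Y i \<in> H) \<Longrightarrow> (\<lambda>\<omega>. \<phi> (\<lambda>i. Y i \<omega>)) \<in> H"
  using space unfolding sublinear_expectation_space_def random_variable_space_def by blast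

lemma H_measurable: "Y \<in> H \<Longrightarrow> Y \<in> borel_measurable M"
  using space unfolding sublinear_expectation_space_def random_variable_space_def by blast

lemma H_add: "Y \<in> H \<Longrightarrow> Z \<in> H \<Longrightarrow> (\<lambda>\<omega>. Y \<omega> + Z \<omega>) \<in> H"
  using space unfolding sublinear_expectation_space_def random_variable_space_def by blast

lemma E_mono: "Y \<in> H \<Longrightarrow> Z \<in> H \<Longrightarrow> (\<And>\<omega>. \<omega> \<in> space M \<Longrightarrow> Y \<omega> \<le> Z \<omega>) \<Longrightarrow> E Y \<le> E Z"
  using space unfolding sublinear_expectation_space_def by blast

lemma E_const: "E (\<lambda>_. c) = ereal c"
  using space unfolding sublinear_expectation_space_def by blast

lemma E_add_le: "Y \<in> H \<Longrightarrow> Z \<in> H \<Longrightarrow> \<not> (E Y = \<infinity> \<and> E Z = -\<infinity>) \<Longrightarrow> \<not> (E Y = -\<infinity> \<and> E Z = \<infinity>) \<Longrightarrow>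
  E (\<lambda>\<omega>. Y \<omega> + Z \<omega>) \<le> E Y + E Z"
  using space unfolding sublinear_expectation_space_def by blast

lemma E_cmult: "Y \<in> H \<Longrightarrow> 0 \<le> c \<Longrightarrow> E (\<lambda>\<omega>. c * Y \<omega>) = ereal c * E Y"
  using space unfolding sublinear_expectation_space_def by blast

lemma const_in_H: "(\<lambda>_. c) \<in> H"
  using in_H[OF bounded_Lipschitz_C_l_Lip[OF bounded_Lipschitz_const[of c 0]]] by simp

lemma E_bounded:
  assumes "Y \<in> H" "\<And>\<omega>. \<omega> \<in> space M \<Longrightarrow> \<bar>Y \<omega>\<bar> \<le> B"
  shows "\<bar>E Y\<bar> \<le> ereal B"
proof -
  have "E Y \<le> E (\<lambda>_. B)" "E (\<lambda>_. - B) \<le> E Y"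
    using assms by (auto intro!: E_mono const_in_H simp: abs_le_iff) (smt (verit) assms(2))
  then show ?thesis unfolding E_const by (cases "E Y") auto
qed

text \<open>Coordinate i stands for the variable \<open>X (Suc i)\<close>. On bounded Lipschitz
  functions the expectation is finite, so the conversion to \<open>real\<close> loses nothing
  (\<open>E_eq_law\<close>).\<close>

definition law :: "((nat \<Rightarrow> real) \<Rightarrow> real) \<Rightarrow> real" where
  "law \<phi> = real_of_ereal (E (\<lambda>\<omega>. \<phi> (\<lambda>i. X (Suc i) \<omega>)))"

definition law1 :: "(real \<Rightarrow> real) \<Rightarrow> real" where
  "law1 f = law (\<lambda>x. f (x 0))"

definition integrate_out :: "nat \<Rightarrow> ((nat \<Rightarrow> real) \<Rightarrow> real) \<Rightarrow> (nat \<Rightarrow> real) \<Rightarrow> real" where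
  "integrate_out m \<phi> x = law1 (\<lambda>y. \<phi> (x(m := y)))"

lemma seq_in_H: "\<phi> \<in> bounded_Lipschitz n \<Longrightarrow> (\<lambda>\<omega>. \<phi> (\<lambda>i. X (Suc i) \<omega>)) \<in> H"
  by (rule in_H[OF bounded_Lipschitz_C_l_Lip]) (auto intro: rv)

lemma E_eq_law:
  assumes "\<phi> \<in> bounded_Lipschitz n"
  shows "E (\<lambda>\<omega>. \<phi> (\<lambda>i. X (Suc i) \<omega>)) = ereal (law \<phi>)"
proof -
  obtain B where "\<And>x. \<bar>\<phi> x\<bar> \<le> B" using assms by (rule bounded_LipschitzE) blast
  then have "\<bar>E (\<lambda>\<omega>. \<phi> (\<lambda>i. X (Suc i) \<omega>))\<bar> \<le> ereal B"
    by (intro E_bounded seq_in_H[OF assms])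
  then show ?thesis unfolding law_def
    by (cases "E (\<lambda>\<omega>. \<phi> (\<lambda>i. X (Suc i) \<omega>))") auto
qed

lemma law_mono:
  assumes "\<phi> \<in> bounded_Lipschitz n" "\<psi> \<in> bounded_Lipschitz n" "\<And>x. \<phi> x \<le> \<psi> x"
  shows "law \<phi> \<le> law \<psi>"
  using E_mono[OF seq_in_H[OF assms(1)] seq_in_H[OF assms(2)]] assms(3)
  unfolding E_eq_law[OF assms(1)] E_eq_law[OF assms(2)] by simp

lemma law_add_le:
  assumes "\<phi> \<in> bounded_Lipschitz n" "\<psi> \<in> bounded_Lipschitz n"
  shows "law (\<lambda>x. \<phi> x + \<psi> x) \<le> law \<phi> + law \<psi>"
  using E_add_le[OF seq_in_H[OF assms(1)] seq_in_H[OF assms(2)]]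
  unfolding E_eq_law[OF assms(1)] E_eq_law[OF assms(2)] E_eq_law[OF bounded_Lipschitz_add[OF assms]] by simp

lemma law_cmult:
  assumes "\<phi> \<in> bounded_Lipschitz n" "0 \<le> c"
  shows "law (\<lambda>x. c * \<phi> x) = c * law \<phi>"
  using E_cmult[OF seq_in_H[OF assms(1)] assms(2)]
  unfolding E_eq_law[OF assms(1)] E_eq_law[OF bounded_Lipschitz_cmult[OF assms(1)]] by simp

lemma law_const: "law (\<lambda>_. c) = c"
  by (simp add: law_def E_const)

lemma law_abs_le:
  assumes "\<phi> \<in> bounded_Lipschitz n" "\<And>x. \<bar>\<phi> x\<bar> \<le> B"
  shows "\<bar>law \<phi>\<bar> \<le> B"
  using E_bounded[OF seq_in_H[OF assms(1)] assms(2)] unfolding E_eq_law[OF assms(1)] by simp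

lemma law_uminus_ge:
  assumes "\<phi> \<in> bounded_Lipschitz n"
  shows "- law (\<lambda>x. - \<phi> x) \<le> law \<phi>"
  using law_add_le[OF assms bounded_Lipschitz_uminus[OF assms]] by (simp add: law_const)

lemma law_add_const:
  assumes "\<phi> \<in> bounded_Lipschitz n"
  shows "law (\<lambda>x. \<phi> x + c) = law \<phi> + c"
  using law_add_le[OF assms bounded_Lipschitz_const[of c]]
    law_add_le[OF bounded_Lipschitz_add[OF assms bounded_Lipschitz_const[of c]] bounded_Lipschitz_const[of "- c"]]
  by (simp add: law_const)

lemma law1_mono: "f \<in> real_BL \<Longrightarrow> g \<in> real_BL \<Longrightarrow> (\<And>x. f x \<le> g x) \<Longrightarrow> law1 f \<le> law1 g"
  unfolding law1_def by (intro law_mono[of _ "Suc 0"] real_BL_coord) auto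

lemma law1_add_le: "f \<in> real_BL \<Longrightarrow> g \<in> real_BL \<Longrightarrow> law1 (\<lambda>x. f x + g x) \<le> law1 f + law1 g"
  unfolding law1_def by (intro law_add_le[of _ "Suc 0"] real_BL_coord) auto

lemma law1_cmult: "f \<in> real_BL \<Longrightarrow> 0 \<le> c \<Longrightarrow> law1 (\<lambda>x. c * f x) = c * law1 f"
  unfolding law1_def by (intro law_cmult[of _ "Suc 0"] real_BL_coord) auto

lemma law1_const: "law1 (\<lambda>_. c) = c"
  by (simp add: law1_def law_const)

lemma law1_abs_le: "f \<in> real_BL \<Longrightarrow> (\<And>x. \<bar>f x\<bar> \<le> B) \<Longrightarrow> \<bar>law1 f\<bar> \<le> B"
  unfolding law1_def by (intro law_abs_le[of _ "Suc 0"] real_BL_coord) auto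

lemma law1_add_const: "f \<in> real_BL \<Longrightarrow> law1 (\<lambda>x. f x + c) = law1 f + c"
  unfolding law1_def by (intro law_add_const[of _ "Suc 0"] real_BL_coord) auto

lemma E_term_eq_law1:
  assumes f: "f \<in> real_BL" and k: "1 \<le> k"
  shows "E (\<lambda>\<omega>. f (X k \<omega>)) = ereal (law1 f)"
proof -
  have bl: "(\<lambda>z. f (z 0)) \<in> bounded_Lipschitz 1" using real_BL_coord[OF f] by simp
  note cl = bounded_Lipschitz_C_l_Lip[OF bl]
  have 1: "E (\<lambda>\<omega>. f (X 1 \<omega>)) = ereal (law1 f)"
    using E_eq_law[OF bl] by (simp add: law1_def)
  obtain B where B: "\<And>x. \<bar>f x\<bar> \<le> B" using f by (rule real_BL_E) blast
  have "(\<lambda>\<omega>. f (X k \<omega>)) \<in> H"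
    using in_H[OF cl, of "\<lambda>_. X k"] rv[OF k] by simp
  then have "\<bar>E (\<lambda>\<omega>. f (X k \<omega>))\<bar> \<le> ereal B" using B by (rule E_bounded)
  then have "\<bar>E (\<lambda>\<omega>. f (X k \<omega>))\<bar> \<noteq> \<infinity>" by auto
  then have "E (\<lambda>\<omega>. f (X k \<omega>)) = E (\<lambda>\<omega>. f (X 1 \<omega>))"
    using ident cl k 1 unfolding identically_distributed_def by fastforce
  then show ?thesis using 1 by simp
qed

text \<open>Moving x shifts the integrand by at most K times the distance, uniformly in the
  coordinate that is integrated out. Monotonicity and translation by constants pass this through
  \<open>law1\<close>, so the Lipschitz constant is preserved without any linearity.\<close>

lemma integrate_out_bounded_Lipschitz:
  assumes "\<phi> \<in> bounded_Lipschitz (Suc m)"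
  shows "integrate_out m \<phi> \<in> bounded_Lipschitz m"
proof -
  from assms obtain K B where 1: "0 \<le> K" "\<And>x y. \<bar>\<phi> x - \<phi> y\<bar> \<le> K * vnorm (Suc m) (\<lambda>i. x i - y i)" "\<And>x. \<bar>\<phi> x\<bar> \<le> B"
    by (rule bounded_LipschitzE) blast
  note BL = real_BL_update[OF assms]
  have le: "integrate_out m \<phi> x \<le> integrate_out m \<phi> y + K * vnorm m (\<lambda>i. x i - y i)" for x y
  proof -
    have "\<phi> (x(m := z)) \<le> \<phi> (y(m := z)) + K * vnorm m (\<lambda>i. x i - y i)" for z
    proof -
      have "vnorm (Suc m) (\<lambda>i. (x(m := z)) i - (y(m := z)) i) = vnorm m (\<lambda>i. (x(m := z)) i - (y(m := z)) i)"
        by (rule vnorm_Suc_eq) simp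
      also have "\<dots> = vnorm m (\<lambda>i. x i - y i)" by (rule vnorm_cong) auto
      finally show ?thesis using 1(2)[of "x(m := z)" "y(m := z)"] by simp
    qed
    then have "law1 (\<lambda>z. \<phi> (x(m := z))) \<le> law1 (\<lambda>z. \<phi> (y(m := z)) + K * vnorm m (\<lambda>i. x i - y i))"
      by (intro law1_mono BL real_BL_add real_BL_const)
    then show ?thesis by (simp add: integrate_out_def law1_add_const[OF BL])
  qed
  show ?thesis
  proof (rule bounded_LipschitzI[OF 1(1)])
    show "\<bar>integrate_out m \<phi> x - integrate_out m \<phi> y\<bar> \<le> K * vnorm m (\<lambda>i. x i - y i)" for x y
      using le[of x y] le[of y x] unfolding vnorm_minus_commute[of m y x] by linarith
    show "\<bar>integrate_out m \<phi> x\<bar> \<le> B" for x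
      unfolding integrate_out_def using 1(3) by (intro law1_abs_le BL)
  qed
qed

text \<open>Fubini's theorem for the last coordinate: independence moves its expectation inside, and
  identical distribution replaces \<open>X (m + 1)\<close> by the first variable. The side
  conditions of independence hold because both inner expectations are bounded Lipschitz.\<close>

lemma law_integrate_out:
  assumes "\<phi> \<in> bounded_Lipschitz (Suc m)"
  shows "law \<phi> = law (integrate_out m \<phi>)"
\<comment> \<open>Independence is assumed only relative to a nonempty past; for m = 0 the inner
  expectation is the constant \<open>law \<phi>\<close>.\<close>
proof (cases "m = 0")
  case True
  have "integrate_out 0 \<phi> = (\<lambda>_. law \<phi>)"
  proof
    fix x
    have "\<phi> (x(0 := z 0)) = \<phi> z" for z
      by (rule bounded_Lipschitz_cong[OF assms]) (use True in auto)
    then show "integrate_out 0 \<phi> x = law \<phi>" by (simp add: integrate_out_def law1_def)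
  qed
  then show ?thesis using True by (simp add: law_const)
next
  case False
  then have m: "1 \<le> m" by simp
  have vap: "\<phi> (vappend m x (\<lambda>_. y)) = \<phi> (x(m := y))" for x y
    by (rule bounded_Lipschitz_cong[OF assms]) (auto simp: vappend_def)
  have psi: "E (\<lambda>\<omega>. \<phi> (vappend m x (\<lambda>_. X (m + 1) \<omega>))) = ereal (integrate_out m \<phi> x)" for x
    unfolding vap integrate_out_def by (rule E_term_eq_law1[OF real_BL_update[OF assms]]) simp
  have psi_abs: "E (\<lambda>\<omega>. \<bar>\<phi> (vappend m x (\<lambda>_. X (m + 1) \<omega>))\<bar>) = ereal (integrate_out m (\<lambda>x. \<bar>\<phi> x\<bar>) x)" for x
    unfolding vap integrate_out_def
    by (rule E_term_eq_law1[OF real_BL_update[OF bounded_Lipschitz_abs[OF assms]]]) simp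
  note BL1 = integrate_out_bounded_Lipschitz[OF assms]
  note BL2 = integrate_out_bounded_Lipschitz[OF bounded_Lipschitz_abs[OF assms]]
  have "independent_to H E 1 (\<lambda>_. X (m + 1)) m (\<lambda>k. X (k + 1))"
    using indep m unfolding independent_seq_def by blast
  note ind = bspec[OF this[unfolded independent_to_def] bounded_Lipschitz_C_l_Lip[OF assms[unfolded Suc_eq_plus1]],
      unfolded Let_def psi psi_abs real_of_ereal.simps]
  have "E (\<lambda>\<omega>. \<phi> (vappend m (\<lambda>i. X (i + 1) \<omega>) (\<lambda>_. X (m + 1) \<omega>)))
      = E (\<lambda>\<omega>. integrate_out m \<phi> (\<lambda>i. X (i + 1) \<omega>))"
    by (rule ind[rule_format])
      (use seq_in_H[OF BL1] seq_in_H[OF BL2] E_eq_law[OF bounded_Lipschitz_abs[OF BL2]] in auto)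
  moreover have "\<phi> (vappend m (\<lambda>i. X (i + 1) \<omega>) (\<lambda>_. X (m + 1) \<omega>)) = \<phi> (\<lambda>i. X (Suc i) \<omega>)" for \<omega>
    by (rule bounded_Lipschitz_cong[OF assms]) (auto simp: vappend_def less_Suc_eq)
  ultimately show ?thesis by (simp add: law_def)
qed

end

section \<open>Continuous capacities force linearity\<close>

context sublinear_iid_sequence
begin

definition dev_sum :: "(real \<Rightarrow> real) \<Rightarrow> real \<Rightarrow> nat \<Rightarrow> nat \<Rightarrow> (nat \<Rightarrow> real) \<Rightarrow> real" where
  "dev_sum f b m n x = (\<Sum>i<n. f (x (m + i)) - b)"

lemma dev_sum_bounded_Lipschitz:
  assumes "f \<in> real_BL"
  shows "dev_sum f b m n \<in> bounded_Lipschitz (m + n)"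
  unfolding dev_sum_def
  by (intro bounded_Lipschitz_sum bounded_Lipschitz_diff bounded_Lipschitz_const bounded_Lipschitz_coord assms) auto

text \<open>For t <= 0 the factor - t is nonnegative and the upper mean is at least b; for t > 0 the
  sign flips and the lower mean is at most b. In this sense a sublinear expectation can push towards
  b from either side.\<close>

lemma law1_tilt_nonneg:
  assumes f: "f \<in> real_BL" and b: "- law1 (\<lambda>y. - f y) \<le> b" "b \<le> law1 f"
  shows "0 \<le> law1 (\<lambda>y. - t * (f y - b))"
proof (cases "t \<le> 0")
  case True
  have "law1 (\<lambda>y. - t * (f y - b)) = - t * law1 (\<lambda>y. f y + (- b))"
    using True law1_cmult[OF real_BL_add[OF f real_BL_const[of "- b"]], of "- t"] by simp
  also have "\<dots> = - t * (law1 f - b)" unfolding law1_add_const[OF f] by simp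
  finally show ?thesis using True b by (simp add: mult_nonpos_nonneg)
next
  case False
  note nf = real_BL_uminus[OF f]
  have "(\<lambda>y. - t * (f y - b)) = (\<lambda>y. t * (- f y + b))" by (auto simp: algebra_simps)
  then have "law1 (\<lambda>y. - t * (f y - b)) = t * law1 (\<lambda>y. - f y + b)"
    using False law1_cmult[OF real_BL_add[OF nf real_BL_const[of b]], of t] by simp
  also have "\<dots> = t * (law1 (\<lambda>y. - f y) + b)" unfolding law1_add_const[OF nf] by simp
  finally show ?thesis using False b by simp
qed

text \<open>
  In the expansion of the square the cross term is harmless for every target \<open>b\<close> between the
  lower and the upper mean, whatever the sign of the partial sum (\<open>law1_tilt_nonneg\<close>).
\<close>

lemma law_block_ge:
  assumes f: "f \<in> real_BL" and B: "\<And>y. \<bar>f y\<bar> \<le> B" "\<bar>b\<bar> \<le> B"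
    and b: "- law1 (\<lambda>y. - f y) \<le> b" "b \<le> law1 f"
    and F: "F \<in> bounded_Lipschitz m" "\<And>x. 0 \<le> F x" and a: "0 \<le> a"
  shows "law (\<lambda>x. F x * (c - a * real n * (4 * B\<^sup>2))) \<le> law (\<lambda>x. F x * (c - a * (dev_sum f b m n x)\<^sup>2))"
proof (induction n arbitrary: c)
  case 0
  then show ?case by (simp add: dev_sum_def)
next
  case (Suc n)
  have FBL: "F \<in> bounded_Lipschitz (m + k)" for k by (rule bounded_Lipschitz_mono[OF F(1)]) simp
  have BL: "(\<lambda>x. F x * (c - a * (dev_sum f b m k x)\<^sup>2)) \<in> bounded_Lipschitz (m + k)" for c k
    unfolding power2_eq_square
    by (intro bounded_Lipschitz_mult bounded_Lipschitz_diff bounded_Lipschitz_cmult bounded_Lipschitz_const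
        dev_sum_bounded_Lipschitz f FBL)
  let ?phi = "\<lambda>x. F x * (c - a * (dev_sum f b m (Suc n) x)\<^sup>2)"
  let ?d = "c - a * (4 * B\<^sup>2)"
  have pBL: "?phi \<in> bounded_Lipschitz (Suc (m + n))" using BL[of c "Suc n"] by simp
  \<comment> \<open>The last coordinate contributes a square of at most (2 B)^2. Its charge is
    deducted from the constant before the induction hypothesis is used, which is why c must be
    arbitrary.\<close>
  have "law (\<lambda>x. F x * (c - a * real (Suc n) * (4 * B\<^sup>2))) = law (\<lambda>x. F x * (?d - a * real n * (4 * B\<^sup>2)))"
    by (simp add: algebra_simps)
  also have "\<dots> \<le> law (\<lambda>x. F x * (?d - a * (dev_sum f b m n x)\<^sup>2))" by (rule Suc)
  also have "\<dots> \<le> law (integrate_out (m + n) ?phi)"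
  proof (rule law_mono[OF BL integrate_out_bounded_Lipschitz[OF pBL]])
    fix x
    define t where "t = dev_sum f b m n x"
    have upd: "?phi (x(m + n := y)) = F x * (c - a * (t + (f y - b))\<^sup>2)" for y
    proof -
      have "F (x(m + n := y)) = F x" by (rule bounded_Lipschitz_cong[OF F(1)]) auto
      moreover have "dev_sum f b m (Suc n) (x(m + n := y)) = t + (f y - b)"
        by (simp add: dev_sum_def t_def)
      ultimately show ?thesis by simp
    qed
    have tBL: "(\<lambda>y. - t * (f y - b)) \<in> real_BL"
      by (intro real_BL_cmult real_BL_diff f real_BL_const)
    have scale: "law1 (\<lambda>y. 2 * a * F x * (- t * (f y - b))) = 2 * a * F x * law1 (\<lambda>y. - t * (f y - b))"
      using a F(2)[of x] by (intro law1_cmult[OF tBL]) simp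
    have "F x * (?d - a * t\<^sup>2) \<le> 2 * a * F x * law1 (\<lambda>y. - t * (f y - b)) + F x * (?d - a * t\<^sup>2)"
      using law1_tilt_nonneg[OF f b, of t] a F(2)[of x] by simp
    also have "\<dots> = law1 (\<lambda>y. 2 * a * F x * (- t * (f y - b)) + F x * (?d - a * t\<^sup>2))"
      by (simp only: law1_add_const[OF real_BL_cmult[OF tBL]] scale)
    also have "\<dots> \<le> law1 (\<lambda>y. ?phi (x(m + n := y)))"
    proof (rule law1_mono[OF real_BL_add[OF real_BL_cmult[OF tBL] real_BL_const] real_BL_update[OF pBL]])
      fix y
      have "\<bar>f y - b\<bar> \<le> 2 * B" using B(1)[of y] B(2) by linarith
      then have "(f y - b)\<^sup>2 \<le> (2 * B)\<^sup>2" using power_mono[of "\<bar>f y - b\<bar>" "2 * B" 2] by simp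
      then have sq: "a * (f y - b)\<^sup>2 \<le> a * (4 * B\<^sup>2)" using a by (intro mult_left_mono) (auto simp: power_mult_distrib)
      have "F x * (?d - a * t\<^sup>2 - 2 * a * t * (f y - b)) \<le> F x * (c - a * (t + (f y - b))\<^sup>2)"
      proof (rule mult_left_mono[OF _ F(2)])
        have "c - a * (t + (f y - b))\<^sup>2 = c - a * t\<^sup>2 - 2 * a * t * (f y - b) - a * (f y - b)\<^sup>2"
          by (simp add: power2_eq_square algebra_simps)
        then show "?d - a * t\<^sup>2 - 2 * a * t * (f y - b) \<le> c - a * (t + (f y - b))\<^sup>2"
          using sq by linarith
      qed
      then show "2 * a * F x * (- t * (f y - b)) + F x * (?d - a * t\<^sup>2) \<le> ?phi (x(m + n := y))"
        unfolding upd by (simp add: algebra_simps)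
    qed
    finally show "F x * (?d - a * (dev_sum f b m n x)\<^sup>2) \<le> integrate_out (m + n) ?phi x"
      by (simp add: integrate_out_def t_def)
  qed
  also have "\<dots> = law ?phi" by (rule law_integrate_out[OF pBL, symmetric])
  finally show ?case .
qed

text \<open>A bounded Lipschitz substitute for the indicator of the event that the block sum of f -
  b is below 1 / sqrt a in absolute value; outside that event it vanishes.\<close>

definition block_weight :: "(real \<Rightarrow> real) \<Rightarrow> real \<Rightarrow> real \<Rightarrow> nat \<Rightarrow> nat \<Rightarrow> (nat \<Rightarrow> real) \<Rightarrow> real" where
  "block_weight f b a m n x = max 0 (1 - a * (dev_sum f b m n x)\<^sup>2)"

lemma block_weight_bounded_Lipschitz:
  assumes "f \<in> real_BL"
  shows "block_weight f b a m n \<in> bounded_Lipschitz (m + n)"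
  unfolding block_weight_def power2_eq_square
  by (intro bounded_Lipschitz_max bounded_Lipschitz_mult bounded_Lipschitz_diff bounded_Lipschitz_cmult bounded_Lipschitz_const
        dev_sum_bounded_Lipschitz assms)

text \<open>Chebyshev's inequality for the upper expectation, conditioned on a nonnegative weight F
  of the past. It holds for every target b between the two means, so successive blocks can be
  steered to different targets at small cost.\<close>

lemma law_block_weight_ge:
  assumes f: "f \<in> real_BL" and B: "\<And>y. \<bar>f y\<bar> \<le> B" "\<bar>b\<bar> \<le> B"
    and b: "- law1 (\<lambda>y. - f y) \<le> b" "b \<le> law1 f"
    and F: "F \<in> bounded_Lipschitz m" "\<And>x. 0 \<le> F x" and a: "0 \<le> a" "a * real n * (4 * B\<^sup>2) \<le> \<epsilon>" "\<epsilon> \<le> 1"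
  shows "(1 - \<epsilon>) * law F \<le> law (\<lambda>x. F x * block_weight f b a m n x)"
proof -
  have FBL: "F \<in> bounded_Lipschitz (m + n)" by (rule bounded_Lipschitz_mono[OF F(1)]) simp
  have BL: "(\<lambda>x. F x * (1 - a * (dev_sum f b m n x)\<^sup>2)) \<in> bounded_Lipschitz (m + n)"
    unfolding power2_eq_square
    by (intro bounded_Lipschitz_mult bounded_Lipschitz_diff bounded_Lipschitz_cmult bounded_Lipschitz_const
        dev_sum_bounded_Lipschitz f FBL)
  have BL2: "(\<lambda>x. F x * block_weight f b a m n x) \<in> bounded_Lipschitz (m + n)"
    by (intro bounded_Lipschitz_mult FBL block_weight_bounded_Lipschitz f)
  have "(1 - \<epsilon>) * law F = law (\<lambda>x. (1 - \<epsilon>) * F x)"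
    using a by (intro law_cmult[OF F(1), symmetric]) auto
  also have "\<dots> \<le> law (\<lambda>x. (1 - a * real n * (4 * B\<^sup>2)) * F x)"
    using a F(2) by (intro law_mono[of _ m] bounded_Lipschitz_cmult F(1) mult_right_mono) auto
  also have "\<dots> = law (\<lambda>x. F x * (1 - a * real n * (4 * B\<^sup>2)))"
    by (simp only: mult.commute)
  also have "\<dots> \<le> law (\<lambda>x. F x * (1 - a * (dev_sum f b m n x)\<^sup>2))"
    by (rule law_block_ge[OF f B b F a(1)])
  also have "\<dots> \<le> law (\<lambda>x. F x * block_weight f b a m n x)"
    by (rule law_mono[OF BL BL2]) (use F(2) in \<open>auto simp: block_weight_def intro!: mult_left_mono\<close>)
  finally show ?thesis .
qed

end

text \<open>\<open>W\<close> stands for \<open>upper_cap\<close> in one case of the theorem and for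
  its \<open>outer_cap\<close> in the other. In the second case countable subadditivity of
  \<open>E\<close> enters through \<open>E_le_W\<close>.\<close>

locale continuous_capacity = sublinear_iid_sequence +
  fixes W :: "'a set \<Rightarrow> ereal"
  assumes W_le_E: "\<And>A \<xi>. A \<in> sets M \<Longrightarrow> \<xi> \<in> H \<Longrightarrow> (\<And>\<omega>. \<omega> \<in> space M \<Longrightarrow> indicator A \<omega> \<le> \<xi> \<omega>) \<Longrightarrow> W A \<le> E \<xi>"
    and E_le_W: "\<And>A \<xi>. A \<in> sets M \<Longrightarrow> \<xi> \<in> H \<Longrightarrow> (\<And>\<omega>. \<omega> \<in> space M \<Longrightarrow> 0 \<le> \<xi> \<omega>) \<Longrightarrow>
      (\<And>\<omega>. \<omega> \<in> space M \<Longrightarrow> \<xi> \<omega> \<le> indicator A \<omega>) \<Longrightarrow> E \<xi> \<le> W A"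
    and W_mono: "\<And>A B. A \<subseteq> B \<Longrightarrow> W A \<le> W B"
    and W_nonneg: "\<And>A. 0 \<le> W A"
    and W_continuous: "continuous_cap M W"
begin

lemma W_le_1: "A \<in> sets M \<Longrightarrow> W A \<le> 1"
  using W_le_E[OF _ const_in_H[of 1], of A] by (simp add: E_const indicator_def one_ereal_def)

lemma W_empty: "W {} = 0"
  using W_le_E[OF _ const_in_H[of 0], of "{}"] W_nonneg[of "{}"] by (simp add: E_const zero_ereal_def)

lemma W_space: "W (space M) = 1"
  using E_le_W[OF _ const_in_H[of 1], of "space M"] W_le_1[of "space M"]
  by (simp add: E_const one_ereal_def)

lemma W_incseq: "range A \<subseteq> sets M \<Longrightarrow> incseq A \<Longrightarrow> (\<lambda>n. W (A n)) \<longlonglongrightarrow> W (\<Union>n. A n)"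
  using W_continuous unfolding continuous_cap_def by blast

lemma W_decseq: "range A \<subseteq> sets M \<Longrightarrow> decseq A \<Longrightarrow> (\<lambda>n. W (A n)) \<longlonglongrightarrow> W (\<Inter>n. A n)"
  using W_continuous unfolding continuous_cap_def by blast

text \<open>The unions of the tails of a disjoint sequence decrease to the empty set while each of
  them still has capacity at least c.\<close>

lemma no_disjoint_large_events:
  assumes B: "range B \<subseteq> sets M" "disjoint_family B" and c: "0 < c" "\<And>k::nat. c \<le> W (B k)"
  shows False
proof -
  define A where "A n = (\<Union>k\<in>{n..}. B k)" for n
  have A: "range A \<subseteq> sets M" using B by (auto simp: A_def)
  have "decseq A" unfolding A_def decseq_def by (intro allI impI UN_mono) auto
  have "(\<Inter>n. A n) = {}"
  proof (rule ccontr)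
    assume "(\<Inter>n. A n) \<noteq> {}"
    then obtain \<omega> where \<omega>: "\<And>n. \<omega> \<in> A n" by auto
    from \<omega>[of 0] obtain k where k: "\<omega> \<in> B k" by (auto simp: A_def)
    from \<omega>[of "Suc k"] obtain l where l: "\<omega> \<in> B l" "k < l" by (auto simp: A_def)
    show False using disjoint_family_onD[OF B(2), of k l] k l by auto
  qed
  then have "(\<lambda>n. W (A n)) \<longlonglongrightarrow> 0" using W_decseq[OF A \<open>decseq A\<close>] by (simp add: W_empty)
  moreover have "c \<le> W (A n)" for n
    using c(2)[of n] W_mono[of "B n" "A n"] by (auto simp: A_def intro: order_trans)
  ultimately have "c \<le> 0" by (intro LIMSEQ_le_const) auto
  then show False using c(1) by simp
qed

lemma law1_uminus:
  assumes f: "f \<in> real_BL"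
  shows "law1 (\<lambda>y. - f y) = - law1 f"
proof (rule ccontr)
  assume neq: "law1 (\<lambda>y. - f y) \<noteq> - law1 f"
  obtain B where B: "\<And>y. \<bar>f y\<bar> \<le> B" using f by (rule real_BL_E) blast
  define lo where "lo = - law1 (\<lambda>y. - f y)"
  define hi where "hi = law1 f"
  have "lo \<le> hi" unfolding lo_def hi_def law1_def by (rule law_uminus_ge[OF real_BL_coord[OF f]])
  then have lh: "lo < hi" using neq by (simp add: lo_def hi_def)
  have Blo: "\<bar>lo\<bar> \<le> B" unfolding lo_def using law1_abs_le[OF real_BL_uminus[OF f]] B by simp
  have Bhi: "\<bar>hi\<bar> \<le> B" unfolding hi_def by (rule law1_abs_le[OF f B])
  define d where "d = (hi - lo) / 2"
  have d: "0 < d" using lh by (simp add: d_def)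
  \<comment> \<open>Long enough for the Chebyshev loss 4 B^2 / (n d^2) of block k to be at most
    \<open>\<epsilon> k\<close>.\<close>
  define n where "n k = Suc (nat \<lceil>4 * B\<^sup>2 * 2 ^ (k + 2) / d\<^sup>2\<rceil>)" for k :: nat
  \<comment> \<open>With this factor a weight vanishes once the block average is at distance d or
    more from its target. Since d is half the gap between the means, the two weights of a block are
    never positive together.\<close>
  define a where "a k = 1 / (real (n k) * d)\<^sup>2" for k
  define s where "s k = (\<Sum>j<k. n j)" for k
  \<comment> \<open>The losses sum to 1 / 2, so infinitely many blocks can follow the lower mean.
    The remaining losses from k on are 2 \<epsilon> k, whence the invariant 1 / 2 + 2 \<epsilon> k;
    a further block at the upper mean still leaves 3 / 8.\<close>
  define \<epsilon> where "\<epsilon> k = (1 / 2 :: real) ^ (k + 2)" for k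
  have eps: "0 < \<epsilon> k" "\<epsilon> k \<le> 1 / 4" for k
    unfolding \<epsilon>_def using power_decreasing[of 2 "k + 2" "1 / 2 :: real"] by (auto simp: power2_eq_square)
  have n0: "0 < real (n k)" for k by (simp only: n_def of_nat_0_less_iff zero_less_Suc)
  have a0: "0 \<le> a k" for k by (simp add: a_def)
  have a_le: "a k * real (n k) * (4 * B\<^sup>2) \<le> \<epsilon> k" for k
  proof -
    have "4 * B\<^sup>2 * 2 ^ (k + 2) / d\<^sup>2 \<le> real (n k)" unfolding n_def by linarith
    then have "4 * B\<^sup>2 / (real (n k) * d\<^sup>2) \<le> \<epsilon> k"
      using d n0[of k] by (simp add: \<epsilon>_def field_simps)
    also have "4 * B\<^sup>2 / (real (n k) * d\<^sup>2) = a k * real (n k) * (4 * B\<^sup>2)"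
      using n0[of k] by (simp add: a_def power2_eq_square)
    finally show ?thesis .
  qed
  define h where "h k = block_weight f lo (a k) (s k) (n k)" for k
  define g where "g k = block_weight f hi (a k) (s k) (n k)" for k
  define F where "F k x = (\<Prod>j<k. h j x)" for k x
  have F_Suc: "F (Suc k) = (\<lambda>x. F k x * h k x)" for k by (rule ext) (simp add: F_def)
  have h0: "0 \<le> h k x" "h k x \<le> 1" and g0: "0 \<le> g k x" "g k x \<le> 1" for k x
    using a0[of k] by (auto simp: h_def g_def block_weight_def)
  have F0: "0 \<le> F k x" "F k x \<le> 1" for k x
    unfolding F_def using h0 by (auto intro!: prod_nonneg prod_le_1)
  have s_Suc: "s (Suc k) = s k + n k" for k by (simp add: s_def)
  have hBL: "h k \<in> bounded_Lipschitz (s k + n k)" and gBL: "g k \<in> bounded_Lipschitz (s k + n k)" for k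
    unfolding h_def g_def by (rule block_weight_bounded_Lipschitz[OF f])+
  have FBL: "F k \<in> bounded_Lipschitz (s k)" for k
  proof (induction k)
    case 0
    have "F 0 = (\<lambda>_. 1)" by (rule ext) (simp add: F_def)
    then show ?case by (simp add: bounded_Lipschitz_const)
  next
    case (Suc k)
    show ?case unfolding F_Suc s_Suc
      by (intro bounded_Lipschitz_mult hBL bounded_Lipschitz_mono[OF Suc]) simp
  qed
  have lawF: "1 / 2 + 2 * \<epsilon> k \<le> law (F k)" for k
  proof (induction k)
    case 0
    have "F 0 = (\<lambda>_. 1)" by (rule ext) (simp add: F_def)
    then show ?case by (simp add: \<epsilon>_def law_const power2_eq_square)
  next
    case (Suc k)
    have "1 / 2 + 2 * \<epsilon> (Suc k) = 1 / 2 + \<epsilon> k" by (simp add: \<epsilon>_def)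
    also have "\<dots> \<le> (1 - \<epsilon> k) * (1 / 2 + 2 * \<epsilon> k)"
    proof -
      have "(1 - \<epsilon> k) * (1 / 2 + 2 * \<epsilon> k) - (1 / 2 + \<epsilon> k) = 2 * \<epsilon> k * (1 / 4 - \<epsilon> k)"
        by (simp add: algebra_simps diff_divide_distrib)
      moreover have "0 \<le> 2 * \<epsilon> k * (1 / 4 - \<epsilon> k)" using eps[of k] by simp
      ultimately show ?thesis by linarith
    qed
    also have "\<dots> \<le> (1 - \<epsilon> k) * law (F k)"
      using Suc eps(2)[of k] by (intro mult_left_mono) auto
    also have "\<dots> \<le> law (\<lambda>x. F k x * h k x)"
      unfolding h_def using eps(2)[of k] \<open>lo \<le> hi\<close>
      by (intro law_block_weight_ge[OF f B Blo _ _ FBL F0(1) a0 a_le]) (auto simp: lo_def hi_def)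
    finally show ?case by (simp add: F_Suc)
  qed
  have lawg: "1 / 4 \<le> law (\<lambda>x. F k x * g k x)" for k
  proof -
    have "(3 / 4) * (1 / 2) \<le> (1 - \<epsilon> k) * law (F k)"
      using lawF[of k] eps[of k] by (intro mult_mono) auto
    also have "\<dots> \<le> law (\<lambda>x. F k x * g k x)"
      unfolding g_def using eps(2)[of k] \<open>lo \<le> hi\<close>
      by (intro law_block_weight_ge[OF f B Bhi _ _ FBL F0(1) a0 a_le]) (auto simp: lo_def hi_def)
    finally show ?thesis by simp
  qed
  have excl: "\<not> (0 < h k x \<and> 0 < g k x)" for k x
  proof
    assume *: "0 < h k x \<and> 0 < g k x"
    have small: "\<bar>dev_sum f b (s k) (n k) x\<bar> < real (n k) * d" if "0 < block_weight f b (a k) (s k) (n k) x" for b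
    proof -
      have P: "0 < (real (n k) * d)\<^sup>2" using n0[of k] d by (intro zero_less_power mult_pos_pos)
      have "a k * (dev_sum f b (s k) (n k) x)\<^sup>2 < 1" using that by (auto simp: block_weight_def less_max_iff_disj)
      then have "(dev_sum f b (s k) (n k) x)\<^sup>2 < (real (n k) * d)\<^sup>2"
        unfolding a_def using P by (simp only: times_divide_eq_left mult_1 pos_divide_less_eq)
      then have "\<bar>dev_sum f b (s k) (n k) x\<bar>\<^sup>2 < (real (n k) * d)\<^sup>2" by (simp only: power2_abs)
      then show ?thesis by (rule power2_less_imp_less) (use n0[of k] d in auto)
    qed
    have "dev_sum f lo (s k) (n k) x - dev_sum f hi (s k) (n k) x = real (n k) * (hi - lo)"
      by (simp add: dev_sum_def sum_subtractf algebra_simps)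
    also have "\<dots> = 2 * (real (n k) * d)" by (simp add: d_def)
    finally have "dev_sum f lo (s k) (n k) x - dev_sum f hi (s k) (n k) x = 2 * (real (n k) * d)" .
    moreover have "\<bar>dev_sum f lo (s k) (n k) x\<bar> < real (n k) * d" "\<bar>dev_sum f hi (s k) (n k) x\<bar> < real (n k) * d"
      using * unfolding h_def g_def by (auto intro: small)
    ultimately show False by linarith
  qed
  define A where "A k = {\<omega>\<in>space M. 0 < F k (\<lambda>i. X (Suc i) \<omega>) * g k (\<lambda>i. X (Suc i) \<omega>)}" for k
  have FgBL: "(\<lambda>x. F k x * g k x) \<in> bounded_Lipschitz (s k + n k)" for k
    by (intro bounded_Lipschitz_mult gBL bounded_Lipschitz_mono[OF FBL]) simp
  have A_sets: "A k \<in> sets M" for k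
    unfolding A_def using H_measurable[OF seq_in_H[OF FgBL]] by measurable
  have "disjoint_family A"
    unfolding disjoint_family_on_def
  proof (intro ballI impI)
    have *: "A k \<inter> A l = {}" if "k < l" for k l
    proof (rule ccontr)
      assume "A k \<inter> A l \<noteq> {}"
      then obtain x where x: "0 < F k x * g k x" "0 < F l x * g l x" by (auto simp: A_def)
      have "h k x \<noteq> 0"
      proof
        assume "h k x = 0"
        then have "F l x = 0" unfolding F_def using that by (intro prod_zero) auto
        then show False using x by simp
      qed
      moreover have "g k x \<noteq> 0" using x by auto
      ultimately show False using excl[of k x] h0(1)[of k x] g0(1)[of k x] by auto
    qed
    fix k l :: nat assume "k \<noteq> l"
    then show "A k \<inter> A l = {}" using *[of k l] *[of l k] by (cases k l rule: linorder_cases) auto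
  qed
  moreover have "ereal (1 / 4) \<le> W (A k)" for k
  proof -
    have "ereal (1 / 4) \<le> E (\<lambda>\<omega>. F k (\<lambda>i. X (Suc i) \<omega>) * g k (\<lambda>i. X (Suc i) \<omega>))"
      unfolding E_eq_law[OF FgBL] using lawg by simp
    also have "\<dots> \<le> W (A k)"
    proof (rule E_le_W[OF A_sets seq_in_H[OF FgBL]])
      fix \<omega> assume "\<omega> \<in> space M"
      let ?x = "\<lambda>i. X (Suc i) \<omega>"
      have "0 \<le> F k ?x * g k ?x" "F k ?x * g k ?x \<le> 1"
        using F0[of k ?x] g0[of k ?x] by (auto intro: mult_le_one)
      then show "0 \<le> F k ?x * g k ?x" "F k ?x * g k ?x \<le> indicator (A k) \<omega>"
        using \<open>\<omega> \<in> space M\<close> by (auto simp: A_def indicator_def)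
    qed
    finally show ?thesis .
  qed
  ultimately show False
    using A_sets by (intro no_disjoint_large_events[of A "ereal (1 / 4)"]) auto
qed

end

section \<open>Functionals determined by a distribution function\<close>

definition ramp :: "real \<Rightarrow> real \<Rightarrow> real \<Rightarrow> real" where
  "ramp s t y = max 0 (min 1 ((t - y) / (t - s)))"

lemma ramp_01: "0 \<le> ramp s t y" "ramp s t y \<le> 1"
  by (auto simp: ramp_def)

lemma ramp_eq_1: "s < t \<Longrightarrow> y \<le> s \<Longrightarrow> ramp s t y = 1"
  by (simp add: ramp_def)

lemma ramp_eq_0: "s < t \<Longrightarrow> t \<le> y \<Longrightarrow> ramp s t y = 0"
  using divide_nonpos_pos[of "t - y" "t - s"] by (simp add: ramp_def)

lemma ramp_real_BL:
  assumes "s < t"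
  shows "ramp s t \<in> real_BL"
proof (rule real_BL_I)
  show "0 \<le> 1 / (t - s)" using assms by simp
  show "\<bar>ramp s t x - ramp s t y\<bar> \<le> 1 / (t - s) * \<bar>x - y\<bar>" for x y
  proof -
    have "\<bar>max 0 (min 1 a) - max 0 (min 1 b)\<bar> \<le> \<bar>a - b\<bar>" for a b :: real
      by (auto simp: max_def min_def)
    then have "\<bar>ramp s t x - ramp s t y\<bar> \<le> \<bar>(t - x) / (t - s) - (t - y) / (t - s)\<bar>"
      unfolding ramp_def .
    also have "(t - x) / (t - s) - (t - y) / (t - s) = (y - x) / (t - s)"
      by (simp add: diff_divide_distrib[symmetric])
    finally show ?thesis using assms by (simp add: abs_divide abs_minus_commute)
  qed
  show "\<bar>ramp s t x\<bar> \<le> 1" for x by (simp add: ramp_def)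
qed

text \<open>Indicators of half-lines are not Lipschitz, so F is tied to the functional by squeezing
  ramps between two of its values. No monotone continuity of the functional is demanded; uniqueness
  comes from quantitative approximation instead.\<close>

definition represents_cdf :: "((real \<Rightarrow> real) \<Rightarrow> real) \<Rightarrow> (real \<Rightarrow> real) \<Rightarrow> bool" where
  "represents_cdf \<Lambda> F \<longleftrightarrow>
     (\<forall>f\<in>real_BL. \<forall>g\<in>real_BL. \<Lambda> (\<lambda>x. f x + g x) = \<Lambda> f + \<Lambda> g) \<and>
     (\<forall>f\<in>real_BL. \<forall>c. \<Lambda> (\<lambda>x. c * f x) = c * \<Lambda> f) \<and>
     (\<forall>f\<in>real_BL. \<forall>g\<in>real_BL. (\<forall>x. f x \<le> g x) \<longrightarrow> \<Lambda> f \<le> \<Lambda> g) \<and>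
     (\<forall>c. \<Lambda> (\<lambda>_. c) = c) \<and>
     (\<forall>s t. s < t \<longrightarrow> F s \<le> \<Lambda> (ramp s t) \<and> \<Lambda> (ramp s t) \<le> F t)"

lemma represents_cdfD:
  assumes "represents_cdf \<Lambda> F"
  shows "f \<in> real_BL \<Longrightarrow> g \<in> real_BL \<Longrightarrow> \<Lambda> (\<lambda>x. f x + g x) = \<Lambda> f + \<Lambda> g"
    and "f \<in> real_BL \<Longrightarrow> \<Lambda> (\<lambda>x. c * f x) = c * \<Lambda> f"
    and "f \<in> real_BL \<Longrightarrow> g \<in> real_BL \<Longrightarrow> (\<And>x. f x \<le> g x) \<Longrightarrow> \<Lambda> f \<le> \<Lambda> g"
    and "\<Lambda> (\<lambda>_. c) = c"
    and "s < t \<Longrightarrow> F s \<le> \<Lambda> (ramp s t)" "s < t \<Longrightarrow> \<Lambda> (ramp s t) \<le> F t"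
  using assms unfolding represents_cdf_def by auto

lemma represents_cdf_sum:
  assumes \<Lambda>: "represents_cdf \<Lambda> F" and "\<And>i. i \<in> I \<Longrightarrow> f i \<in> real_BL"
  shows "\<Lambda> (\<lambda>x. \<Sum>i\<in>I. f i x) = (\<Sum>i\<in>I. \<Lambda> (f i))"
  using assms(2)
proof (induction I rule: infinite_finite_induct)
  case (insert i I)
  then show ?case using represents_cdfD(1)[OF \<Lambda>, of "f i" "\<lambda>x. \<Sum>i\<in>I. f i x"] by (simp add: real_BL_sum)
qed (auto simp: represents_cdfD(4)[OF \<Lambda>])

text \<open>The piecewise linear interpolation of f at the nodes s 0, ..., s n, constant outside,
  written by summation by parts as a combination of ramps, on which the functional is controlled by
  F.\<close>

definition interpolant :: "(nat \<Rightarrow> real) \<Rightarrow> nat \<Rightarrow> (real \<Rightarrow> real) \<Rightarrow> real \<Rightarrow> real" where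
  "interpolant s n f y = f (s n) + (\<Sum>i<n. (f (s i) - f (s (Suc i))) * ramp (s i) (s (Suc i)) y)"

text \<open>On cell k the ramps of the earlier cells are 0, and those of the later cells are 1, so
  that their coefficients telescope with f (s n).\<close>

lemma interpolant_ge:
  assumes s: "\<And>i. s i < s (Suc i)" and k: "Suc k \<le> n" and y: "s k \<le> y" "y \<le> s (Suc k)"
  shows "interpolant s n f y = f (s (Suc k)) + (f (s k) - f (s (Suc k))) * ramp (s k) (s (Suc k)) y"
  using k
proof (induction n rule: dec_induct)
  have mono: "s i \<le> s j" if "i \<le> j" for i j
    using less_imp_le[OF s] that by (rule lift_Suc_mono_le)
  case base
  have "(\<Sum>i<k. (f (s i) - f (s (Suc i))) * ramp (s i) (s (Suc i)) y) = 0"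
  proof (rule sum.neutral, rule ballI)
    fix i assume "i \<in> {..<k}"
    then have "s (Suc i) \<le> y" using mono[of "Suc i" k] y by auto
    then show "(f (s i) - f (s (Suc i))) * ramp (s i) (s (Suc i)) y = 0"
      using ramp_eq_0[OF s] by simp
  qed
  then show ?case by (simp add: interpolant_def)
next
  have mono: "s i \<le> s j" if "i \<le> j" for i j
    using less_imp_le[OF s] that by (rule lift_Suc_mono_le)
  case (step n)
  have "y \<le> s n" using mono[OF step(1)] y by simp
  then have "ramp (s n) (s (Suc n)) y = 1" using ramp_eq_1[OF s] by simp
  then have "interpolant s (Suc n) f y = interpolant s n f y" by (simp add: interpolant_def)
  then show ?case using step by simp
qed

lemma interpolant_right:
  assumes s: "\<And>i. s i < s (Suc i)" and y: "s n \<le> y"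
  shows "interpolant s n f y = f (s n)"
proof -
  have mono: "s i \<le> s j" if "i \<le> j" for i j
    using less_imp_le[OF s] that by (rule lift_Suc_mono_le)
  have "(\<Sum>i<n. (f (s i) - f (s (Suc i))) * ramp (s i) (s (Suc i)) y) = 0"
  proof (rule sum.neutral, rule ballI)
    fix i assume "i \<in> {..<n}"
    then have "s (Suc i) \<le> y" using mono[of "Suc i" n] y by auto
    then show "(f (s i) - f (s (Suc i))) * ramp (s i) (s (Suc i)) y = 0"
      using ramp_eq_0[OF s] by simp
  qed
  then show ?thesis by (simp add: interpolant_def)
qed

lemma interpolant_left:
  assumes s: "\<And>i. s i < s (Suc i)" and y: "y \<le> s 0"
  shows "interpolant s n f y = f (s 0)"
proof (induction n)
  case (Suc n)
  have "s 0 \<le> s n"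
    using less_imp_le[OF s] le0 by (rule lift_Suc_mono_le)
  then have "ramp (s n) (s (Suc n)) y = 1" using ramp_eq_1[OF s] y by simp
  then show ?case using Suc by (simp add: interpolant_def)
qed (simp add: interpolant_def)

text \<open>The approximating sum involves only f and F, so two functionals with the same F must
  agree. One mesh error comes from interpolating f, the other from replacing ramps by values of F,
  and the last term accounts for the mass outside [-R, R].\<close>

lemma represents_cdf_approx:
  assumes \<Lambda>: "represents_cdf \<Lambda> F" and F: "\<And>t. 0 \<le> F t" "\<And>t. F t \<le> 1"
    and f: "0 \<le> K" "0 \<le> B" "\<And>x y. \<bar>f x - f y\<bar> \<le> K * \<bar>x - y\<bar>" "\<And>x. \<bar>f x\<bar> \<le> B"
    and R: "0 < R" and n: "0 < n"
  defines "s \<equiv> \<lambda>i. - R + real i * (2 * R / real n)"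
  shows "\<bar>\<Lambda> f - (f (s n) + (\<Sum>i<n. (f (s i) - f (s (Suc i))) * F (s i)))\<bar>
    \<le> 2 * (K * (2 * R / real n)) + 2 * B * (1 - F (R - 1) + F (1 - R))"
proof -
  define \<delta> where "\<delta> = 2 * R / real n"
  have \<delta>: "0 < \<delta>" using R n by (simp add: \<delta>_def)
  have s_Suc: "s (Suc i) = s i + \<delta>" for i by (simp add: s_def \<delta>_def algebra_simps add_divide_distrib)
  have s_eq: "s i = - R + real i * \<delta>" for i by (simp add: s_def \<delta>_def)
  have s_less: "s i < s (Suc i)" for i using \<delta> by (simp add: s_Suc)
  have s0: "s 0 = - R" and sn: "s n = R" using n by (simp_all add: s_def)
  let ?I = "interpolant s n f"
  \<comment> \<open>A bounded Lipschitz majorant of the indicator of |y| >= R, where f and its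
    interpolant may differ by 2 B.\<close>
  let ?tail = "\<lambda>y. 1 + (- 1) * ramp (R - 1) R y + ramp (- R) (1 - R) y"
  have fBL: "f \<in> real_BL" by (rule real_BL_I[OF f(1,3,4)])
  have rBL: "ramp (s i) (s (Suc i)) \<in> real_BL" for i by (rule ramp_real_BL[OF s_less])
  have rBL1: "ramp (R - 1) R \<in> real_BL" "ramp (- R) (1 - R) \<in> real_BL" by (auto intro!: ramp_real_BL)
  have sumBL: "(\<lambda>y. \<Sum>i<n. (f (s i) - f (s (Suc i))) * ramp (s i) (s (Suc i)) y) \<in> real_BL"
    by (intro real_BL_sum real_BL_cmult rBL)
  have IBL: "?I \<in> real_BL" unfolding interpolant_def by (intro real_BL_add real_BL_const sumBL)
  have tBL: "?tail \<in> real_BL" by (intro real_BL_add real_BL_cmult real_BL_const rBL1)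
  have tail0: "0 \<le> ?tail y" for y using ramp_01[of "R - 1" R y] ramp_01[of "- R" "1 - R" y] by simp
  have step: "\<bar>f (s i) - f (s (Suc i))\<bar> \<le> K * \<delta>" for i
    using f(3)[of "s i" "s (Suc i)"] \<delta> by (simp add: s_Suc)
  have near: "\<bar>f y - ?I y\<bar> \<le> K * \<delta> + 2 * B * ?tail y" for y
  proof -
    consider "R \<le> y" | "y \<le> - R" | "- R < y" "y < R" by linarith
    then show ?thesis
    proof cases
      case 1
      have "?tail y \<ge> 1" using 1 ramp_eq_0[of "R - 1" R y] ramp_01[of "- R" "1 - R" y] by simp
      then have "2 * B * 1 \<le> 2 * B * ?tail y" using f(2) by (intro mult_left_mono) auto
      moreover have "?I y = f R" using interpolant_right[of s n y f, OF s_less] 1 sn by simp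
      moreover have "0 \<le> K * \<delta>" using f(1) \<delta> by simp
      ultimately show ?thesis using f(4)[of y] f(4)[of R] by linarith
    next
      case 2
      have "?tail y \<ge> 1" using 2 ramp_eq_1[of "- R" "1 - R" y] ramp_01[of "R - 1" R y] by simp
      then have "2 * B * 1 \<le> 2 * B * ?tail y" using f(2) by (intro mult_left_mono) auto
      moreover have "?I y = f (- R)" using interpolant_left[of s y n f, OF s_less] 2 s0 by simp
      moreover have "0 \<le> K * \<delta>" using f(1) \<delta> by simp
      ultimately show ?thesis using f(4)[of y] f(4)[of "- R"] by linarith
    next
      case 3
      define k where "k = nat \<lfloor>(y + R) / \<delta>\<rfloor>"
      have pos: "0 \<le> (y + R) / \<delta>" using 3 \<delta> by simp
      have "real k \<le> (y + R) / \<delta>" "(y + R) / \<delta> < real k + 1"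
        unfolding k_def using pos by linarith+
      then have k: "real k * \<delta> \<le> y + R" "y + R < (real k + 1) * \<delta>"
        using \<delta> by (auto simp: field_simps)
      have y: "s k \<le> y" "y \<le> s (Suc k)"
        unfolding s_Suc s_eq using k by (auto simp: algebra_simps)
      have "real k * \<delta> < real n * \<delta>" using k(1) 3 n by (simp add: \<delta>_def)
      then have kn: "Suc k \<le> n" using \<delta> by simp
      define r where "r = ramp (s k) (s (Suc k)) y"
      have r: "0 \<le> r" "r \<le> 1" unfolding r_def by (rule ramp_01)+
      have "f y - ?I y = (1 - r) * (f y - f (s (Suc k))) + r * (f y - f (s k))"
        unfolding interpolant_ge[of s k n y f, OF s_less kn y] r_def[symmetric] by (simp add: algebra_simps)
      also have "\<bar>\<dots>\<bar> \<le> (1 - r) * \<bar>f y - f (s (Suc k))\<bar> + r * \<bar>f y - f (s k)\<bar>"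
        using r by (intro order_trans[OF abs_triangle_ineq]) (simp add: abs_mult)
      also have "\<dots> \<le> (1 - r) * (K * \<delta>) + r * (K * \<delta>)"
      proof (intro add_mono mult_left_mono)
        show "\<bar>f y - f (s (Suc k))\<bar> \<le> K * \<delta>" "\<bar>f y - f (s k)\<bar> \<le> K * \<delta>"
          using f(3)[of y "s (Suc k)"] f(3)[of y "s k"] y f(1) unfolding s_Suc
          by (auto intro: order_trans[OF _ mult_left_mono])
      qed (use r in auto)
      also have "\<dots> = K * \<delta>" by (simp add: algebra_simps)
      finally show ?thesis using tail0[of y] f(2) by (smt (verit) mult_nonneg_nonneg)
    qed
  qed
  have \<Lambda>tail: "\<Lambda> ?tail \<le> 1 - F (R - 1) + F (1 - R)"
  proof -
    have "\<Lambda> ?tail = \<Lambda> (\<lambda>y. 1 + (- 1) * ramp (R - 1) R y) + \<Lambda> (ramp (- R) (1 - R))"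
      by (intro represents_cdfD(1)[OF \<Lambda>] real_BL_add real_BL_cmult real_BL_const rBL1)
    also have "\<Lambda> (\<lambda>y. 1 + (- 1) * ramp (R - 1) R y) = \<Lambda> (\<lambda>_. 1) + \<Lambda> (\<lambda>y. (- 1) * ramp (R - 1) R y)"
      by (intro represents_cdfD(1)[OF \<Lambda>] real_BL_cmult real_BL_const rBL1)
    also have "\<Lambda> (\<lambda>y. (- 1) * ramp (R - 1) R y) = (- 1) * \<Lambda> (ramp (R - 1) R)"
      by (rule represents_cdfD(2)[OF \<Lambda> rBL1(1)])
    finally show ?thesis
      using represents_cdfD(5)[OF \<Lambda>, of "R - 1" R] represents_cdfD(6)[OF \<Lambda>, of "- R" "1 - R"]
        represents_cdfD(4)[OF \<Lambda>, of 1] by simp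
  qed
  let ?err = "\<lambda>y. K * \<delta> + 2 * B * ?tail y"
  have eBL: "?err \<in> real_BL" by (intro real_BL_add[OF real_BL_const] real_BL_cmult tBL)
  have \<Lambda>err: "\<Lambda> ?err \<le> K * \<delta> + 2 * B * (1 - F (R - 1) + F (1 - R))"
  proof -
    have "\<Lambda> ?err = \<Lambda> (\<lambda>_. K * \<delta>) + \<Lambda> (\<lambda>y. 2 * B * ?tail y)"
      by (intro represents_cdfD(1)[OF \<Lambda>] real_BL_cmult real_BL_const tBL)
    also have "\<Lambda> (\<lambda>y. 2 * B * ?tail y) = 2 * B * \<Lambda> ?tail" by (rule represents_cdfD(2)[OF \<Lambda> tBL])
    also have "\<dots> \<le> 2 * B * (1 - F (R - 1) + F (1 - R))" using \<Lambda>tail f(2) by (intro mult_left_mono) auto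
    finally show ?thesis using represents_cdfD(4)[OF \<Lambda>, of "K * \<delta>"] by simp
  qed
  have "\<Lambda> f \<le> \<Lambda> (\<lambda>y. ?I y + ?err y)"
  proof (rule represents_cdfD(3)[OF \<Lambda> fBL real_BL_add[OF IBL eBL]])
    show "f y \<le> ?I y + ?err y" for y using near[of y] by linarith
  qed
  then have 1: "\<Lambda> f \<le> \<Lambda> ?I + \<Lambda> ?err" using represents_cdfD(1)[OF \<Lambda> IBL eBL] by simp
  have "\<Lambda> ?I \<le> \<Lambda> (\<lambda>y. f y + ?err y)"
  proof (rule represents_cdfD(3)[OF \<Lambda> IBL real_BL_add[OF fBL eBL]])
    show "?I y \<le> f y + ?err y" for y using near[of y] by linarith
  qed
  then have 2: "\<Lambda> ?I \<le> \<Lambda> f + \<Lambda> ?err" using represents_cdfD(1)[OF \<Lambda> fBL eBL] by simp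
  have \<Lambda>I: "\<Lambda> ?I = f (s n) + (\<Sum>i<n. (f (s i) - f (s (Suc i))) * \<Lambda> (ramp (s i) (s (Suc i))))"
  proof -
    have "\<Lambda> ?I = \<Lambda> (\<lambda>_. f (s n)) + \<Lambda> (\<lambda>y. \<Sum>i<n. (f (s i) - f (s (Suc i))) * ramp (s i) (s (Suc i)) y)"
      unfolding interpolant_def by (rule represents_cdfD(1)[OF \<Lambda> real_BL_const sumBL])
    also have "\<Lambda> (\<lambda>y. \<Sum>i<n. (f (s i) - f (s (Suc i))) * ramp (s i) (s (Suc i)) y)
      = (\<Sum>i<n. \<Lambda> (\<lambda>y. (f (s i) - f (s (Suc i))) * ramp (s i) (s (Suc i)) y))"
      by (rule represents_cdf_sum[OF \<Lambda>]) (intro real_BL_cmult rBL)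
    also have "\<dots> = (\<Sum>i<n. (f (s i) - f (s (Suc i))) * \<Lambda> (ramp (s i) (s (Suc i))))"
      by (intro sum.cong refl represents_cdfD(2)[OF \<Lambda> rBL])
    finally show ?thesis using represents_cdfD(4)[OF \<Lambda>] by simp
  qed
  have "\<bar>\<Lambda> ?I - (f (s n) + (\<Sum>i<n. (f (s i) - f (s (Suc i))) * F (s i)))\<bar>
      = \<bar>\<Sum>i<n. (f (s i) - f (s (Suc i))) * (\<Lambda> (ramp (s i) (s (Suc i))) - F (s i))\<bar>"
    unfolding \<Lambda>I by (simp add: right_diff_distrib sum_subtractf)
  also have "\<dots> \<le> (\<Sum>i<n. \<bar>(f (s i) - f (s (Suc i))) * (\<Lambda> (ramp (s i) (s (Suc i))) - F (s i))\<bar>)"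
    by (rule sum_abs)
  \<comment> \<open>Each replacement costs at most an increment of F times the oscillation of f on
    the cell; the increments telescope to at most 1, so the number of cells does not matter.\<close>
  also have "\<dots> \<le> (\<Sum>i<n. K * \<delta> * (F (s (Suc i)) - F (s i)))"
  proof (rule sum_mono)
    fix i
    have "\<bar>\<Lambda> (ramp (s i) (s (Suc i))) - F (s i)\<bar> \<le> F (s (Suc i)) - F (s i)"
      using represents_cdfD(5,6)[OF \<Lambda> s_less[of i]] by simp
    then show "\<bar>(f (s i) - f (s (Suc i))) * (\<Lambda> (ramp (s i) (s (Suc i))) - F (s i))\<bar> \<le> K * \<delta> * (F (s (Suc i)) - F (s i))"
      unfolding abs_mult using step[of i] f(1) \<delta> by (intro mult_mono) auto
  qed
  also have "\<dots> = K * \<delta> * (F (s n) - F (s 0))"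
    using sum_lessThan_telescope[of "\<lambda>i. F (s i)" n] by (simp add: sum_distrib_left[symmetric])
  also have "\<dots> \<le> K * \<delta> * 1"
    using F(1)[of "s 0"] F(2)[of "s n"] f(1) \<delta> by (intro mult_left_mono) auto
  finally show ?thesis using 1 2 \<Lambda>err unfolding \<delta>_def by linarith
qed

lemma represents_cdf_unique:
  assumes \<Lambda>: "represents_cdf \<Lambda> F" and \<Lambda>': "represents_cdf \<Lambda>' F"
    and F: "\<And>t. 0 \<le> F t" "\<And>t. F t \<le> 1" "(F \<longlongrightarrow> 0) at_bot" "(F \<longlongrightarrow> 1) at_top"
    and f: "f \<in> real_BL"
  shows "\<Lambda> f = \<Lambda>' f"
proof -
  obtain K B where f: "0 \<le> K" "0 \<le> B" "\<And>x y. \<bar>f x - f y\<bar> \<le> K * \<bar>x - y\<bar>" "\<And>x. \<bar>f x\<bar> \<le> B"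
    using f by (rule real_BL_E) blast
  \<comment> \<open>Range R = n with n^2 cells: the mesh 2 / n shrinks while the range exhausts the
    line.\<close>
  let ?b = "\<lambda>n. 2 * (2 * (K * (2 * real n / real (n * n))) + 2 * B * (1 - F (real n - 1) + F (1 - real n)))"
  have "\<bar>\<Lambda> f - \<Lambda>' f\<bar> \<le> ?b n" if "0 < n" for n
    using represents_cdf_approx[OF \<Lambda> F(1,2) f, of "real n" "n * n"] represents_cdf_approx[OF \<Lambda>' F(1,2) f, of "real n" "n * n"] that
    by simp
  moreover have "?b \<longlonglongrightarrow> 2 * (2 * (K * 0) + 2 * B * (1 - 1 + 0))"
  proof (intro tendsto_intros)
    show "(\<lambda>n. 2 * real n / real (n * n)) \<longlonglongrightarrow> 0" by real_asymp
    have "filterlim (\<lambda>n. real n - 1) at_top sequentially" by real_asymp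
    then show "(\<lambda>n. F (real n - 1)) \<longlonglongrightarrow> 1" using F(4) by (rule filterlim_compose[rotated])
    have "filterlim (\<lambda>n. 1 - real n) at_bot sequentially" by real_asymp
    then show "(\<lambda>n. F (1 - real n)) \<longlonglongrightarrow> 0" using F(3) by (rule filterlim_compose[rotated])
  qed
  ultimately have "\<bar>\<Lambda> f - \<Lambda>' f\<bar> \<le> 0"
    by (intro LIMSEQ_le_const[where X = ?b]) (auto intro!: exI[of _ 1])
  then show ?thesis by simp
qed

lemma represents_cdf_distribution:
  assumes "real_distribution \<mu>"
  shows "represents_cdf (\<lambda>f. \<integral>x. f x \<partial>\<mu>) (cdf \<mu>)"
proof -
  interpret real_distribution \<mu> by fact
  have m: "f \<in> borel_measurable borel" if f: "f \<in> real_BL" for f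
  proof -
    obtain K where K: "0 \<le> K" "\<And>x y. \<bar>f x - f y\<bar> \<le> K * \<bar>x - y\<bar>" using f by (rule real_BL_E) blast
    then have "K-lipschitz_on UNIV f" by (intro lipschitz_onI) (auto simp: dist_real_def)
    then show ?thesis by (intro borel_measurable_continuous_onI lipschitz_on_continuous_on)
  qed
  have int: "integrable \<mu> f" if f: "f \<in> real_BL" for f
  proof -
    obtain B where B: "\<And>x. \<bar>f x\<bar> \<le> B" using f by (rule real_BL_E) blast
    show ?thesis by (rule integrable_const_bound[of _ B]) (use B m[OF f] in auto)
  qed
  have ind: "integrable \<mu> (indicator {..t} :: real \<Rightarrow> real)" for t
    by (intro integrable_real_indicator) (auto simp: emeasure_eq_measure)
  have cdf_eq: "cdf \<mu> t = (\<integral>x. indicator {..t} x \<partial>\<mu>)" for t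
    by (simp add: cdf_def)
  have "cdf \<mu> s \<le> (\<integral>x. ramp s t x \<partial>\<mu>) \<and> (\<integral>x. ramp s t x \<partial>\<mu>) \<le> cdf \<mu> t" if st: "s < t" for s t
  proof (unfold cdf_eq, intro conjI Bochner_Integration.integral_mono ind int ramp_real_BL st)
    fix x
    show "indicator {..s} x \<le> ramp s t x"
      using ramp_eq_1[OF st, of x] ramp_01[of s t x] by (cases "x \<le> s") auto
    show "ramp s t x \<le> indicator {..t} x"
      using ramp_eq_0[OF st, of x] ramp_01[of s t x] by (cases "x \<le> t") auto
  qed
  note ramp = this
  show ?thesis
    unfolding represents_cdf_def
  proof (intro conjI ballI allI impI)
    show "(\<integral>x. c \<partial>\<mu>) = c" for c :: real
      using prob_space by simp
    show "(\<integral>x. f x \<partial>\<mu>) \<le> (\<integral>x. g x \<partial>\<mu>)"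
      if "f \<in> real_BL" "g \<in> real_BL" "\<forall>x. f x \<le> g x" for f g
      by (rule Bochner_Integration.integral_mono[OF int[OF that(1)] int[OF that(2)]]) (use that(3) in blast)
  qed (use ramp int in \<open>simp_all add: Bochner_Integration.integral_add\<close>)
qed

section \<open>The product measure behind a continuous capacity\<close>

lemma tendsto_coordinatewise:
  fixes f :: "'b \<Rightarrow> nat \<Rightarrow> real"
  shows "(f \<longlongrightarrow> l) F \<longleftrightarrow> (\<forall>i. ((\<lambda>c. f c i) \<longlongrightarrow> l i) F)"
  using limitin_componentwise[of "\<lambda>_::nat. euclidean :: real topology" UNIV f l F]
  by (simp add: euclidean_product_topology)

text \<open>The seminorm reads finitely many coordinates and is therefore continuous for the product
  topology.\<close>

lemma bounded_Lipschitz_measurable: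
  assumes "\<phi> \<in> bounded_Lipschitz n"
  shows "\<phi> \<in> borel_measurable borel"
proof -
  obtain K where K: "0 \<le> K" "\<And>x y. \<bar>\<phi> x - \<phi> y\<bar> \<le> K * vnorm n (\<lambda>i. x i - y i)"
    using assms by (rule bounded_LipschitzE) blast
  have "continuous_on UNIV \<phi>"
    unfolding continuous_on_def
  proof (intro ballI)
    fix x :: "nat \<Rightarrow> real"
    have "((\<lambda>y. y) \<longlongrightarrow> x) (at x)" by (rule tendsto_ident_at)
    then have "((\<lambda>y. y i) \<longlongrightarrow> x i) (at x)" for i
      unfolding tendsto_coordinatewise[of "\<lambda>y. y"] by simp
    then have "((\<lambda>y. K * sqrt (\<Sum>i<n. (y i - x i)\<^sup>2)) \<longlongrightarrow> K * sqrt (\<Sum>i<n. (x i - x i)\<^sup>2)) (at x)"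
      by (intro tendsto_intros)
    then have "((\<lambda>y. K * vnorm n (\<lambda>i. y i - x i)) \<longlongrightarrow> 0) (at x)"
      by (simp add: vnorm_def L2_set_def)
    then have "((\<lambda>y. \<phi> y - \<phi> x) \<longlongrightarrow> 0) (at x)"
      by (rule Lim_null_comparison[rotated]) (use K(2) in \<open>auto intro: always_eventually\<close>)
    then show "(\<phi> \<longlongrightarrow> \<phi> x) (at x within UNIV)" by (simp add: LIM_zero_iff)
  qed
  then show ?thesis by (rule borel_measurable_continuous_onI)
qed

text \<open>The distance to the complement of U, measured in the first n coordinates, grows with n.
  If n times this distance stayed below 1 for every positive n, points of the complement would
  converge coordinatewise to x, which is impossible for x in the open set U.\<close>

lemma open_eq_Union_bounded_Lipschitz:
  fixes U :: "(nat \<Rightarrow> real) set"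
  assumes "open U"
  obtains \<phi> :: "nat \<Rightarrow> (nat \<Rightarrow> real) \<Rightarrow> real" where "\<And>n. \<phi> n \<in> bounded_Lipschitz n"
    "\<And>n x. 0 \<le> \<phi> n x" "\<And>n x. \<phi> n x \<le> indicator U x" "\<And>n x. \<phi> n x \<le> \<phi> (Suc n) x"
    "\<And>x. x \<in> U \<Longrightarrow> \<exists>n. \<phi> n x = 1"
\<comment> \<open>An empty complement would make the infimum defining the distance
  meaningless.\<close>
proof (cases "U = UNIV")
  case True
  then show ?thesis using that[of "\<lambda>_ _. 1"] bounded_Lipschitz_const by auto
next
  case False
  then obtain w where w: "w \<notin> U" by auto
  define D where "D n x = (\<lambda>y. vnorm n (\<lambda>i. x i - y i)) ` (- U)" for n x
  define gap where "gap n x = Inf (D n x)" for n x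
  have D: "D n x \<noteq> {}" "bdd_below (D n x)" for n x
    using w vnorm_nonneg by (auto simp: D_def intro!: bdd_belowI[of _ 0])
  have gap0: "0 \<le> gap n x" for n x
    unfolding gap_def using vnorm_nonneg by (intro cInf_greatest D) (auto simp: D_def)
  have gap_le: "gap n x \<le> vnorm n (\<lambda>i. x i - y i)" if "y \<notin> U" for n x y
    unfolding gap_def using that by (intro cInf_lower D) (auto simp: D_def)
  have gap_Lip: "gap n x \<le> vnorm n (\<lambda>i. x i - y i) + gap n y" for n x y
  proof -
    have "gap n x - vnorm n (\<lambda>i. x i - y i) \<le> gap n y"
      unfolding gap_def[of n y]
    proof (rule cInf_greatest[OF D(1)])
      fix v assume "v \<in> D n y"
      then obtain z where z: "z \<notin> U" "v = vnorm n (\<lambda>i. y i - z i)" by (auto simp: D_def)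
      then show "gap n x - vnorm n (\<lambda>i. x i - y i) \<le> v"
        using gap_le[of z n x] vnorm_triangle[of n x z y] by linarith
    qed
    then show ?thesis by linarith
  qed
  have gap_Suc: "gap n x \<le> gap (Suc n) x" for n x
    unfolding gap_def[of "Suc n"]
  proof (rule cInf_greatest[OF D(1)])
    fix v assume "v \<in> D (Suc n) x"
    then obtain z where z: "z \<notin> U" "v = vnorm (Suc n) (\<lambda>i. x i - z i)" by (auto simp: D_def)
    then show "gap n x \<le> v"
      using gap_le[of z n x] vnorm_mono[of n "Suc n" "\<lambda>i. x i - z i"] by linarith
  qed
  define \<phi> where "\<phi> n x = min 1 (real n * gap n x)" for n x
  have "\<phi> n \<in> bounded_Lipschitz n" for n
  proof (rule bounded_LipschitzI)
    show "0 \<le> real n" by simp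
    show "\<bar>\<phi> n x\<bar> \<le> 1" for x using gap0[of n x] by (simp add: \<phi>_def)
    show "\<bar>\<phi> n x - \<phi> n y\<bar> \<le> real n * vnorm n (\<lambda>i. x i - y i)" for x y
    proof -
      have "\<bar>gap n x - gap n y\<bar> \<le> vnorm n (\<lambda>i. x i - y i)"
        using gap_Lip[of n x y] gap_Lip[of n y x] vnorm_minus_commute[of n x y] by linarith
      then have "\<bar>real n * gap n x - real n * gap n y\<bar> \<le> real n * vnorm n (\<lambda>i. x i - y i)"
        unfolding right_diff_distrib[symmetric] abs_mult by (simp add: mult_left_mono)
      then show ?thesis unfolding \<phi>_def by linarith
    qed
  qed
  moreover have "0 \<le> \<phi> n x" for n x using gap0[of n x] by (simp add: \<phi>_def)
  moreover have "\<phi> n x \<le> indicator U x" for n x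
    using gap_le[of x n x] gap0[of n x] by (cases "x \<in> U") (auto simp: \<phi>_def vnorm_def L2_set_def)
  moreover have "\<phi> n x \<le> \<phi> (Suc n) x" for n x
    unfolding \<phi>_def using mult_mono[OF _ gap_Suc, of "real n" "real (Suc n)" n x] gap0[of n x]
    by (intro min.mono) auto
  moreover have "\<exists>n. \<phi> n x = 1" if "x \<in> U" for x
  proof (rule ccontr)
    assume no: "\<nexists>n. \<phi> n x = 1"
    have "\<exists>y. y \<notin> U \<and> vnorm (Suc n) (\<lambda>i. x i - y i) < 1 / real (Suc n)" for n
    proof -
      have "\<phi> (Suc n) x < 1" using no[simplified, rule_format, of "Suc n"] by (auto simp: \<phi>_def min_def split: if_splits)
      then have "gap (Suc n) x < 1 / real (Suc n)"
        by (simp add: \<phi>_def field_simps min_less_iff_disj)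
      then obtain v where "v \<in> D (Suc n) x" "v < 1 / real (Suc n)"
        unfolding gap_def using cInf_lessD[OF D(1)] by blast
      then show ?thesis by (auto simp: D_def)
    qed
    then obtain y where y: "\<And>n. y n \<notin> U" "\<And>n. vnorm (Suc n) (\<lambda>i. x i - y n i) < 1 / real (Suc n)" by metis
    have "(\<lambda>n. y n i) \<longlonglongrightarrow> x i" for i
    proof -
      have "(\<lambda>n. y n i - x i) \<longlonglongrightarrow> 0"
      proof (rule Lim_null_comparison)
        show "eventually (\<lambda>n. norm (y n i - x i) \<le> 1 / real (Suc n)) sequentially"
          using eventually_ge_at_top[of i]
        proof eventually_elim
          case (elim n)
          then have "\<bar>x i - y n i\<bar> \<le> vnorm (Suc n) (\<lambda>i. x i - y n i)"
            using abs_le_vnorm[of i "Suc n" "\<lambda>i. x i - y n i"] by simp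
          then show ?case using y(2)[of n] by simp
        qed
        show "(\<lambda>n. 1 / real (Suc n)) \<longlonglongrightarrow> 0" by real_asymp
      qed
      then show ?thesis by (simp add: LIM_zero_iff)
    qed
    then have "y \<longlonglongrightarrow> x" using tendsto_coordinatewise by blast
    then have "eventually (\<lambda>n. y n \<in> U) sequentially"
      using \<open>open U\<close> that by (rule topological_tendstoD)
    then show False using y(1) by (auto dest: eventually_happens)
  qed
  ultimately show ?thesis using that by blast
qed

section \<open>The marginal distribution and the product measure\<close>

context continuous_capacity
begin

lemma law1_add:
  assumes "f \<in> real_BL" "g \<in> real_BL"
  shows "law1 (\<lambda>x. f x + g x) = law1 f + law1 g"
proof (rule antisym[OF law1_add_le[OF assms]])
  have "law1 (\<lambda>x. (f x + g x) + (- g x)) \<le> law1 (\<lambda>x. f x + g x) + law1 (\<lambda>x. - g x)"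
    by (intro law1_add_le real_BL_add real_BL_uminus assms)
  then show "law1 f + law1 g \<le> law1 (\<lambda>x. f x + g x)" by (simp add: law1_uminus[OF assms(2)])
qed

lemma law1_scale:
  assumes "f \<in> real_BL"
  shows "law1 (\<lambda>x. c * f x) = c * law1 f"
proof (cases "0 \<le> c")
  case False
  have "law1 (\<lambda>x. - (- c * f x)) = - law1 (\<lambda>x. - c * f x)"
    by (intro law1_uminus real_BL_cmult assms)
  then show ?thesis using law1_cmult[OF assms, of "- c"] False by simp
qed (use law1_cmult[OF assms] in simp)

definition capF :: "real \<Rightarrow> real" where
  "capF t = real_of_ereal (W {\<omega>\<in>space M. X (Suc 0) \<omega> \<le> t})"

lemma X_measurable[measurable]: "X (Suc n) \<in> borel_measurable M"
  by (rule H_measurable[OF rv]) simp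

lemma ereal_real_W: "A \<in> sets M \<Longrightarrow> ereal (real_of_ereal (W A)) = W A"
  using W_le_1[of A] W_nonneg[of A] by (cases "W A") auto

lemma capF_eq: "W {\<omega>\<in>space M. X (Suc 0) \<omega> \<le> t} = ereal (capF t)"
  unfolding capF_def by (subst ereal_real_W) auto

lemma capF_01: "0 \<le> capF t" "capF t \<le> 1"
proof -
  have "{\<omega>\<in>space M. X (Suc 0) \<omega> \<le> t} \<in> sets M" by measurable
  from W_le_1[OF this] W_nonneg[of "{\<omega>\<in>space M. X (Suc 0) \<omega> \<le> t}"]
  show "0 \<le> capF t" "capF t \<le> 1" unfolding capF_eq by (auto simp: one_ereal_def zero_ereal_def)
qed

lemma capF_mono: "s \<le> t \<Longrightarrow> capF s \<le> capF t"
proof -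
  assume "s \<le> t"
  then have "W {\<omega>\<in>space M. X (Suc 0) \<omega> \<le> s} \<le> W {\<omega>\<in>space M. X (Suc 0) \<omega> \<le> t}"
    by (intro W_mono) auto
  then show ?thesis unfolding capF_eq by simp
qed

lemma capF_right_cont: "continuous (at_right a) capF"
proof -
  let ?A = "\<lambda>n. {\<omega>\<in>space M. X (Suc 0) \<omega> \<le> a + 1 / real (Suc n)}"
  have "(\<lambda>n. W (?A n)) \<longlonglongrightarrow> W (\<Inter>n. ?A n)"
  proof (rule W_decseq)
    show "range ?A \<subseteq> sets M" by auto
    show "decseq ?A"
      unfolding decseq_def
    proof (intro allI impI subsetI CollectI conjI)
      fix m n \<omega> assume "m \<le> n" "\<omega> \<in> ?A n"
      then have "X (Suc 0) \<omega> \<le> a + 1 / real (Suc n)" "1 / real (Suc n) \<le> 1 / real (Suc m)"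
        by (auto simp: frac_le)
      then show "X (Suc 0) \<omega> \<le> a + 1 / real (Suc m)" by linarith
    qed auto
  qed
  also have "(\<Inter>n. ?A n) = {\<omega>\<in>space M. X (Suc 0) \<omega> \<le> a}"
  proof (intro equalityI subsetI)
    fix \<omega> assume \<omega>: "\<omega> \<in> (\<Inter>n. ?A n)"
    have "(\<lambda>n. a + 1 / real (Suc n)) \<longlonglongrightarrow> a" by real_asymp
    then have "X (Suc 0) \<omega> \<le> a" using \<omega> by (intro LIMSEQ_le_const) auto
    then show "\<omega> \<in> {\<omega>\<in>space M. X (Suc 0) \<omega> \<le> a}" using \<omega> by auto
  qed (auto intro: order_trans)
  finally have lim: "(\<lambda>n. capF (a + 1 / real (Suc n))) \<longlonglongrightarrow> capF a"
    unfolding capF_eq by simp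
  have "continuous (at_right a) capF \<longleftrightarrow> (\<forall>e>0. \<exists>\<delta>>0. capF (a + \<delta>) - capF a < e)"
    by (rule continuous_at_right_real_increasing) (rule capF_mono)
  moreover have "\<forall>e>0. \<exists>\<delta>>0. capF (a + \<delta>) - capF a < e"
  proof (intro allI impI)
    fix e :: real assume "0 < e"
    from LIMSEQ_D[OF lim this] obtain n where "\<bar>capF (a + 1 / real (Suc n)) - capF a\<bar> < e" by auto
    then show "\<exists>\<delta>>0. capF (a + \<delta>) - capF a < e"
      by (intro exI[of _ "1 / real (Suc n)"]) auto
  qed
  ultimately show ?thesis by blast
qed

lemma capF_at_bot: "(capF \<longlongrightarrow> 0) at_bot"
proof -
  let ?A = "\<lambda>n. {\<omega>\<in>space M. X (Suc 0) \<omega> \<le> - real n}"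
  have "(\<lambda>n. W (?A n)) \<longlonglongrightarrow> W (\<Inter>n. ?A n)"
    by (rule W_decseq) (auto simp: decseq_def)
  also have "(\<Inter>n. ?A n) = {}"
  proof (intro equalityI subsetI)
    fix \<omega> assume \<omega>: "\<omega> \<in> (\<Inter>n. ?A n)"
    obtain n where "- X (Suc 0) \<omega> < real n" using reals_Archimedean2 by blast
    moreover have "X (Suc 0) \<omega> \<le> - real n" using \<omega> by blast
    ultimately show "\<omega> \<in> {}" by simp
  qed simp
  finally have lim: "(\<lambda>n. capF (- real n)) \<longlonglongrightarrow> 0"
    unfolding capF_eq W_empty zero_ereal_def by simp
  show ?thesis
  proof (rule tendstoI)
    fix e :: real assume "0 < e"
    from LIMSEQ_D[OF lim this] obtain n where n: "\<bar>capF (- real n)\<bar> < e" by auto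
    show "eventually (\<lambda>t. dist (capF t) 0 < e) at_bot"
      using eventually_le_at_bot[of "- real n"]
      by eventually_elim (use n capF_mono capF_01 in \<open>force simp: dist_real_def\<close>)
  qed
qed

lemma capF_at_top: "(capF \<longlongrightarrow> 1) at_top"
proof -
  let ?A = "\<lambda>n. {\<omega>\<in>space M. X (Suc 0) \<omega> \<le> real n}"
  have "(\<lambda>n. W (?A n)) \<longlonglongrightarrow> W (\<Union>n. ?A n)"
    by (rule W_incseq) (auto simp: incseq_def)
  also have "(\<Union>n. ?A n) = space M" by (auto intro: real_arch_simple)
  finally have lim: "(\<lambda>n. capF (real n)) \<longlonglongrightarrow> 1"
    unfolding capF_eq W_space one_ereal_def by simp
  show ?thesis
  proof (rule tendstoI)
    fix e :: real assume "0 < e"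
    from LIMSEQ_D[OF lim this] obtain n where n: "\<bar>capF (real n) - 1\<bar> < e" by auto
    show "eventually (\<lambda>t. dist (capF t) 1 < e) at_top"
      using eventually_ge_at_top[of "real n"]
    proof eventually_elim
      case (elim t)
      then show ?case using n capF_mono[OF elim] capF_01(2)[of t] by (simp add: dist_real_def)
    qed
  qed
qed

lemma represents_law1: "represents_cdf law1 capF"
  unfolding represents_cdf_def
proof (intro conjI ballI allI impI)
  fix s t :: real assume st: "s < t"
  have H: "(\<lambda>\<omega>. ramp s t (X (Suc 0) \<omega>)) \<in> H"
    using in_H[OF bounded_Lipschitz_C_l_Lip[OF real_BL_coord[OF ramp_real_BL[OF st]]], of "\<lambda>_. X (Suc 0)"] rv by simp
  have E: "E (\<lambda>\<omega>. ramp s t (X (Suc 0) \<omega>)) = ereal (law1 (ramp s t))"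
    by (rule E_term_eq_law1[OF ramp_real_BL[OF st]]) simp
  have sets: "{\<omega>\<in>space M. X (Suc 0) \<omega> \<le> u} \<in> sets M" for u by measurable
  have "W {\<omega>\<in>space M. X (Suc 0) \<omega> \<le> s} \<le> E (\<lambda>\<omega>. ramp s t (X (Suc 0) \<omega>))"
    using ramp_01[of s t] ramp_eq_1[OF st] by (intro W_le_E[OF sets H]) (auto simp: indicator_def)
  then show "capF s \<le> law1 (ramp s t)" unfolding E capF_eq by simp
  have "E (\<lambda>\<omega>. ramp s t (X (Suc 0) \<omega>)) \<le> W {\<omega>\<in>space M. X (Suc 0) \<omega> \<le> t}"
    using ramp_01[of s t] ramp_eq_0[OF st] by (intro E_le_W[OF sets H]) (auto simp: indicator_def not_le)
  then show "law1 (ramp s t) \<le> capF t" unfolding E capF_eq by simp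
qed (auto intro: law1_add law1_scale law1_mono law1_const)

definition marginal :: "real measure" where
  "marginal = interval_measure capF"

definition seq_law :: "(nat \<Rightarrow> real) measure" where
  "seq_law = PiM UNIV (\<lambda>_. marginal)"

definition sample :: "'a \<Rightarrow> nat \<Rightarrow> real" where
  "sample \<omega> i = X (Suc i) \<omega>"

lemma real_distribution_marginal: "real_distribution marginal"
  unfolding marginal_def
  by (rule real_distribution_interval_measure[OF capF_mono capF_right_cont capF_at_bot capF_at_top])

lemma sets_marginal[measurable_cong, simp]: "sets marginal = sets borel"
  using real_distribution_marginal by (simp add: real_distribution_def real_distribution_axioms_def)

lemma prob_space_marginal: "prob_space marginal"
  using real_distribution_marginal by (simp add: real_distribution_def)

lemma law1_eq_integral:
  assumes "f \<in> real_BL"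
  shows "law1 f = (\<integral>x. f x \<partial>marginal)"
proof -
  have "cdf marginal = capF"
    unfolding marginal_def by (rule cdf_interval_measure[OF capF_mono capF_right_cont capF_at_bot])
  then have "represents_cdf (\<lambda>f. \<integral>x. f x \<partial>marginal) capF"
    using represents_cdf_distribution[OF real_distribution_marginal] by simp
  from represents_cdf_unique[OF represents_law1 this capF_01 capF_at_bot capF_at_top assms]
  show ?thesis .
qed

lemma prob_space_seq_law: "prob_space seq_law"
  unfolding seq_law_def by (rule prob_space_PiM) (rule prob_space_marginal)

text \<open>With countably many coordinates the product sigma-algebra is the Borel one, which gives
  access to open sets and outer regularity.\<close>

lemma sets_seq_law[measurable_cong, simp]: "sets seq_law = sets borel"
proof -
  have "sets seq_law = sets (PiM UNIV (\<lambda>_::nat. borel :: real measure))"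
    unfolding seq_law_def by (rule sets_PiM_cong) auto
  then show ?thesis by (simp add: sets_PiM_equal_borel)
qed

lemma space_seq_law[simp]: "space seq_law = UNIV"
  using sets_eq_imp_space_eq[OF sets_seq_law] by simp

text \<open>Resampling one coordinate leaves the product measure invariant. This matches the form of
  \<open>integrate_out\<close> and avoids splitting sequences into initial and final
  segments.\<close>

lemma seq_law_update: "distr (marginal \<Otimes>\<^sub>M seq_law) seq_law (\<lambda>(y, x). x(n := y)) = seq_law"
  using distr_pair_PiM_eq_PiM[of UNIV "\<lambda>_. marginal" n] prob_space_marginal by (simp add: seq_law_def)

text \<open>Linearity in one variable suffices: coordinates are integrated out one at a time, on the
  capacity side by independence and on the measure side by Fubini with a resampled
  coordinate.\<close>

lemma law_eq_integral: "\<phi> \<in> bounded_Lipschitz n \<Longrightarrow> law \<phi> = (\<integral>x. \<phi> x \<partial>seq_law)"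
proof (induction n arbitrary: \<phi>)
  case 0
  interpret prob_space seq_law by (rule prob_space_seq_law)
  have "\<phi> = (\<lambda>_. \<phi> undefined)" by (rule ext) (rule bounded_Lipschitz_cong[OF 0], simp)
  then obtain c where "\<phi> = (\<lambda>_. c)" by blast
  then show ?case using prob_space by (simp add: law_const)
next
  case (Suc n)
  interpret S: prob_space seq_law by (rule prob_space_seq_law)
  interpret G: prob_space marginal by (rule prob_space_marginal)
  interpret pair_prob_space marginal seq_law ..
  obtain B where B: "\<And>x. \<bar>\<phi> x\<bar> \<le> B" using Suc.prems by (rule bounded_LipschitzE) blast
  have pm[measurable]: "\<phi> \<in> borel_measurable seq_law"
    using bounded_Lipschitz_measurable[OF Suc.prems] by (simp cong: measurable_cong_sets)
  have um[measurable]: "(\<lambda>(y, x). x(n := y)) \<in> measurable (marginal \<Otimes>\<^sub>M seq_law) seq_law"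
    unfolding seq_law_def case_prod_beta by (rule measurable_fun_upd[where J=UNIV]) auto
  have int: "integrable (marginal \<Otimes>\<^sub>M seq_law) (\<lambda>(y, x). \<phi> (x(n := y)))"
  proof (rule P.integrable_const_bound[of _ B])
    have "\<phi> \<circ> (\<lambda>(y, x). x(n := y)) \<in> borel_measurable (marginal \<Otimes>\<^sub>M seq_law)"
      by (rule measurable_comp[OF um pm])
    then show "(\<lambda>(y, x). \<phi> (x(n := y))) \<in> borel_measurable (marginal \<Otimes>\<^sub>M seq_law)"
      by (simp add: comp_def case_prod_beta)
  qed (use B in auto)
  have "law \<phi> = law (integrate_out n \<phi>)" by (rule law_integrate_out[OF Suc.prems])
  also have "\<dots> = (\<integral>x. integrate_out n \<phi> x \<partial>seq_law)"
    by (rule Suc.IH[OF integrate_out_bounded_Lipschitz[OF Suc.prems]])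
  also have "\<dots> = (\<integral>x. (\<integral>y. \<phi> (x(n := y)) \<partial>marginal) \<partial>seq_law)"
    unfolding integrate_out_def law1_eq_integral[OF real_BL_update[OF Suc.prems]] ..
  also have "\<dots> = (\<integral>z. (case z of (y, x) \<Rightarrow> \<phi> (x(n := y))) \<partial>(marginal \<Otimes>\<^sub>M seq_law))"
    by (rule integral_snd[OF int])
  also have "\<dots> = (\<integral>x. \<phi> x \<partial>distr (marginal \<Otimes>\<^sub>M seq_law) seq_law (\<lambda>(y, x). x(n := y)))"
    by (subst integral_distr[OF um pm]) (auto intro!: Bochner_Integration.integral_cong)
  also have "\<dots> = (\<integral>x. \<phi> x \<partial>seq_law)" by (simp only: seq_law_update)
  finally show ?case .
qed

lemma sample_measurable[measurable]: "sample \<in> measurable M borel"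
  by (rule measurable_coordinatewise_then_product) (simp add: sample_def)

lemma sample_vimage_sets: "B \<in> sets borel \<Longrightarrow> {\<omega>\<in>space M. sample \<omega> \<in> B} \<in> sets M"
  using measurable_sets[OF sample_measurable, of B] by (simp add: vimage_def Int_def conj_commute)

text \<open>The functions increasing to the indicator of U make the sets {\<phi> n >= 1} increase to
  U and the sets {\<phi> n < 1} decrease to the complement. Continuity of W from below and from
  above gives the two bounds separately, as complements cannot be exchanged for subtraction.\<close>

lemma W_open:
  assumes U: "open U"
  shows "W {\<omega>\<in>space M. sample \<omega> \<in> U} \<le> ereal (measure seq_law U)"
    and "ereal (1 - measure seq_law U) \<le> W {\<omega>\<in>space M. sample \<omega> \<notin> U}"
proof -
  interpret S: prob_space seq_law by (rule prob_space_seq_law)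
  from open_eq_Union_bounded_Lipschitz[OF U] obtain \<phi> :: "nat \<Rightarrow> (nat \<Rightarrow> real) \<Rightarrow> real" where
    \<phi>: "\<And>n. \<phi> n \<in> bounded_Lipschitz n" "\<And>n x. 0 \<le> \<phi> n x" "\<And>n x. \<phi> n x \<le> indicator U x"
    "\<And>n x. \<phi> n x \<le> \<phi> (Suc n) x" "\<And>x. x \<in> U \<Longrightarrow> \<exists>n. \<phi> n x = 1" by blast
  have mono: "\<phi> m x \<le> \<phi> n x" if "m \<le> n" for m n x
    using that \<phi>(4) by (rule lift_Suc_mono_le[rotated])
  have le1: "\<phi> n x \<le> 1" for n x using \<phi>(3)[of n x] by (cases "x \<in> U") auto
  have pm[measurable]: "\<phi> n \<in> borel_measurable borel" for n by (rule bounded_Lipschitz_measurable[OF \<phi>(1)])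
  have Um[measurable]: "U \<in> sets borel" using U by simp
  have int: "(\<integral>x. \<phi> n x \<partial>seq_law) \<le> measure seq_law U" for n
  proof -
    have "(\<integral>x. \<phi> n x \<partial>seq_law) \<le> (\<integral>x. indicator U x \<partial>seq_law)"
    proof (rule Bochner_Integration.integral_mono)
      show "integrable seq_law (\<phi> n)"
        by (rule S.integrable_const_bound[of _ 1]) (use \<phi>(2) le1 in auto)
      show "integrable seq_law (indicator U :: _ \<Rightarrow> real)"
        by (rule integrable_real_indicator) (auto simp: S.emeasure_eq_measure)
    qed (rule \<phi>(3))
    then show ?thesis by simp
  qed
  have E: "E (\<lambda>\<omega>. \<psi> (sample \<omega>)) = ereal (\<integral>x. \<psi> x \<partial>seq_law)" "(\<lambda>\<omega>. \<psi> (sample \<omega>)) \<in> H"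
    if "\<psi> \<in> bounded_Lipschitz n" for \<psi> n
    using E_eq_law[OF that] seq_in_H[OF that] law_eq_integral[OF that] by (simp_all add: sample_def[abs_def])
  let ?A = "\<lambda>n. {\<omega>\<in>space M. 1 \<le> \<phi> n (sample \<omega>)}"
  have "(\<lambda>n. W (?A n)) \<longlonglongrightarrow> W (\<Union>n. ?A n)"
    by (rule W_incseq) (use mono in \<open>auto simp: incseq_def intro: order_trans\<close>)
  moreover have "(\<Union>n. ?A n) = {\<omega>\<in>space M. sample \<omega> \<in> U}"
  proof (intro equalityI subsetI)
    fix \<omega> assume "\<omega> \<in> (\<Union>n. ?A n)"
    then obtain n where "\<omega> \<in> space M" "1 \<le> \<phi> n (sample \<omega>)" by blast
    then show "\<omega> \<in> {\<omega>\<in>space M. sample \<omega> \<in> U}"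
      using \<phi>(3)[of n "sample \<omega>"] by (cases "sample \<omega> \<in> U") auto
  next
    fix \<omega> assume *: "\<omega> \<in> {\<omega>\<in>space M. sample \<omega> \<in> U}"
    then obtain n where "\<phi> n (sample \<omega>) = 1" using \<phi>(5) by blast
    then have "\<omega> \<in> ?A n" using * by simp
    then show "\<omega> \<in> (\<Union>n. ?A n)" by blast
  qed
  moreover have "W (?A n) \<le> ereal (measure seq_law U)" for n
  proof -
    have "W (?A n) \<le> E (\<lambda>\<omega>. \<phi> n (sample \<omega>))"
      by (rule W_le_E[OF _ E(2)[OF \<phi>(1)]]) (use \<phi>(2) in \<open>auto simp: indicator_def\<close>)
    then show ?thesis using int[of n] unfolding E(1)[OF \<phi>(1)] by (auto intro: order_trans)
  qed
  ultimately show "W {\<omega>\<in>space M. sample \<omega> \<in> U} \<le> ereal (measure seq_law U)"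
    by (intro LIMSEQ_le_const2) auto
  let ?B = "\<lambda>n. {\<omega>\<in>space M. \<phi> n (sample \<omega>) < 1}"
  have "(\<lambda>n. W (?B n)) \<longlonglongrightarrow> W (\<Inter>n. ?B n)"
    by (rule W_decseq) (use mono in \<open>auto simp: decseq_def intro: le_less_trans\<close>)
  moreover have "(\<Inter>n. ?B n) = {\<omega>\<in>space M. sample \<omega> \<notin> U}"
  proof (intro equalityI subsetI)
    fix \<omega> assume *: "\<omega> \<in> (\<Inter>n. ?B n)"
    have "\<phi> n (sample \<omega>) \<noteq> 1" for n
    proof -
      have "\<omega> \<in> ?B n" using * by blast
      then show ?thesis by auto
    qed
    then show "\<omega> \<in> {\<omega>\<in>space M. sample \<omega> \<notin> U}" using * \<phi>(5) by blast
  next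
    fix \<omega> assume *: "\<omega> \<in> {\<omega>\<in>space M. sample \<omega> \<notin> U}"
    have "\<phi> n (sample \<omega>) < 1" for n
    proof -
      have "\<phi> n (sample \<omega>) \<le> 0" using \<phi>(3)[of n "sample \<omega>"] * by simp
      then show ?thesis by linarith
    qed
    then show "\<omega> \<in> (\<Inter>n. ?B n)" using * by auto
  qed
  moreover have "ereal (1 - measure seq_law U) \<le> W (?B n)" for n
  proof -
    have BL: "(\<lambda>x. 1 - \<phi> n x) \<in> bounded_Lipschitz n"
      by (intro bounded_Lipschitz_diff bounded_Lipschitz_const \<phi>(1))
    have "integrable seq_law (\<phi> n)"
      by (rule S.integrable_const_bound[of _ 1]) (use \<phi>(2) le1 in auto)
    then have "(\<integral>x. 1 - \<phi> n x \<partial>seq_law) = 1 - (\<integral>x. \<phi> n x \<partial>seq_law)"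
      using S.prob_space by (subst Bochner_Integration.integral_diff) auto
    then have "ereal (1 - measure seq_law U) \<le> E (\<lambda>\<omega>. 1 - \<phi> n (sample \<omega>))"
      unfolding E(1)[OF BL] using int[of n] by simp
    also have "\<dots> \<le> W (?B n)"
      by (rule E_le_W[OF _ E(2)[OF BL]]) (use \<phi>(2) le1 in \<open>auto simp: indicator_def order_less_le\<close>)
    finally show ?thesis .
  qed
  ultimately show "ereal (1 - measure seq_law U) \<le> W {\<omega>\<in>space M. sample \<omega> \<notin> U}"
    by (intro LIMSEQ_le_const) auto
qed

text \<open>A null set of the finite Borel measure \<open>seq_law\<close> has open neighbourhoods of
  arbitrarily small measure. The second claim goes through the complements of these neighbourhoods
  and is not a consequence of the first for a general monotone W.\<close>

lemma W_null:
  assumes N: "N \<in> null_sets seq_law"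
  shows "W {\<omega>\<in>space M. sample \<omega> \<in> N} = 0" "1 \<le> W {\<omega>\<in>space M. sample \<omega> \<notin> N}"
proof -
  interpret S: prob_space seq_law by (rule prob_space_seq_law)
  have Nb: "N \<in> sets borel" using N by (auto simp: null_sets_def)
  have approx: "\<exists>U. open U \<and> N \<subseteq> U \<and> measure seq_law U < e" if e: "0 < e" for e
  proof -
    have "(INF U \<in> {U. N \<subseteq> U \<and> open U}. emeasure seq_law U) = 0"
      using outer_regular[OF sets_seq_law _ Nb] N by (simp add: S.emeasure_eq_measure null_sets_def)
    also have "0 < ennreal e" using e by simp
    finally obtain U where "N \<subseteq> U" "open U" "emeasure seq_law U < ennreal e"
      by (auto simp: INF_less_iff)
    then show ?thesis using e by (auto simp: S.emeasure_eq_measure ennreal_less_iff)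
  qed
  have "W {\<omega>\<in>space M. sample \<omega> \<in> N} \<le> 0"
  proof (rule ereal_le_epsilon2)
    fix e :: real assume "0 < e"
    then obtain U where U: "open U" "N \<subseteq> U" "measure seq_law U < e" using approx by blast
    have "W {\<omega>\<in>space M. sample \<omega> \<in> N} \<le> W {\<omega>\<in>space M. sample \<omega> \<in> U}"
      using U(2) by (intro W_mono) auto
    also have "\<dots> \<le> ereal (measure seq_law U)" by (rule W_open(1)[OF U(1)])
    also have "\<dots> \<le> 0 + ereal e" using U(3) by simp
    finally show "W {\<omega>\<in>space M. sample \<omega> \<in> N} \<le> 0 + ereal e" .
  qed
  then show "W {\<omega>\<in>space M. sample \<omega> \<in> N} = 0" using W_nonneg by (rule antisym)
  show "1 \<le> W {\<omega>\<in>space M. sample \<omega> \<notin> N}"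
  proof (rule ereal_le_epsilon2)
    fix e :: real assume "0 < e"
    then obtain U where U: "open U" "N \<subseteq> U" "measure seq_law U < e" using approx by blast
    have "1 \<le> ereal (1 - measure seq_law U) + ereal e" using U(3) by (simp add: one_ereal_def)
    also have "\<dots> \<le> W {\<omega>\<in>space M. sample \<omega> \<notin> U} + ereal e"
      by (intro add_right_mono W_open(2) U(1))
    also have "\<dots> \<le> W {\<omega>\<in>space M. sample \<omega> \<notin> N} + ereal e"
      using U(2) by (intro add_right_mono W_mono) auto
    finally show "1 \<le> W {\<omega>\<in>space M. sample \<omega> \<notin> N} + ereal e" .
  qed
qed

end

section \<open>Mean and variance of the marginal by truncation\<close>

definition clamp_at :: "real \<Rightarrow> real \<Rightarrow> real" where
  "clamp_at r y = max (- r) (min r y)"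

lemma clamp_at_real_BL: "0 \<le> r \<Longrightarrow> clamp_at r \<in> real_BL"
  by (rule real_BL_I[of 1 _ r]) (auto simp: clamp_at_def)

lemma abs_clamp_at: "0 \<le> r \<Longrightarrow> \<bar>clamp_at r y\<bar> = min r \<bar>y\<bar>"
  unfolding clamp_at_def by linarith

lemma real_BL_mult: "f \<in> real_BL \<Longrightarrow> g \<in> real_BL \<Longrightarrow> (\<lambda>x. f x * g x) \<in> real_BL"
  by (rule real_BL_coordI) (rule bounded_Lipschitz_mult; rule real_BL_coord)

lemma clamp_at_square: "0 \<le> r \<Longrightarrow> y\<^sup>2 = (clamp_at r y)\<^sup>2 + max (y\<^sup>2 - r\<^sup>2) 0"
proof -
  assume r: "0 \<le> r"
  show ?thesis
  proof (cases "\<bar>y\<bar> \<le> r")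
    case True
    then have "y\<^sup>2 \<le> r\<^sup>2" by (simp add: abs_le_square_iff[symmetric])
    then show ?thesis using True by (auto simp: clamp_at_def max_def min_def)
  next
    case False
    then have "r\<^sup>2 \<le> y\<^sup>2" using r by (simp add: abs_le_square_iff[symmetric])
    moreover have "(clamp_at r y)\<^sup>2 = r\<^sup>2" using False r by (auto simp: clamp_at_def max_def min_def)
    ultimately show ?thesis by simp
  qed
qed

text \<open>For |y| > r >= 1 the excess |y| - r is at most (|y| - r)(|y| + r). So the truncation
  error of the first moment is controlled by the same quantity as that of the second.\<close>

lemma abs_diff_clamp_at_le:
  assumes "1 \<le> r"
  shows "\<bar>y - clamp_at r y\<bar> \<le> max (y\<^sup>2 - r\<^sup>2) 0"
proof (cases "\<bar>y\<bar> \<le> r")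
  case False
  have eq: "\<bar>y - clamp_at r y\<bar> = \<bar>y\<bar> - r" using False assms by (auto simp: clamp_at_def max_def min_def)
  have "(\<bar>y\<bar> - r) * 1 \<le> (\<bar>y\<bar> - r) * (\<bar>y\<bar> + r)" using False assms by (intro mult_left_mono) auto
  also have "\<dots> = y\<^sup>2 - r\<^sup>2" by (simp add: algebra_simps power2_eq_square)
  finally show ?thesis using eq by simp
qed (auto simp: clamp_at_def)

lemma C_l_Lip_of_square:
  assumes g: "\<And>a b :: real. \<bar>g a - g b\<bar> \<le> \<bar>a - b\<bar>"
  shows "(\<lambda>z. g ((z 0)\<^sup>2)) \<in> C_l_Lip 1"
proof -
  have "\<bar>g ((x 0)\<^sup>2) - g ((y 0)\<^sup>2)\<bar> \<le> 1 * (1 + vnorm 1 x ^ 1 + vnorm 1 y ^ 1) * vnorm 1 (\<lambda>i. x i - y i)" for x y :: "nat \<Rightarrow> real"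
  proof -
    have "\<bar>g ((x 0)\<^sup>2) - g ((y 0)\<^sup>2)\<bar> \<le> \<bar>(x 0)\<^sup>2 - (y 0)\<^sup>2\<bar>" by (rule g)
    also have "\<dots> = \<bar>x 0 + y 0\<bar> * \<bar>x 0 - y 0\<bar>"
      by (simp add: power2_eq_square square_diff_square_factored abs_mult)
    also have "\<dots> \<le> (1 + \<bar>x 0\<bar> + \<bar>y 0\<bar>) * \<bar>x 0 - y 0\<bar>" by (intro mult_right_mono) auto
    finally show ?thesis by (simp add: vnorm_1)
  qed
  then show ?thesis unfolding C_l_Lip_def by (intro CollectI exI[of _ 1] conjI exI[of _ "1::nat"]) auto
qed

context continuous_capacity
begin

lemma distr_seq_law_coord: "distr seq_law borel (\<lambda>x. x i) = marginal"
proof -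
  have "distr seq_law borel (\<lambda>x. x i) = distr seq_law marginal (\<lambda>x. x i)"
    by (rule distr_cong) auto
  also have "\<dots> = marginal"
    unfolding seq_law_def by (rule distr_PiM_component) (auto intro: prob_space_marginal)
  finally show ?thesis .
qed

lemma coord_measurable: "(\<lambda>x. x i) \<in> borel_measurable seq_law"
proof -
  have "(\<lambda>x. x i) \<in> measurable seq_law marginal"
    unfolding seq_law_def by (rule measurable_component_singleton) simp
  then show ?thesis by (simp cong: measurable_cong_sets)
qed

lemma indep_coords: "prob_space.indep_vars seq_law (\<lambda>_. borel) (\<lambda>i x. x i) UNIV"
proof -
  interpret S: prob_space seq_law by (rule prob_space_seq_law)
  have "distr seq_law (PiM UNIV (\<lambda>_. borel)) (\<lambda>x. \<lambda>i\<in>UNIV. x i) = distr seq_law seq_law (\<lambda>x. x)"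
    by (rule distr_cong) (auto simp: sets_PiM_equal_borel)
  also have "\<dots> = seq_law" by (rule distr_id)
  also have "\<dots> = PiM UNIV (\<lambda>i. distr seq_law borel (\<lambda>x. x i))"
    unfolding distr_seq_law_coord by (rule seq_law_def)
  finally show ?thesis by (subst S.indep_vars_iff_distr_eq_PiM) (auto intro: coord_measurable)
qed

lemma square_in_H: "(\<lambda>\<omega>. (X 1 \<omega>)\<^sup>2) \<in> H" "(\<lambda>\<omega>. - (X 1 \<omega>)\<^sup>2) \<in> H" "(\<lambda>\<omega>. max ((X 1 \<omega>)\<^sup>2 - c) 0) \<in> H"
  using in_H[OF C_l_Lip_of_square[of "\<lambda>a. a"], of "\<lambda>_. X 1"]
    in_H[OF C_l_Lip_of_square[of "\<lambda>a. - a"], of "\<lambda>_. X 1"]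
    in_H[OF C_l_Lip_of_square[of "\<lambda>a. max (a - c) 0"], of "\<lambda>_. X 1"] rv[of 1]
  by auto

lemma H_cmult: "Y \<in> H \<Longrightarrow> (\<lambda>\<omega>. c * Y \<omega>) \<in> H"
  using space unfolding sublinear_expectation_space_def random_variable_space_def by blast

lemma real_BL_in_H: "f \<in> real_BL \<Longrightarrow> (\<lambda>\<omega>. f (X 1 \<omega>)) \<in> H"
  using in_H[OF bounded_Lipschitz_C_l_Lip[OF real_BL_coord], of f "\<lambda>_. X 1"] rv[of 1] by simp

context
  fixes \<sigma> :: real
  assumes trunc: "((\<lambda>c::real. E (\<lambda>\<omega>. max ((X 1 \<omega>)\<^sup>2 - c) 0)) \<longlongrightarrow> 0) at_top"
    and mean: "E (X 1) = 0" "E (\<lambda>\<omega>. - X 1 \<omega>) = 0"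
    and \<sigma>: "0 \<le> \<sigma>" "ereal (\<sigma>\<^sup>2) = E (\<lambda>\<omega>. (X 1 \<omega>)\<^sup>2)"
begin

definition excess :: "nat \<Rightarrow> ereal" where
  "excess n = E (\<lambda>\<omega>. max ((X 1 \<omega>)\<^sup>2 - (real n)\<^sup>2) 0)"

lemma excess_nonneg: "0 \<le> excess n"
  unfolding excess_def zero_ereal_def E_const[symmetric] by (intro E_mono const_in_H square_in_H) auto

lemma excess_tendsto: "excess \<longlonglongrightarrow> 0"
proof -
  have "filterlim (\<lambda>n. (real n)\<^sup>2) at_top sequentially" by real_asymp
  then show ?thesis unfolding excess_def[abs_def] by (rule filterlim_compose[OF trunc])
qed

text \<open>The clamped square is a bounded Lipschitz function, so its expectation is an integral.
  It lies below \<open>\<sigma>\<^sup>2\<close> by monotonicity and above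
  \<open>\<sigma>\<^sup>2 - excess n\<close> by subadditivity, and the truncation hypothesis closes
  the gap.\<close>

lemma clamp_square_integral_tendsto: "(\<lambda>n. \<integral>y. (clamp_at (real n) y)\<^sup>2 \<partial>marginal) \<longlonglongrightarrow> \<sigma>\<^sup>2"
proof -
  let ?f = "\<lambda>n y. (clamp_at (real n) y)\<^sup>2"
  have BL: "?f n \<in> real_BL" for n unfolding power2_eq_square by (intro real_BL_mult clamp_at_real_BL) auto
  have e: "E (\<lambda>\<omega>. ?f n (X 1 \<omega>)) = ereal (\<integral>y. ?f n y \<partial>marginal)" for n
    using E_term_eq_law1[OF BL, of 1] law1_eq_integral[OF BL] by simp
  have up: "ereal (\<integral>y. ?f n y \<partial>marginal) \<le> ereal (\<sigma>\<^sup>2)" for n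
    unfolding e[symmetric] \<sigma>(2)
  proof (rule E_mono[OF real_BL_in_H[OF BL] square_in_H(1)])
    show "(clamp_at (real n) (X 1 \<omega>))\<^sup>2 \<le> (X 1 \<omega>)\<^sup>2" for \<omega>
      using clamp_at_square[of "real n" "X 1 \<omega>"] by simp
  qed
  have low: "ereal (\<sigma>\<^sup>2) - excess n \<le> ereal (\<integral>y. ?f n y \<partial>marginal)" for n
  proof -
    have "ereal (\<sigma>\<^sup>2) = E (\<lambda>\<omega>. ?f n (X 1 \<omega>) + max ((X 1 \<omega>)\<^sup>2 - (real n)\<^sup>2) 0)"
      unfolding \<sigma>(2) by (rule arg_cong[of _ _ E], rule ext, rule clamp_at_square) simp
    also have "\<dots> \<le> E (\<lambda>\<omega>. ?f n (X 1 \<omega>)) + excess n"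
      unfolding excess_def
      by (rule E_add_le[OF real_BL_in_H[OF BL] square_in_H(3)])
        (use excess_nonneg[of n] in \<open>simp_all only: e excess_def, auto\<close>)
    finally show ?thesis unfolding e using excess_nonneg[of n] by (cases "excess n") auto
  qed
  have lim: "(\<lambda>n. ereal (\<sigma>\<^sup>2) - excess n) \<longlonglongrightarrow> ereal (\<sigma>\<^sup>2)"
    using tendsto_diff_ereal[OF _ _ tendsto_const excess_tendsto, of "ereal (\<sigma>\<^sup>2)"] by simp
  have "(\<lambda>n. ereal (\<integral>y. ?f n y \<partial>marginal)) \<longlonglongrightarrow> ereal (\<sigma>\<^sup>2)"
    by (rule tendsto_sandwich[OF always_eventually always_eventually lim tendsto_const]) (use low up in blast)+
  then show ?thesis by simp
qed

lemma clamp_at_eventually_eq: "eventually (\<lambda>n. clamp_at (real n) y = y) sequentially"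
proof -
  have "eventually (\<lambda>n. \<bar>y\<bar> \<le> real n) sequentially"
    using filterlim_real_sequentially by (simp add: filterlim_at_top)
  then show ?thesis by eventually_elim (auto simp: clamp_at_def)
qed

lemma marginal_ident: "(\<lambda>y. y) \<in> borel_measurable marginal"
  by (rule measurable_ident_sets[OF sets_marginal])

lemma clamp_at_measurable: "(\<lambda>y. clamp_at r y) \<in> borel_measurable marginal"
  unfolding clamp_at_def by (intro borel_measurable_max borel_measurable_min marginal_ident borel_measurable_const)

lemma marginal_square: "integrable marginal (\<lambda>y. y\<^sup>2)" "(\<integral>y. y\<^sup>2 \<partial>marginal) = \<sigma>\<^sup>2"
proof -
  interpret G: prob_space marginal by (rule prob_space_marginal)
  have m: "(\<lambda>y. (clamp_at r y)\<^sup>2) \<in> borel_measurable marginal" for r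
    by (intro borel_measurable_power clamp_at_measurable)
  have int: "integrable marginal (\<lambda>y. (clamp_at (real n) y)\<^sup>2)" for n
  proof (rule G.integrable_const_bound[of _ "(real n)\<^sup>2"])
    have "(clamp_at (real n) y)\<^sup>2 \<le> (real n)\<^sup>2" for y
      unfolding abs_le_square_iff[symmetric] by (simp add: abs_clamp_at)
    then show "AE y in marginal. norm ((clamp_at (real n) y)\<^sup>2) \<le> (real n)\<^sup>2"
      by (intro AE_I2) (simp only: real_norm_def abs_power2)
  qed (rule m)
  have mono: "mono (\<lambda>n. (clamp_at (real n) y)\<^sup>2)" for y
  proof (rule monoI)
    fix m n :: nat assume "m \<le> n"
    then have "\<bar>clamp_at (real m) y\<bar> \<le> \<bar>clamp_at (real n) y\<bar>" by (auto simp: abs_clamp_at)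
    then show "(clamp_at (real m) y)\<^sup>2 \<le> (clamp_at (real n) y)\<^sup>2" by (simp only: abs_le_square_iff)
  qed
  have lim: "(\<lambda>n. (clamp_at (real n) y)\<^sup>2) \<longlonglongrightarrow> y\<^sup>2" for y
    using clamp_at_eventually_eq[of y] by (intro tendsto_eventually) (auto elim: eventually_mono)
  show "integrable marginal (\<lambda>y. y\<^sup>2)"
    by (rule integrable_monotone_convergence[OF int _ _ clamp_square_integral_tendsto])
      (intro AE_I2 mono lim borel_measurable_power marginal_ident)+
  show "(\<integral>y. y\<^sup>2 \<partial>marginal) = \<sigma>\<^sup>2"
    by (rule integral_monotone_convergence[OF int _ _ clamp_square_integral_tendsto])
      (intro AE_I2 mono lim borel_measurable_power marginal_ident)+
qed

text \<open>The clamped mean is at most \<open>excess n\<close> because \<open>E (X 1) = 0\<close>,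
  and at least \<open>- excess n\<close> because \<open>E (- X 1) = 0\<close>; one-sided information
  would not suffice for a sublinear E. Dominated convergence then removes the clamp.\<close>

lemma marginal_mean: "(\<integral>y. y \<partial>marginal) = 0"
proof -
  interpret G: prob_space marginal by (rule prob_space_marginal)
  have y_int: "integrable marginal (\<lambda>y. y)"
    by (rule G.square_integrable_imp_integrable[OF marginal_ident marginal_square(1)])
  let ?m = "\<lambda>n. \<integral>y. clamp_at (real n) y \<partial>marginal"
  have BL: "clamp_at (real n) \<in> real_BL" for n by (rule clamp_at_real_BL) simp
  note BL' = real_BL_uminus[OF BL]
  have XH: "X 1 \<in> H" "(\<lambda>\<omega>. - X 1 \<omega>) \<in> H"
  proof -
    show "X 1 \<in> H" by (rule rv) simp
    then have "(\<lambda>\<omega>. (- 1) * X 1 \<omega>) \<in> H" by (rule H_cmult)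
    then show "(\<lambda>\<omega>. - X 1 \<omega>) \<in> H" by simp
  qed
  have pos: "ereal (?m n) \<le> excess n" if "1 \<le> n" for n
  proof -
    have "ereal (?m n) = E (\<lambda>\<omega>. clamp_at (real n) (X 1 \<omega>))"
      by (simp only: E_term_eq_law1[OF BL order_refl] law1_eq_integral[OF BL])
    also have "\<dots> \<le> E (\<lambda>\<omega>. X 1 \<omega> + max ((X 1 \<omega>)\<^sup>2 - (real n)\<^sup>2) 0)"
    proof (rule E_mono[OF real_BL_in_H[OF BL] H_add[OF XH(1) square_in_H(3)]])
      show "clamp_at (real n) (X 1 \<omega>) \<le> X 1 \<omega> + max ((X 1 \<omega>)\<^sup>2 - (real n)\<^sup>2) 0" for \<omega>
        using abs_diff_clamp_at_le[of "real n" "X 1 \<omega>"] that by linarith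
    qed
    also have "\<dots> \<le> E (X 1) + excess n"
      unfolding excess_def by (rule E_add_le[OF XH(1) square_in_H(3)]) (simp_all add: mean del: One_nat_def)
    finally show ?thesis by (simp add: mean del: One_nat_def)
  qed
  have neg: "ereal (- ?m n) \<le> excess n" if "1 \<le> n" for n
  proof -
    have "ereal (- ?m n) = E (\<lambda>\<omega>. - clamp_at (real n) (X 1 \<omega>))"
      by (simp only: E_term_eq_law1[OF BL' order_refl] law1_eq_integral[OF BL'] Bochner_Integration.integral_minus)
    also have "\<dots> \<le> E (\<lambda>\<omega>. - X 1 \<omega> + max ((X 1 \<omega>)\<^sup>2 - (real n)\<^sup>2) 0)"
    proof (rule E_mono[OF real_BL_in_H[OF BL'] H_add[OF XH(2) square_in_H(3)]])
      show "- clamp_at (real n) (X 1 \<omega>) \<le> - X 1 \<omega> + max ((X 1 \<omega>)\<^sup>2 - (real n)\<^sup>2) 0" for \<omega>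
        using abs_diff_clamp_at_le[of "real n" "X 1 \<omega>"] that by linarith
    qed
    also have "\<dots> \<le> E (\<lambda>\<omega>. - X 1 \<omega>) + excess n"
      unfolding excess_def by (rule E_add_le[OF XH(2) square_in_H(3)]) (simp_all add: mean del: One_nat_def)
    finally show ?thesis by (simp add: mean del: One_nat_def)
  qed
  have "(\<lambda>n. ereal \<bar>?m n\<bar>) \<longlonglongrightarrow> 0"
  proof (rule tendsto_sandwich[OF _ _ tendsto_const excess_tendsto])
    show "eventually (\<lambda>n. ereal \<bar>?m n\<bar> \<le> excess n) sequentially"
      using eventually_ge_at_top[of 1]
    proof eventually_elim
      case (elim n)
      show ?case using pos[OF elim] neg[OF elim] by (cases "0 \<le> ?m n") (simp_all only: abs_of_nonneg abs_of_neg not_le)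
    qed
  qed simp
  then have "(\<lambda>n. \<bar>?m n\<bar>) \<longlonglongrightarrow> 0" by (simp add: zero_ereal_def)
  then have "?m \<longlonglongrightarrow> 0" by (rule tendsto_rabs_zero_cancel)
  moreover have "?m \<longlonglongrightarrow> (\<integral>y. y \<partial>marginal)"
  proof (rule integral_dominated_convergence[where w="\<lambda>y. \<bar>y\<bar>"])
    show "AE y in marginal. (\<lambda>n. clamp_at (real n) y) \<longlonglongrightarrow> y"
      using clamp_at_eventually_eq by (intro AE_I2 tendsto_eventually)
    show "AE y in marginal. norm (clamp_at (real n) y) \<le> \<bar>y\<bar>" for n
      by (intro AE_I2) (simp add: abs_clamp_at)
    show "clamp_at (real n) \<in> borel_measurable marginal" for n
      using clamp_at_measurable[of "real n"] .
  qed (rule marginal_ident integrable_abs[OF y_int])+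
  ultimately show ?thesis by (rule LIMSEQ_unique[symmetric])
qed

lemma centered_iid_coords: "centered_iid_sequence seq_law (\<lambda>i x. x i) \<sigma>"
proof -
  interpret S: prob_space seq_law by (rule prob_space_seq_law)
  show ?thesis
  proof
    show "S.indep_vars (\<lambda>_. borel) (\<lambda>i x. x i) UNIV" by (rule indep_coords)
    show "distr seq_law borel (\<lambda>x. x n) = distr seq_law borel (\<lambda>x. x 0)" for n
      by (simp only: distr_seq_law_coord)
    have sq: "integrable (distr seq_law borel (\<lambda>x. x 0)) (\<lambda>y. y\<^sup>2)"
      unfolding distr_seq_law_coord by (rule marginal_square)
    show "integrable seq_law (\<lambda>x. (x 0)\<^sup>2)"
      using sq integrable_distr_eq[OF coord_measurable, of "\<lambda>y. y\<^sup>2" 0] by simp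
    have "(\<integral>y. y\<^sup>2 \<partial>distr seq_law borel (\<lambda>x. x 0)) = \<sigma>\<^sup>2"
      unfolding distr_seq_law_coord by (rule marginal_square)
    then show "S.expectation (\<lambda>x. (x 0)\<^sup>2) = \<sigma>\<^sup>2"
      using integral_distr[OF coord_measurable, of "\<lambda>y. y\<^sup>2" 0] by simp
    have "(\<integral>y. y \<partial>distr seq_law borel (\<lambda>x. x 0)) = 0"
      unfolding distr_seq_law_coord by (rule marginal_mean)
    then show "S.expectation (\<lambda>x. x 0) = 0"
      using integral_distr[OF coord_measurable, of "\<lambda>y. y" 0] by simp
  qed (rule \<sigma>)
qed

text \<open>G is the preimage of the complement of a null set and so is measurable. The events of
  the theorem are handled as supersets of G, where monotonicity of the capacity is enough.\<close>

lemma capacity_law_of_the_iterated_logarithm: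
  defines "s \<equiv> \<lambda>\<omega> n. (\<Sum>k=1..n. X k \<omega>) / sqrt (2 * real n * log_e (log_e (real n)))"
  obtains G where "G \<in> sets M" "1 \<le> W G" "W (space M - G) = 0"
    "\<And>\<omega>. \<omega> \<in> G \<Longrightarrow> limsup (\<lambda>n. ereal (s \<omega> n)) = ereal \<sigma> \<and>
       liminf (\<lambda>n. ereal (s \<omega> n)) = ereal (- \<sigma>) \<and> cluster_set (s \<omega>) = {- \<sigma>..\<sigma>}"
proof -
  interpret L: centered_iid_sequence seq_law "\<lambda>i x. x i" \<sigma> by (rule centered_iid_coords)
  have s_eq: "s \<omega> = L.lil_ratio (sample \<omega>)" for \<omega>
    by (rule ext) (simp only: s_def L.lil_ratio_def sample_def lil_norm_def loglog_def One_nat_def sum.atLeast1_atMost_eq)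
  from L.law_of_the_iterated_logarithm[unfolded eventually_ae_filter] obtain N where N: "N \<in> null_sets seq_law"
    "{x \<in> space seq_law. \<not> (limsup (\<lambda>n. ereal (L.lil_ratio x n)) = ereal \<sigma> \<and>
       liminf (\<lambda>n. ereal (L.lil_ratio x n)) = ereal (- \<sigma>) \<and> cluster_set (L.lil_ratio x) = {- \<sigma>..\<sigma>})} \<subseteq> N" ..
  show ?thesis
  proof (rule that[of "{\<omega>\<in>space M. sample \<omega> \<notin> N}"])
    have "N \<in> sets borel" using N(1) by (auto simp: null_sets_def)
    then have "{\<omega>\<in>space M. sample \<omega> \<in> - N} \<in> sets M" by (intro sample_vimage_sets) auto
    then show "{\<omega>\<in>space M. sample \<omega> \<notin> N} \<in> sets M" by simp
    show "1 \<le> W {\<omega>\<in>space M. sample \<omega> \<notin> N}" by (rule W_null(2)[OF N(1)])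
    have "space M - {\<omega>\<in>space M. sample \<omega> \<notin> N} = {\<omega>\<in>space M. sample \<omega> \<in> N}" by auto
    then show "W (space M - {\<omega>\<in>space M. sample \<omega> \<notin> N}) = 0"
      using W_null(1)[OF N(1)] by (simp only:)
    fix \<omega> assume "\<omega> \<in> {\<omega>\<in>space M. sample \<omega> \<notin> N}"
    then have "sample \<omega> \<notin> N" by simp
    show "limsup (\<lambda>n. ereal (s \<omega> n)) = ereal \<sigma> \<and>
       liminf (\<lambda>n. ereal (s \<omega> n)) = ereal (- \<sigma>) \<and> cluster_set (s \<omega>) = {- \<sigma>..\<sigma>}"
      unfolding s_eq
    proof (rule ccontr)
      assume "\<not> (limsup (\<lambda>n. ereal (L.lil_ratio (sample \<omega>) n)) = ereal \<sigma> \<and>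
        liminf (\<lambda>n. ereal (L.lil_ratio (sample \<omega>) n)) = ereal (- \<sigma>) \<and>
        cluster_set (L.lil_ratio (sample \<omega>)) = {- \<sigma>..\<sigma>})"
      then have "sample \<omega> \<in> N"
        by (intro subsetD[OF N(2)] CollectI conjI) (simp only: space_seq_law UNIV_I)
      with \<open>sample \<omega> \<notin> N\<close> show False by (rule notE)
    qed
  qed
qed

end

end

section \<open>The upper capacity and its outer version\<close>

lemma upper_cap_le: "\<xi> \<in> H \<Longrightarrow> (\<And>\<omega>. \<omega> \<in> space M \<Longrightarrow> indicator A \<omega> \<le> \<xi> \<omega>) \<Longrightarrow> upper_cap M H E A \<le> E \<xi>"
  unfolding upper_cap_def by (rule Inf_lower) blast

lemma upper_cap_greatest:
  "(\<And>\<xi>. \<xi> \<in> H \<Longrightarrow> (\<And>\<omega>. \<omega> \<in> space M \<Longrightarrow> indicator A \<omega> \<le> \<xi> \<omega>) \<Longrightarrow> c \<le> E \<xi>) \<Longrightarrow> c \<le> upper_cap M H E A"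
  unfolding upper_cap_def by (rule Inf_greatest) blast

lemma upper_cap_mono: "A \<subseteq> B \<Longrightarrow> upper_cap M H E A \<le> upper_cap M H E B"
proof (rule upper_cap_greatest)
  fix \<xi> assume "A \<subseteq> B" "\<xi> \<in> H" and \<xi>: "\<And>\<omega>. \<omega> \<in> space M \<Longrightarrow> indicator B \<omega> \<le> \<xi> \<omega>"
  have "indicator A \<omega> \<le> \<xi> \<omega>" if "\<omega> \<in> space M" for \<omega>
  proof -
    have "indicator A \<omega> \<le> (indicator B \<omega> :: real)" using \<open>A \<subseteq> B\<close> by (auto simp: indicator_def)
    then show ?thesis using \<xi>[OF that] by (rule order_trans)
  qed
  with \<open>\<xi> \<in> H\<close> show "upper_cap M H E A \<le> E \<xi>" by (rule upper_cap_le)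
qed

context sublinear_iid_sequence
begin

lemma upper_cap_nonneg: "0 \<le> upper_cap M H E A"
proof (rule upper_cap_greatest)
  fix \<xi> assume "\<xi> \<in> H" "\<And>\<omega>. \<omega> \<in> space M \<Longrightarrow> indicator A \<omega> \<le> \<xi> \<omega>"
  then have "E (\<lambda>_. 0) \<le> E \<xi>"
    by (intro E_mono const_in_H) (auto intro: order_trans[OF indicator_pos_le])
  then show "0 \<le> E \<xi>" by (simp add: E_const zero_ereal_def)
qed

lemma upper_cap_le_1: "upper_cap M H E A \<le> 1"
  using upper_cap_le[OF const_in_H[of 1], of M A E] by (simp add: E_const one_ereal_def indicator_def)

lemma upper_cap_empty: "upper_cap M H E {} = 0"
  using upper_cap_le[OF const_in_H[of 0], of M "{}" E] upper_cap_nonneg[of "{}"]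
  by (simp add: E_const zero_ereal_def)

lemma E_le_upper_cap:
  assumes "\<xi> \<in> H" "\<And>\<omega>. \<omega> \<in> space M \<Longrightarrow> \<xi> \<omega> \<le> indicator A \<omega>"
  shows "E \<xi> \<le> upper_cap M H E A"
proof (rule upper_cap_greatest)
  fix \<eta> assume "\<eta> \<in> H" "\<And>\<omega>. \<omega> \<in> space M \<Longrightarrow> indicator A \<omega> \<le> \<eta> \<omega>"
  then show "E \<xi> \<le> E \<eta>" using assms by (intro E_mono) (auto intro: order_trans)
qed

lemma continuous_capacity_upper_cap:
  assumes "continuous_cap M (upper_cap M H E)"
  shows "continuous_capacity M H E X (upper_cap M H E)"
  by unfold_locales
    (auto intro: upper_cap_le E_le_upper_cap upper_cap_mono upper_cap_nonneg assms)

lemma outer_cap_nonneg: "0 \<le> outer_cap M (upper_cap M H E) A"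
  unfolding outer_cap_def by (rule Inf_greatest) (auto intro: suminf_nonneg summable_ereal_pos upper_cap_nonneg)

lemma outer_cap_le_upper_cap:
  assumes "A \<in> sets M"
  shows "outer_cap M (upper_cap M H E) A \<le> upper_cap M H E A"
proof -
  define B where "B n = (if n = 0 then A else {})" for n :: nat
  have "(\<Sum>n. upper_cap M H E (B n)) = (\<Sum>n\<in>{0}. upper_cap M H E (B n))"
    by (rule suminf_finite) (auto simp: B_def upper_cap_empty)
  also have "\<dots> = upper_cap M H E A" by (simp add: B_def)
  finally have "(\<Sum>n. upper_cap M H E (B n)) = upper_cap M H E A" .
  moreover have "range B \<subseteq> sets M" "A \<subseteq> (\<Union>n. B n)" using assms by (auto simp: B_def)
  ultimately show ?thesis unfolding outer_cap_def by (intro Inf_lower) (auto intro!: exI[of _ B])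
qed

text \<open>For a countable cover of A, choose majorants of the indicators that are optimal up to e
  / 2^(n+1). Their sum dominates \<open>\<xi>\<close> pointwise, and countable subadditivity
  transfers this to the expectations.\<close>

lemma E_le_outer_cap:
  assumes csub: "countably_subadditive_exp M H E" and \<xi>: "\<xi> \<in> H" "\<And>\<omega>. \<omega> \<in> space M \<Longrightarrow> 0 \<le> \<xi> \<omega>"
    "\<And>\<omega>. \<omega> \<in> space M \<Longrightarrow> \<xi> \<omega> \<le> indicator A \<omega>"
  shows "E \<xi> \<le> outer_cap M (upper_cap M H E) A"
  unfolding outer_cap_def
proof (rule Inf_greatest)
  fix v assume "v \<in> {(\<Sum>n. upper_cap M H E (B n)) | B :: nat \<Rightarrow> 'a set. range B \<subseteq> sets M \<and> A \<subseteq> (\<Union>n. B n)}"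
  then obtain B where B: "A \<subseteq> (\<Union>n. B n)" "v = (\<Sum>n. upper_cap M H E (B n))" by blast
  show "E \<xi> \<le> v"
  proof (rule ereal_le_epsilon2)
    fix e :: real assume e: "0 < e"
    have "\<exists>\<eta>. \<eta> \<in> H \<and> (\<forall>\<omega>\<in>space M. indicator (B n) \<omega> \<le> \<eta> \<omega>) \<and> E \<eta> \<le> upper_cap M H E (B n) + ereal (e * (1 / 2) ^ Suc n)" for n
    proof (rule ccontr)
      assume no: "\<not> ?thesis"
      have "upper_cap M H E (B n) + ereal (e * (1 / 2) ^ Suc n) \<le> upper_cap M H E (B n)"
      proof (rule upper_cap_greatest)
        fix \<eta> assume "\<eta> \<in> H" "\<And>\<omega>. \<omega> \<in> space M \<Longrightarrow> indicator (B n) \<omega> \<le> \<eta> \<omega>"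
        then have "\<not> E \<eta> \<le> upper_cap M H E (B n) + ereal (e * (1 / 2) ^ Suc n)" using no by blast
        then show "upper_cap M H E (B n) + ereal (e * (1 / 2) ^ Suc n) \<le> E \<eta>" by (simp only: not_le less_imp_le)
      qed
      \<comment> \<open>The contradiction uses that the upper capacity lies in [0, 1]: adding a
        positive amount to a finite value changes it.\<close>
      moreover have "0 < e * (1 / 2) ^ Suc n" using e by simp
      ultimately show False using upper_cap_nonneg[of "B n"] upper_cap_le_1[of "B n"]
        by (cases "upper_cap M H E (B n)") (auto simp: one_ereal_def simp del: power_Suc)
    qed
    then obtain \<eta> where \<eta>: "\<And>n. \<eta> n \<in> H" "\<And>n \<omega>. \<omega> \<in> space M \<Longrightarrow> indicator (B n) \<omega> \<le> \<eta> n \<omega>"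
      "\<And>n. E (\<eta> n) \<le> upper_cap M H E (B n) + ereal (e * (1 / 2) ^ Suc n)" by metis
    have \<eta>0: "0 \<le> \<eta> n \<omega>" if "\<omega> \<in> space M" for n \<omega>
      using \<eta>(2)[OF that, of n] by (rule order_trans[OF indicator_pos_le])
    have cover: "ereal (\<xi> \<omega>) \<le> (\<Sum>n. ereal (\<eta> n \<omega>))" if \<omega>: "\<omega> \<in> space M" for \<omega>
    proof (cases "\<omega> \<in> A")
      case True
      then obtain m where "\<omega> \<in> B m" using B(1) by blast
      then have "\<xi> \<omega> \<le> \<eta> m \<omega>" using \<xi>(3)[OF \<omega>] \<eta>(2)[OF \<omega>, of m] True by simp
      then have "ereal (\<xi> \<omega>) \<le> (\<Sum>n\<in>{m}. ereal (\<eta> n \<omega>))" by simp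
      also have "\<dots> \<le> (\<Sum>n. ereal (\<eta> n \<omega>))"
        by (rule sum_le_suminf) (use \<eta>0[OF \<omega>] in \<open>auto intro: summable_ereal_pos\<close>)
      finally show ?thesis .
    next
      case False
      then have "ereal (\<xi> \<omega>) \<le> 0" using \<xi>(3)[OF \<omega>] by (simp add: zero_ereal_def)
      also have "\<dots> \<le> (\<Sum>n. ereal (\<eta> n \<omega>))"
        by (rule suminf_nonneg) (use \<eta>0[OF \<omega>] in \<open>auto intro: summable_ereal_pos\<close>)
      finally show ?thesis .
    qed
    have E0: "0 \<le> E (\<eta> n)" for n
      using E_mono[OF const_in_H[of 0] \<eta>(1)[of n]] \<eta>0 by (simp add: E_const zero_ereal_def)
    have "E \<xi> \<le> (\<Sum>n. E (\<eta> n))"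
      using csub \<xi>(1,2) \<eta>(1) \<eta>0 cover unfolding countably_subadditive_exp_def by blast
    also have "\<dots> \<le> (\<Sum>n. upper_cap M H E (B n) + ereal (e * (1 / 2) ^ Suc n))"
      using \<eta>(3) E0 by (intro suminf_le summable_ereal_pos) (auto intro: order_trans)
    also have "\<dots> = v + (\<Sum>n. ereal (e * (1 / 2) ^ Suc n))"
      unfolding B(2) using e upper_cap_nonneg by (intro suminf_add_ereal) auto
    also have "(\<Sum>n. ereal (e * (1 / 2) ^ Suc n)) = ereal e"
    proof (rule sums_unique[symmetric])
      have "(\<lambda>n. e * (1 / 2) ^ Suc n) sums (e * 1)" by (intro sums_mult power_half_series)
      then show "(\<lambda>n. ereal (e * (1 / 2) ^ Suc n)) sums ereal e" by (simp add: sums_ereal)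
    qed
    finally show "E \<xi> \<le> v + ereal e" .
  qed
qed

lemma continuous_capacity_outer_cap:
  assumes "continuous_cap M (outer_cap M (upper_cap M H E))" "countably_subadditive_exp M H E"
  shows "continuous_capacity M H E X (outer_cap M (upper_cap M H E))"
proof unfold_locales
  let ?W = "outer_cap M (upper_cap M H E)"
  show "?W A \<le> E \<xi>" if "A \<in> sets M" "\<xi> \<in> H" "\<And>\<omega>. \<omega> \<in> space M \<Longrightarrow> indicator A \<omega> \<le> \<xi> \<omega>" for A \<xi>
    using outer_cap_le_upper_cap[OF that(1)] upper_cap_le[OF that(2,3)] by (rule order_trans)
  show "E \<xi> \<le> ?W A" if "\<xi> \<in> H" "\<And>\<omega>. \<omega> \<in> space M \<Longrightarrow> 0 \<le> \<xi> \<omega>" "\<And>\<omega>. \<omega> \<in> space M \<Longrightarrow> \<xi> \<omega> \<le> indicator A \<omega>" for A \<xi>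
    by (rule E_le_outer_cap[OF assms(2) that])
  show "?W A \<le> ?W B" if "A \<subseteq> B" for A B
    unfolding outer_cap_def
  proof (rule Inf_superset_mono, rule subsetI)
    fix v assume "v \<in> {(\<Sum>n. upper_cap M H E (D n)) | D :: nat \<Rightarrow> 'a set. range D \<subseteq> sets M \<and> B \<subseteq> (\<Union>n. D n)}"
    then obtain D :: "nat \<Rightarrow> 'a set" where "v = (\<Sum>n. upper_cap M H E (D n))" "range D \<subseteq> sets M" "B \<subseteq> (\<Union>n. D n)"
      by (elim CollectE exE conjE)
    moreover from this(3) that have "A \<subseteq> (\<Union>n. D n)" by (rule order_trans[rotated])
    ultimately show "v \<in> {(\<Sum>n. upper_cap M H E (D n)) | D :: nat \<Rightarrow> 'a set. range D \<subseteq> sets M \<and> A \<subseteq> (\<Union>n. D n)}"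
      by (intro CollectI exI[of _ D] conjI)
  qed
qed (rule outer_cap_nonneg assms(1))+

end

theorem corollary3p13:
  fixes M :: "'a measure"
    and H :: "('a \<Rightarrow> real) set"
    and E :: "('a \<Rightarrow> real) \<Rightarrow> ereal"
    and X :: "nat \<Rightarrow> 'a \<Rightarrow> real"
    and V Vlow Vst Vstlow :: "'a set \<Rightarrow> ereal"
    and x :: "'a \<Rightarrow> nat \<Rightarrow> real"
    and L U :: "'a \<Rightarrow> ereal"
    and C :: "'a \<Rightarrow> ereal set"
    and \<sigma>up \<sigma>low :: real
  assumes space: "sublinear_expectation_space M H E"
    and rv: "\<forall>n\<ge>1. X n \<in> H"
    and indep: "independent_seq H E X"
    and ident: "identically_distributed E X"
    and trunc: "((\<lambda>c::real. E (\<lambda>\<omega>. max ((X 1 \<omega>)\<^sup>2 - c) 0)) \<longlongrightarrow> 0) at_top"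
    and mean: "E (X 1) = 0" "E (\<lambda>\<omega>. - X 1 \<omega>) = 0"
    and V: "V = upper_cap M H E"
    and Vlow: "Vlow = conj_cap M V"
    and Vst: "Vst = outer_cap M V"
    and Vstlow: "Vstlow = conj_cap M Vst"
    and choq: "choquet M V (\<lambda>\<omega>. (X 1 \<omega>)\<^sup>2 / log_e (log_e \<bar>X 1 \<omega>\<bar>)) < \<infinity>"
    and x: "x = (\<lambda>\<omega> n. (\<Sum>k=1..n. X k \<omega>) / sqrt (2 * real n * log_e (log_e (real n))))"
    and L: "L = (\<lambda>\<omega>. liminf (\<lambda>n. ereal (x \<omega> n)))"
    and U: "U = (\<lambda>\<omega>. limsup (\<lambda>n. ereal (x \<omega> n)))"
    and C: "C = (\<lambda>\<omega>. ereal ` cluster_set (x \<omega>))"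
    and \<sigma>up: "\<sigma>up \<ge> 0" "ereal (\<sigma>up\<^sup>2) = E (\<lambda>\<omega>. (X 1 \<omega>)\<^sup>2)"
    and \<sigma>low: "\<sigma>low \<ge> 0" "ereal (\<sigma>low\<^sup>2) = conj_exp E (\<lambda>\<omega>. (X 1 \<omega>)\<^sup>2)"
  shows
    "(continuous_cap M V \<longrightarrow>
        V {\<omega>\<in>space M. C \<omega> = {L \<omega>..U \<omega>} \<and> {L \<omega>..U \<omega>} = {ereal (- \<sigma>up)..ereal \<sigma>up}} = 1 \<and>
        Vlow {\<omega>\<in>space M. ereal \<sigma>low \<le> U \<omega> \<and> U \<omega> \<le> ereal \<sigma>up} = 1 \<and>
        Vlow {\<omega>\<in>space M. ereal (- \<sigma>up) \<le> L \<omega> \<and> L \<omega> \<le> ereal (- \<sigma>low)} = 1 \<and>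
        Vlow {\<omega>\<in>space M. {ereal (- \<sigma>up)..ereal \<sigma>up} \<supseteq> C \<omega> \<and> C \<omega> = {L \<omega>..U \<omega>} \<and>
                          {L \<omega>..U \<omega>} \<supseteq> {ereal (- \<sigma>low)..ereal \<sigma>low}} = 1)
   \<and> (continuous_cap M Vst \<and> countably_subadditive_exp M H E \<longrightarrow>
        V {\<omega>\<in>space M. C \<omega> = {L \<omega>..U \<omega>} \<and> {L \<omega>..U \<omega>} = {ereal (- \<sigma>up)..ereal \<sigma>up}} = 1 \<and>
        Vstlow {\<omega>\<in>space M. ereal \<sigma>low \<le> U \<omega> \<and> U \<omega> \<le> ereal \<sigma>up} = 1 \<and>
        Vstlow {\<omega>\<in>space M. ereal (- \<sigma>up) \<le> L \<omega> \<and> L \<omega> \<le> ereal (- \<sigma>low)} = 1 \<and>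
        Vstlow {\<omega>\<in>space M. {ereal (- \<sigma>up)..ereal \<sigma>up} \<supseteq> C \<omega> \<and> C \<omega> = {L \<omega>..U \<omega>} \<and>
                            {L \<omega>..U \<omega>} \<supseteq> {ereal (- \<sigma>low)..ereal \<sigma>low}} = 1)"
proof -
  interpret sublinear_iid_sequence M H E X
    using space rv indep ident by unfold_locales auto
  let ?I = "{\<omega>\<in>space M. C \<omega> = {L \<omega>..U \<omega>} \<and> {L \<omega>..U \<omega>} = {ereal (- \<sigma>up)..ereal \<sigma>up}}"
  let ?II = "{\<omega>\<in>space M. ereal \<sigma>low \<le> U \<omega> \<and> U \<omega> \<le> ereal \<sigma>up}"
  let ?II' = "{\<omega>\<in>space M. ereal (- \<sigma>up) \<le> L \<omega> \<and> L \<omega> \<le> ereal (- \<sigma>low)}"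
  let ?III = "{\<omega>\<in>space M. {ereal (- \<sigma>up)..ereal \<sigma>up} \<supseteq> C \<omega> \<and> C \<omega> = {L \<omega>..U \<omega>} \<and>
    {L \<omega>..U \<omega>} \<supseteq> {ereal (- \<sigma>low)..ereal \<sigma>low}}"
  \<comment> \<open>Part (I) is always about V, also in the second case. The comparison of W with V
    on measurable sets carries the bound for G over to V.\<close>
  have main: "V ?I = 1 \<and> conj_cap M W ?II = 1 \<and> conj_cap M W ?II' = 1 \<and> conj_cap M W ?III = 1"
    if W: "continuous_capacity M H E X W" "\<And>A. A \<in> sets M \<Longrightarrow> W A \<le> V A" for W
  proof -
    interpret W: continuous_capacity M H E X W by (rule W(1))
    from W.capacity_law_of_the_iterated_logarithm[OF trunc mean \<sigma>up]
    obtain G where G: "G \<in> sets M" "1 \<le> W G" "W (space M - G) = 0"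
      "\<And>\<omega>. \<omega> \<in> G \<Longrightarrow> U \<omega> = ereal \<sigma>up \<and> L \<omega> = ereal (- \<sigma>up) \<and> cluster_set (x \<omega>) = {- \<sigma>up..\<sigma>up}"
      unfolding U L x by blast
    \<comment> \<open>Subadditivity applied to X^2 + (- X^2) = 0.\<close>
    have low_le_up: "\<sigma>low \<le> \<sigma>up"
    proof (rule power2_le_imp_le[OF _ \<sigma>up(1)])
      have "E (\<lambda>\<omega>. - (X 1 \<omega>)\<^sup>2) = ereal (- (\<sigma>low\<^sup>2))"
        using \<sigma>low(2) unfolding conj_exp_def by (metis ereal_uminus_uminus uminus_ereal.simps(1))
      then have "E (\<lambda>\<omega>. (X 1 \<omega>)\<^sup>2 + - (X 1 \<omega>)\<^sup>2) \<le> ereal (\<sigma>up\<^sup>2) + ereal (- (\<sigma>low\<^sup>2))"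
        using E_add_le[OF W.square_in_H(1,2)] \<sigma>up(2)[symmetric] by simp
      then show "\<sigma>low\<^sup>2 \<le> \<sigma>up\<^sup>2" by (simp add: E_const)
    qed
    have image: "ereal ` {- \<sigma>up..\<sigma>up} = {ereal (- \<sigma>up)..ereal \<sigma>up}"
    proof (intro equalityI subsetI)
      fix v assume "v \<in> {ereal (- \<sigma>up)..ereal \<sigma>up}"
      then show "v \<in> ereal ` {- \<sigma>up..\<sigma>up}" by (cases v) auto
    qed auto
    have CG: "C \<omega> = {ereal (- \<sigma>up)..ereal \<sigma>up}" if "\<omega> \<in> G" for \<omega>
      using G(4)[OF that] image by (simp add: C)
    have sub: "G \<subseteq> ?I" "G \<subseteq> ?II" "G \<subseteq> ?II'" "G \<subseteq> ?III"
      using sets.sets_into_space[OF G(1)] G(4) CG low_le_up \<sigma>low(1) \<sigma>up(1) by (auto intro: order_trans)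
    \<comment> \<open>The set A need not be measurable: the locale has monotonicity and
      nonnegativity of W for all sets, so the complement of A inherits capacity 0 from the
      complement of G.\<close>
    have conj1: "conj_cap M W A = 1" if "G \<subseteq> A" for A
    proof -
      have "W (space M - A) \<le> 0" using W.W_mono[of "space M - A" "space M - G"] that G(3) by auto
      then have "W (space M - A) = 0" using W.W_nonneg by (rule antisym)
      then show ?thesis by (simp add: conj_cap_def)
    qed
    have "1 \<le> V G" using G(2) W(2)[OF G(1)] by (rule order_trans)
    also have "V G \<le> V ?I" unfolding V by (rule upper_cap_mono[OF sub(1)])
    finally have "V ?I = 1" unfolding V by (intro antisym upper_cap_le_1)
    with sub(2-4) show ?thesis by (intro conjI conj1)
  qed
  have 1: "V ?I = 1 \<and> conj_cap M V ?II = 1 \<and> conj_cap M V ?II' = 1 \<and> conj_cap M V ?III = 1"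
    if "continuous_cap M V"
    using that unfolding V by (intro main[unfolded V] continuous_capacity_upper_cap order_refl)
  have 2: "V ?I = 1 \<and> conj_cap M Vst ?II = 1 \<and> conj_cap M Vst ?II' = 1 \<and> conj_cap M Vst ?III = 1"
    if "continuous_cap M Vst \<and> countably_subadditive_exp M H E"
    using that unfolding Vst V
    by (intro main[unfolded V] continuous_capacity_outer_cap outer_cap_le_upper_cap) auto
  show ?thesis
    unfolding Vlow Vstlow by (intro conjI[where P="_ \<longrightarrow> _"] impI) (rule 1, assumption, rule 2, assumption)
qed

end
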